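(* Let $K$ be a field of characteristic $p>0$, and let $G$ be one of the groups $Q_8$, $D_8$ (if $p=2$) or $H(p^3)$, $M(p^3)$ (if $p>2$). An extension $L/K$ is a Galois extension with $\mathrm{Gal}(L/K)\cong G$ if and only if $L=K(x_1,x_2,x_3)$ where \[x_1^p-x_1=\kappa_1,\qquad x_2^p-x_2=\kappa_2,\qquad x_3^p-x_3=\mathfrak{s}(x_1,x_2)+\kappa_3,\] for some $\kappa_1,\kappa_2,\kappa_3\in K$ such that $\kappa_1,\kappa_2$ represent $\mathbb{F}_p$-linearly independent cosets of $K/K^\wp$, and \[\mathfrak{s}(x_1,x_2)=-\kappa_2x_1+\begin{cases}\kappa_1x_1+\kappa_2x_2 & G=Q_8,\\ \kappa_1x_1 & G=D_8,\\ 0 & G=H(p^3),\\ S(x_1,\kappa_1) & G=M(p^3).\end{cases}\] Furthermore, the Galois group $\mathrm{Gal}(L/K)=\langle\sigma_1,\sigma_2,\sigma_3\rangle$ (with $\sigma_1,\sigma_2$ generators satisfying the given presentation of $G$ and $\sigma_3=[\sigma_1,\sigma_2]$) is determined by $(\sigma_i-1)x_j=\delta_{ij}$, the Kronecker delta, for all pairs $(i,j)$ with $1\le i,j\le 3$ except $(i,j)=(1,3)$ and $(i,j)=(2,3)$, for which \[(\sigma_1-1)x_3=-x_2+\begin{cases}x_1 & G=Q_8,\\ x_1 & G=D_8,\\ 0 & G=H(p^3),\\ S(x_1,1) & G=M(p^3),\end{cases}\qquad (\sigma_2-1)x_3=\begin{cases}x_2 & G=Q_8,\\ 0 & G=D_8,\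 H(p^3),\ M(p^3).\end{cases}\]
   Context: Notation. $\wp(X)=X^p-X$ and $K^\wp=\{\wp(k):k\in K\}$. $S(X_1,X_2)=\frac{X_1^p+X_2^p-(X_1+X_2)^p}{p}\in\mathbb{Z}[X_1,X_2]$ (evaluated in characteristic $p$ by reducing its integer coefficients mod $p$; for $p=2$ one has $S(x_1,\kappa_1)=\kappa_1x_1$). The elements $x_i$ lie in a separable closure of $K$. Commutators are $[\sigma_1,\sigma_2]=\sigma_1^{-1}\sigma_2^{-1}\sigma_1\sigma_2$. The nonabelian groups of order $p^3$ are presented as follows. For $p=2$: $Q_8=\langle\sigma_1,\sigma_2:\sigma_1^4=1,\ \sigma_1^2=\sigma_2^2=[\sigma_1,\sigma_2]\rangle$ and $D_8=\langle\sigma_1,\sigma_2:\sigma_1^4=\sigma_2^2=1,\ \sigma_1^2=[\sigma_1,\sigma_2]\rangle$. For $p>2$: $H(p^3)=\langle\sigma_1,\sigma_2:\sigma_1^p=\sigma_2^p=[\sigma_1,\sigma_2]^p=1,\ [\sigma_1,\sigma_2]\in Z(H(p^3))\rangle$ and $M(p^3)=\langle\sigma_1,\sigma_2:\sigma_1^{p^2}=\sigma_2^p=1,\ \sigma_1^p=[\sigma_1,\sigma_2]\rangle$. In every case $\sigma_3=[\sigma_1,\sigma_2]$ generates the center, which has order $p$. *)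

theory Defs
  imports
    "HOL-Algebra.Bij"
    "HOL-Algebra.Generated_Groups"
    "HOL-Algebra.Generated_Fields"
    "HOL-Algebra.Finite_Extensions"
    "HOL-Algebra.Algebraic_Closure_Type"
begin

text \<open>
  All fields are subfields of an arbitrary ambient field, the universe of a type \<open>'a :: field\<close>;
  \<^const>\<open>ring_of_type_algebra\<close> is that field as a HOL-Algebra structure. The ambient
  field may for instance be a separable closure of \<open>K\<close>, or \<open>L\<close> itself. Since a subfield contains
  the unit of the ambient field, the characteristic of \<open>K\<close> is \<open>CHAR('a)\<close>.
\<close>

section \<open>Galois extensions\<close>

definition as_field :: "'a::field set \<Rightarrow> 'a ring"
  where "as_field L = (ring_of_type_algebra :: 'a ring)\<lparr>carrier := L\<rparr>"

text \<open>
  The product in \<^const>\<open>BijGroup\<close> is composition of maps, so automorphisms act from the left.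
  As for \<^const>\<open>Bij\<close>, automorphisms are extensional: they are \<open>undefined\<close> outside \<open>L\<close>.
\<close>

definition Gal :: "'a::field set \<Rightarrow> 'a set \<Rightarrow> ('a \<Rightarrow> 'a) monoid"
  where "Gal L K = (BijGroup L)
    \<lparr>carrier := {\<sigma> \<in> Bij L. \<sigma> \<in> ring_iso (as_field L) (as_field L) \<and> (\<forall>k\<in>K. \<sigma> k = k)}\<rparr>"

definition galois_extension :: "'a::field set \<Rightarrow> 'a set \<Rightarrow> bool"
  where "galois_extension L K \<longleftrightarrow>
    subfield K ring_of_type_algebra \<and> subfield L ring_of_type_algebra \<and> K \<subseteq> L \<and>
    (\<forall>x\<in>L. ring.algebraic ring_of_type_algebra K x) \<and>
    {x \<in> L. \<forall>\<sigma>\<in>carrier (Gal L K). \<sigma> x = x} = K"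

definition adjoin :: "'a::field set \<Rightarrow> 'a set \<Rightarrow> 'a set"
  where "adjoin K A = generate_field ring_of_type_algebra (K \<union> A)"

section \<open>Groups given by generators and relations\<close>

text \<open>
  A letter \<open>(g, True)\<close> stands for the generator \<open>g\<close> and \<open>(g, False)\<close> for its inverse. Every element
  of the type \<open>'g\<close> is a generator. A pair \<open>(u, v)\<close> of words in \<open>R\<close> is the relation \<open>u = v\<close>.
\<close>

type_synonym 'g word = "('g \<times> bool) list"

inductive word_eq :: "('g word \<times> 'g word) set \<Rightarrow> 'g word \<Rightarrow> 'g word \<Rightarrow> bool"
  for R where
    rel: "(u, v) \<in> R \<Longrightarrow> word_eq R u v"
  | cancel: "word_eq R [(g, b), (g, \<not> b)] []"
  | refl: "word_eq R u u"
  | sym: "word_eq R u v \<Longrightarrow> word_eq R v u"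
  | trans: "word_eq R u v \<Longrightarrow> word_eq R v w \<Longrightarrow> word_eq R u w"
  | append: "word_eq R u v \<Longrightarrow> word_eq R u' v' \<Longrightarrow> word_eq R (u @ u') (v @ v')"

definition word_class :: "('g word \<times> 'g word) set \<Rightarrow> 'g word \<Rightarrow> 'g word set"
  where "word_class R u = {v. word_eq R u v}"

definition presented_group :: "('g word \<times> 'g word) set \<Rightarrow> 'g word set monoid"
  where "presented_group R =
    \<lparr>carrier = range (word_class R),
     monoid.mult = \<lambda>A B. \<Union>u\<in>A. \<Union>v\<in>B. word_class R (u @ v),
     one = word_class R []\<rparr>"

definition word_gen :: "'g \<Rightarrow> 'g word"
  where "word_gen g = [(g, True)]"

definition word_pow :: "'g word \<Rightarrow> nat \<Rightarrow> 'g word"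
  where "word_pow u n = concat (replicate n u)"

definition word_inv :: "'g word \<Rightarrow> 'g word"
  where "word_inv u = map (\<lambda>(g, b). (g, \<not> b)) (rev u)"

definition word_commutator :: "'g word \<Rightarrow> 'g word \<Rightarrow> 'g word"
  where "word_commutator u v = word_inv u @ word_inv v @ u @ v"

section \<open>The nonabelian groups of order \<open>p\<^sup>3\<close>\<close>

datatype group_kind = Q8 | D8 | H_p3 | M_p3

definition kind_allowed :: "group_kind \<Rightarrow> nat \<Rightarrow> bool"
  where "kind_allowed G p \<longleftrightarrow> (case G of Q8 \<Rightarrow> p = 2 | D8 \<Rightarrow> p = 2 | H_p3 \<Rightarrow> p > 2 | M_p3 \<Rightarrow> p > 2)"

datatype gen = Gen1 | Gen2

text \<open>
  In the presentation of \<open>H(p\<^sup>3)\<close>, centrality of the commutator means that it commutes with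
  both generators.
\<close>

definition relations :: "group_kind \<Rightarrow> nat \<Rightarrow> (gen word \<times> gen word) set"
  where "relations G p =
    (let s1 = word_gen Gen1; s2 = word_gen Gen2; c = word_commutator s1 s2 in
     case G of
       Q8 \<Rightarrow> {(word_pow s1 4, []), (word_pow s1 2, word_pow s2 2), (word_pow s2 2, c)}
     | D8 \<Rightarrow> {(word_pow s1 4, []), (word_pow s2 2, []), (word_pow s1 2, c)}
     | H_p3 \<Rightarrow> {(word_pow s1 p, []), (word_pow s2 p, []), (word_pow c p, []),
               (c @ s1, s1 @ c), (c @ s2, s2 @ c)}
     | M_p3 \<Rightarrow> {(word_pow s1 (p\<^sup>2), []), (word_pow s2 p, []), (word_pow s1 p, c)})"

definition group_p3 :: "group_kind \<Rightarrow> nat \<Rightarrow> gen word set monoid"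
  where "group_p3 G p = presented_group (relations G p)"

definition group_p3_gen :: "group_kind \<Rightarrow> nat \<Rightarrow> gen \<Rightarrow> gen word set"
  where "group_p3_gen G p g = word_class (relations G p) (word_gen g)"

definition commutator :: "('b, 'c) monoid_scheme \<Rightarrow> 'b \<Rightarrow> 'b \<Rightarrow> 'b"
  where "commutator G a b = inv\<^bsub>G\<^esub> a \<otimes>\<^bsub>G\<^esub> inv\<^bsub>G\<^esub> b \<otimes>\<^bsub>G\<^esub> a \<otimes>\<^bsub>G\<^esub> b"

section \<open>The polynomial \<open>S\<close> and the Artin-Schreier data\<close>

text \<open>
  In \<open>\<int>[X\<^sub>1, X\<^sub>2]\<close>, realised as \<open>int poly poly\<close>, \<open>X\<^sub>1\<close> is the inner and \<open>X\<^sub>2\<close> the outer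
  variable. For prime \<open>p\<close> the division by \<open>p\<close> is exact.
\<close>

definition S_poly :: "nat \<Rightarrow> int poly poly"
  where "S_poly p =
    (let X1 = [:[:0, 1:]:]; X2 = [:0, 1:] in (X1 ^ p + X2 ^ p - (X1 + X2) ^ p) div of_nat p)"

definition S :: "nat \<Rightarrow> 'a::field \<Rightarrow> 'a \<Rightarrow> 'a"
  where "S p x1 x2 = poly (poly (map_poly (map_poly of_int) (S_poly p)) [:x2:]) x1"

definition wp :: "nat \<Rightarrow> 'a::field \<Rightarrow> 'a"
  where "wp p x = x ^ p - x"

text \<open>
  The prime field \<open>\<F>\<^sub>p\<close> is the image of the integers. A linear combination of the cosets of
  \<open>\<kappa>\<^sub>1, \<kappa>\<^sub>2\<close> in \<open>K / \<wp>(K)\<close> is zero iff the same combination of \<open>\<kappa>\<^sub>1, \<kappa>\<^sub>2\<close> lies in \<open>\<wp>(K)\<close>.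
\<close>

definition independent_cosets :: "nat \<Rightarrow> 'a::field set \<Rightarrow> 'a \<Rightarrow> 'a \<Rightarrow> bool"
  where "independent_cosets p K \<kappa>1 \<kappa>2 \<longleftrightarrow>
    (\<forall>a\<in>range of_int. \<forall>b\<in>range of_int. a * \<kappa>1 + b * \<kappa>2 \<in> wp p ` K \<longrightarrow> a = 0 \<and> b = 0)"

definition frak_s :: "group_kind \<Rightarrow> nat \<Rightarrow> 'a::field \<Rightarrow> 'a \<Rightarrow> 'a \<Rightarrow> 'a \<Rightarrow> 'a"
  where "frak_s G p \<kappa>1 \<kappa>2 x1 x2 = - \<kappa>2 * x1 +
    (case G of
       Q8 \<Rightarrow> \<kappa>1 * x1 + \<kappa>2 * x2
     | D8 \<Rightarrow> \<kappa>1 * x1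
     | H_p3 \<Rightarrow> 0
     | M_p3 \<Rightarrow> S p x1 \<kappa>1)"

definition artin_schreier_data ::
    "group_kind \<Rightarrow> nat \<Rightarrow> 'a::field set \<Rightarrow> 'a set \<Rightarrow> 'a \<Rightarrow> 'a \<Rightarrow> 'a \<Rightarrow> 'a \<Rightarrow> 'a \<Rightarrow> 'a \<Rightarrow> bool"
  where "artin_schreier_data G p L K \<kappa>1 \<kappa>2 \<kappa>3 x1 x2 x3 \<longleftrightarrow>
    \<kappa>1 \<in> K \<and> \<kappa>2 \<in> K \<and> \<kappa>3 \<in> K \<and> independent_cosets p K \<kappa>1 \<kappa>2 \<and>
    x1 ^ p - x1 = \<kappa>1 \<and>
    x2 ^ p - x2 = \<kappa>2 \<and>
    x3 ^ p - x3 = frak_s G p \<kappa>1 \<kappa>2 x1 x2 + \<kappa>3 \<and>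
    L = adjoin K {x1, x2, x3}"

definition artin_schreier_action ::
    "group_kind \<Rightarrow> nat \<Rightarrow> 'a::field \<Rightarrow> 'a \<Rightarrow> 'a \<Rightarrow> ('a \<Rightarrow> 'a) \<Rightarrow> ('a \<Rightarrow> 'a) \<Rightarrow> ('a \<Rightarrow> 'a) \<Rightarrow> bool"
  where "artin_schreier_action G p x1 x2 x3 \<sigma>1 \<sigma>2 \<sigma>3 \<longleftrightarrow>
    \<sigma>1 x1 - x1 = 1 \<and> \<sigma>1 x2 - x2 = 0 \<and>
    \<sigma>1 x3 - x3 = - x2 + (case G of Q8 \<Rightarrow> x1 | D8 \<Rightarrow> x1 | H_p3 \<Rightarrow> 0 | M_p3 \<Rightarrow> S p x1 1) \<and>
    \<sigma>2 x1 - x1 = 0 \<and> \<sigma>2 x2 - x2 = 1 \<and>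
    \<sigma>2 x3 - x3 = (case G of Q8 \<Rightarrow> x2 | D8 \<Rightarrow> 0 | H_p3 \<Rightarrow> 0 | M_p3 \<Rightarrow> 0) \<and>
    \<sigma>3 x1 - x1 = 0 \<and> \<sigma>3 x2 - x2 = 0 \<and> \<sigma>3 x3 - x3 = 1"

end

theory Submission
  imports Defs
begin

text \<open>
  The four kinds of groups are one family. In each of them the commutator \<open>c = [a, b]\<close> of the two
  generators is central with \<open>c\<^sup>p = 1\<close>, and \<open>a\<^sup>p = c\<^sup>e\<close>, \<open>b\<^sup>p = c\<^sup>f\<close>, where \<open>(e, f)\<close> is
  \<open>(1, 1)\<close> for \<open>Q\<^sub>8\<close>, \<open>(1, 0)\<close> for \<open>D\<^sub>8\<close> and \<open>M(p\<^sup>3)\<close>, and \<open>(0, 0)\<close> for \<open>H(p\<^sup>3)\<close>; conversely these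
  relations imply the given ones (\<open>relations_iff_central_pair\<close>). Since \<open>S(x, y) = x y\<close> in
  characteristic 2, the equation for \<open>x\<^sub>3\<close> reads in all cases
  \<open>\<wp>(x\<^sub>3) = - \<kappa>\<^sub>2 x\<^sub>1 + e S(x\<^sub>1, \<kappa>\<^sub>1) + f S(x\<^sub>2, \<kappa>\<^sub>2) + \<kappa>\<^sub>3\<close>, and the generators act on \<open>x\<^sub>3\<close> by
  adding \<open>d\<^sub>1 = - x\<^sub>2 + e S(x\<^sub>1, 1)\<close> and \<open>d\<^sub>2 = f S(x\<^sub>2, 1)\<close>. So no case distinction is left.

  The polynomial \<open>S\<close> is the carry in the addition of Witt vectors of length two. It is a symmetric
  2-cocycle, which yields \<open>\<wp>(S(x, 1)) = S(x + 1, \<wp>(x)) - S(x, \<wp>(x))\<close>: the shift \<open>x\<^sub>1 \<mapsto> x\<^sub>1 + 1\<close> changes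
  the right-hand side by \<open>\<wp>(d\<^sub>1)\<close>, so it can be lifted to \<open>x\<^sub>3 \<mapsto> x\<^sub>3 + d\<^sub>1\<close>. Moreover
  \<open>\<Sum>i<p. S(x + i, 1) = 1\<close>, so the \<open>p\<close>-th power of this lift adds \<open>e\<close> to \<open>x\<^sub>3\<close>; this is \<open>a\<^sup>p = c\<^sup>e\<close>.
  The term \<open>- x\<^sub>2\<close> in \<open>d\<^sub>1\<close> makes the lifts commute up to \<open>x\<^sub>3 \<mapsto> x\<^sub>3 + 1\<close>; this is \<open>[a, b] = c\<close>.

  From the data to the group: if \<open>\<wp>(x)\<close> but not \<open>x\<close> lies in a subfield \<open>F\<close>, then \<open>x\<close> has degree \<open>p\<close>
  over \<open>F\<close>, every automorphism of \<open>F\<close> that changes \<open>\<wp>(x)\<close> by \<open>\<wp>(u)\<close> for some \<open>u\<close> in \<open>F\<close> extends by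
  \<open>x \<mapsto> x + u\<close>, and the elements fixed by \<open>x \<mapsto> x + 1\<close> are those of \<open>F\<close> (\<open>no_relation_below_p\<close>,
  \<open>extend_automorphism\<close>, \<open>fixed_field\<close>). This is applied to
  \<open>K \<subseteq> K(x\<^sub>1) \<subseteq> K(x\<^sub>1, x\<^sub>2) \<subseteq> L\<close>. The first two steps are proper because \<open>\<kappa>\<^sub>1\<close> and \<open>\<kappa>\<^sub>2\<close> are independent.
  The third is proper because the automorphisms \<open>x\<^sub>1 \<mapsto> x\<^sub>1 + 1\<close> and \<open>x\<^sub>2 \<mapsto> x\<^sub>2 + 1\<close> of \<open>K(x\<^sub>1, x\<^sub>2)\<close> commute,
  while they could not commute on \<open>x\<^sub>3\<close> if it were an element of this field. The three resulting
  automorphisms satisfy the relations, hence there is a homomorphism from the presented group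
  (\<open>von_dyck\<close>); the normal form \<open>a\<^sup>i b\<^sup>j c\<^sup>k\<close> with \<open>i, j, k < p\<close> on both sides makes it bijective.

  From the group to the data: a pair \<open>(u, v)\<close> of elements of \<open>L\<close> extends to a cocycle with values
  \<open>u\<close> at \<open>a\<close> and \<open>v\<close> at \<open>b\<close> as soon as \<open>(a, u)\<close> and \<open>(b, v)\<close> satisfy the relations in the
  semidirect product of \<open>Gal L K\<close> and \<open>L\<close>, and it is a coboundary by \<open>additive_hilbert_90\<close>. The
  pairs \<open>(1, 0)\<close>, \<open>(0, 1)\<close>, \<open>(d\<^sub>1, d\<^sub>2)\<close> give \<open>x\<^sub>1, x\<^sub>2, x\<^sub>3\<close>. No nontrivial automorphism fixes all
  three, hence they generate \<open>L\<close> (\<open>galois_descent\<close>). Hilbert 90 and this last step both rest on the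
  existence of \<open>u\<^sub>1, \<dots>, u\<^sub>n\<close> and \<open>v\<^sub>1, \<dots>, v\<^sub>n\<close> with \<open>\<Sum> u\<^sub>i s(v\<^sub>i) = 0\<close> for \<open>s \<noteq> 1\<close> and \<open>= 1\<close> for \<open>s = 1\<close>
  (\<open>dual_bases\<close>).
\<close>

section \<open>The carry polynomial\<close>

text \<open>
  For prime \<open>p\<close> this is \<open>(x\<^sup>p + y\<^sup>p - (x + y)\<^sup>p) / p\<close> with the division carried out on the binomial
  coefficients, so that it makes sense in every commutative ring, in particular in characteristic \<open>p\<close>.
\<close>

definition carry :: "nat \<Rightarrow> 'b::comm_ring_1 \<Rightarrow> 'b \<Rightarrow> 'b"
  where "carry p x y = - (\<Sum>k=1..<p. of_nat ((p choose k) div p) * x ^ k * y ^ (p - k))"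

lemma of_nat_mult_carry:
  fixes x y :: "'b::comm_ring_1"
  assumes "prime p"
  shows "of_nat p * carry p x y = x ^ p + y ^ p - (x + y) ^ p"
proof -
  have p: "p > 1" using assms by (rule prime_gt_1_nat)
  have "{..p} = insert 0 (insert p {1..<p})" using p by auto
  then have "(x + y) ^ p = x ^ p + y ^ p + (\<Sum>k=1..<p. of_nat (p choose k) * x ^ k * y ^ (p - k))"
    unfolding binomial_ring using p by (simp add: algebra_simps)
  also have "(\<Sum>k=1..<p. of_nat (p choose k) * x ^ k * y ^ (p - k)) =
      (\<Sum>k=1..<p. of_nat p * (of_nat ((p choose k) div p) * x ^ k * y ^ (p - k)))"
  proof (rule sum.cong)
    fix k assume "k \<in> {1..<p}"
    then have "p dvd (p choose k)" using assms by (auto intro!: dvd_choose_prime)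
    then have "of_nat (p choose k) = (of_nat p * of_nat ((p choose k) div p) :: 'b)"
      by (metis dvd_mult_div_cancel of_nat_mult)
    then show "of_nat (p choose k) * x ^ k * y ^ (p - k) =
        of_nat p * (of_nat ((p choose k) div p) * x ^ k * y ^ (p - k))"
      by (simp add: mult.assoc)
  qed simp
  also have "\<dots> = - (of_nat p * carry p x y)"
    by (simp add: carry_def sum_distrib_left)
  finally show ?thesis by (simp add: algebra_simps)
qed

definition unital_hom :: "('b::comm_ring_1 \<Rightarrow> 'c::comm_ring_1) \<Rightarrow> bool"
  where "unital_hom h \<longleftrightarrow> h 1 = 1 \<and> (\<forall>x y. h (x + y) = h x + h y) \<and> (\<forall>x y. h (x * y) = h x * h y)"

lemma unital_homD:
  assumes "unital_hom h"
  shows "h 0 = 0" "h 1 = 1" "h (x + y) = h x + h y" "h (x * y) = h x * h y" "h (- x) = - h x"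
    "h (x ^ n) = h x ^ n" "h (of_nat n) = of_nat n" "h (sum f A) = (\<Sum>a\<in>A. h (f a))"
proof -
  show add: "\<And>x y. h (x + y) = h x + h y" and mult: "\<And>x y. h (x * y) = h x * h y"
    and one: "h 1 = 1" using assms by (auto simp: unital_hom_def)
  show zero: "h 0 = 0" using add[of 0 0] by simp
  show "h (- x) = - h x" using add[of x "- x"] zero by (simp add: eq_neg_iff_add_eq_0 add.commute)
  show "h (x ^ n) = h x ^ n" by (induction n) (simp_all add: mult one)
  show "h (of_nat n) = of_nat n" by (induction n) (simp_all add: add zero one)
  show "h (sum f A) = (\<Sum>a\<in>A. h (f a))"
    by (induction A rule: infinite_finite_induct) (simp_all add: add zero)
qed

lemma unital_hom_carry:
  assumes "unital_hom h"
  shows "h (carry p x y) = carry p (h x) (h y)"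
  by (simp add: carry_def unital_homD[OF assms])

lemma unital_hom_map_poly:
  assumes "unital_hom h"
  shows "unital_hom (map_poly h)"
  unfolding unital_hom_def
  by (auto intro!: poly_eqI simp: coeff_map_poly coeff_mult unital_homD[OF assms])

lemma unital_hom_poly: "unital_hom (\<lambda>q. poly q x)"
  by (simp add: unital_hom_def)

lemma unital_hom_comp:
  assumes "unital_hom h" "unital_hom g"
  shows "unital_hom (\<lambda>x. g (h x))"
  using assms by (simp add: unital_hom_def)

lemma unital_hom_of_int: "unital_hom (of_int :: int \<Rightarrow> 'b::comm_ring_1)"
  by (simp add: unital_hom_def)

text \<open>
  The carry is natural with respect to ring homomorphisms, so it suffices to divide by \<open>p\<close> once, in the
  generic ring \<open>\<int>[X\<^sub>1, X\<^sub>2]\<close>.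
\<close>

lemma S_eq_carry:
  fixes x y :: "'a::field"
  assumes p: "prime p"
  shows "S p x y = carry p x y"
proof -
  define X1 X2 :: "int poly poly" where "X1 = [:[:0, 1:]:]" and "X2 = [:0, 1:]"
  have "S_poly p = (of_nat p * carry p X1 X2) div of_nat p"
    by (simp add: S_poly_def of_nat_mult_carry[OF p] X1_def X2_def Let_def)
  also have "\<dots> = carry p X1 X2"
    using p by (intro nonzero_mult_div_cancel_left) auto
  finally have S: "S_poly p = carry p X1 X2" .
  note hom = unital_hom_of_int[where 'b = 'a]
  note hom2 = unital_hom_map_poly[OF unital_hom_map_poly[OF hom]]
  have "S p x y = carry p (poly (poly (map_poly (map_poly of_int) X1) [:y:]) x)
      (poly (poly (map_poly (map_poly of_int) X2) [:y:]) x)"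
    unfolding S_def S
    by (rule unital_hom_carry[OF unital_hom_comp[OF unital_hom_comp[OF hom2 unital_hom_poly] unital_hom_poly]])
  then show ?thesis by (simp add: X1_def X2_def map_poly_pCons)
qed

text \<open>
  Multiplied by \<open>p\<close>, both sides are \<open>x\<^sup>p + y\<^sup>p + z\<^sup>p - (x + y + z)\<^sup>p\<close>. In \<open>\<int>[U, V, W]\<close> the factor
  \<open>p\<close> can be cancelled, and evaluation transports the identity to any commutative ring.
\<close>

lemma carry_cocycle:
  fixes x y z :: "'b::comm_ring_1"
  assumes p: "prime p"
  shows "carry p x y + carry p (x + y) z = carry p y z + carry p x (y + z)"
proof -
  define U V W :: "int poly poly poly" where "U = [: [: [:0, 1:] :] :]" and "V = [:[:0, 1:]:]" and "W = [:0, 1:]"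
  have "of_nat p * (carry p U V + carry p (U + V) W) = of_nat p * (carry p V W + carry p U (V + W))"
    by (simp add: distrib_left of_nat_mult_carry[OF p] add.assoc)
  then have eq: "carry p U V + carry p (U + V) W = carry p V W + carry p U (V + W)"
    using p by simp
  define h where "h q = poly (poly (poly (map_poly (map_poly (map_poly of_int)) q) [: [:z:] :]) [:y:]) x"
    for q :: "int poly poly poly"
  have h: "unital_hom h"
    unfolding h_def
    by (intro unital_hom_comp[OF _ unital_hom_poly] unital_hom_map_poly unital_hom_of_int)
  have hX: "h U = x" "h V = y" "h W = z"
    by (simp_all add: h_def U_def V_def W_def map_poly_pCons)
  show ?thesis
    using arg_cong[OF eq, of h] by (simp add: unital_homD[OF h] unital_hom_carry[OF h] hX)
qed

lemma carry_0_right: "p > 0 \<Longrightarrow> carry p x 0 = 0"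
  by (auto simp: carry_def power_0_left)

lemma carry_commute:
  fixes x y :: "'b::comm_ring_1"
  shows "carry p x y = carry p y x"
  unfolding carry_def
proof (intro arg_cong[where f = uminus], rule sum.reindex_bij_witness[where i = "\<lambda>k. p - k" and j = "\<lambda>k. p - k"])
  fix k assume k: "k \<in> {1..<p}"
  then show "of_nat ((p choose (p - k)) div p) * y ^ (p - k) * x ^ (p - (p - k)) =
      (of_nat ((p choose k) div p) * x ^ k * y ^ (p - k) :: 'b)"
    by (simp add: binomial_symmetric[of k p] mult_ac)
qed auto

text \<open>
  Multiplied by \<open>p\<close>, the sum telescopes.
\<close>

lemma sum_carry_int:
  assumes p: "prime p"
  shows "(\<Sum>i<p. carry p (int i) 1) = 1 - int p ^ (p - 1)"
proof -
  have "int p * (\<Sum>i<n. carry p (int i) 1) = int n - int n ^ p" for n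
  proof (induction n)
    case (Suc n)
    then show ?case
      using of_nat_mult_carry[OF p, of "int n" 1] by (simp add: distrib_left add.commute)
  qed (use p in \<open>simp add: prime_gt_0_nat\<close>)
  from this[of p] have "int p * (\<Sum>i<p. carry p (int i) 1) = int p * (1 - int p ^ (p - 1))"
    using p by (simp add: right_diff_distrib power_eq_if)
  then show ?thesis using p by simp
qed

text \<open>
  By the cocycle identity, translating the sum by \<open>x\<close> changes it by \<open>S(x, p) = S(x, 0) = 0\<close>, and the sum
  for \<open>x = 0\<close> is the image of an integer congruent to 1. It is this sum that appears when an
  automorphism adding \<open>S(x, 1)\<close> is raised to its \<open>p\<close>-th power.
\<close>

lemma sum_carry_translates:
  fixes x :: "'b::comm_ring_1"
  assumes p: "prime p" and "CHAR('b) = p"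
  shows "(\<Sum>i<p. carry p (x + of_nat i) 1) = 1"
proof -
  have "(\<Sum>i<n. carry p (x + of_nat i) 1) = carry p x (of_nat n) + (\<Sum>i<n. carry p (of_nat i) 1)" for n
  proof (induction n)
    case (Suc n)
    then show ?case
      using carry_cocycle[OF p, of x "of_nat n" 1] by (simp add: algebra_simps)
  qed (use p in \<open>simp add: carry_0_right prime_gt_0_nat\<close>)
  moreover have "(of_nat p :: 'b) = 0" using assms(2) of_nat_CHAR by blast
  moreover have "(\<Sum>i<p. carry p (of_nat i) 1) = (of_int (\<Sum>i<p. carry p (int i) 1) :: 'b)"
    by (simp add: unital_hom_carry[OF unital_hom_of_int])
  ultimately show ?thesis
    using p prime_gt_1_nat[OF p] by (simp add: sum_carry_int carry_0_right prime_gt_0_nat power_0_left)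
qed

lemma carry_frobenius:
  fixes x y :: "'b::comm_ring_1"
  assumes p: "prime p" and char: "CHAR('b) = p"
  shows "carry p x y ^ p = carry p (x ^ p) (y ^ p)"
proof -
  have "unital_hom (\<lambda>x::'b. x ^ p)"
    using freshmans_dream[where 'a = 'b] p char by (simp add: unital_hom_def power_mult_distrib)
  from unital_hom_carry[OF this] show ?thesis .
qed

lemma carry_2: "CHAR('b::comm_ring_1) = 2 \<Longrightarrow> carry 2 (x::'b) y = x * y"
proof -
  assume "CHAR('b) = 2"
  then have "(2::'b) = 0" using of_nat_CHAR[where 'a = 'b] by simp
  then have "x * y + x * y = 0" by (metis mult_2 mult_zero_left)
  moreover have "{1..<2::nat} = {1}" by auto
  ultimately show ?thesis by (simp add: carry_def minus_unique)
qed

section \<open>Groups given by generators and relations\<close>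

lemma word_class_eq_iff: "word_class R u = word_class R v \<longleftrightarrow> word_eq R u v"
proof
  assume "word_class R u = word_class R v"
  then show "word_eq R u v"
    using word_eq.refl[of R v] by (auto simp: word_class_def)
next
  assume "word_eq R u v"
  then show "word_class R u = word_class R v"
    by (auto simp: word_class_def intro: word_eq.trans word_eq.sym)
qed

lemma word_class_mult:
  "word_class R u \<otimes>\<^bsub>presented_group R\<^esub> word_class R v = word_class R (u @ v)"
proof -
  have eq: "word_class R (u' @ v') = word_class R (u @ v)"
    if "u' \<in> word_class R u" "v' \<in> word_class R v" for u' v'
  proof -
    have "word_eq R (u @ v) (u' @ v')"
      using that by (simp add: word_class_def word_eq.append)
    then show ?thesis by (simp add: word_class_eq_iff word_eq.sym)
  qed
  have "(\<Union>u'\<in>word_class R u. \<Union>v'\<in>word_class R v. word_class R (u' @ v')) =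
      (\<Union>u'\<in>word_class R u. \<Union>v'\<in>word_class R v. word_class R (u @ v))"
    by (intro SUP_cong HOL.refl eq)
  moreover have "u \<in> word_class R u" "v \<in> word_class R v"
    by (simp_all add: word_class_def word_eq.refl)
  ultimately show ?thesis by (auto simp: presented_group_def)
qed

lemma word_inv_Cons: "word_inv (l # u) = word_inv u @ [(fst l, \<not> snd l)]"
  by (cases l) (simp add: word_inv_def)

lemma word_eq_inv_append: "word_eq R (word_inv u @ u) []"
proof (induction u)
  case Nil
  show ?case by (simp add: word_inv_def word_eq.refl)
next
  case (Cons l u)
  have "word_eq R (word_inv u @ [(fst l, \<not> snd l), l] @ u) (word_inv u @ [] @ u)"
    using word_eq.cancel[of R "fst l" "\<not> snd l"]
    by (intro word_eq.append word_eq.refl) simp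
  then show ?case
    using Cons.IH by (auto simp: word_inv_Cons intro: word_eq.trans)
qed

lemma carrier_presented_group: "carrier (presented_group R) = range (word_class R)"
  by (simp add: presented_group_def)

lemma one_presented_group: "\<one>\<^bsub>presented_group R\<^esub> = word_class R []"
  by (simp add: presented_group_def)

lemma group_presented_group: "group (presented_group R)"
proof (rule groupI)
  fix x assume "x \<in> carrier (presented_group R)"
  then obtain u where "x = word_class R u" by (auto simp: carrier_presented_group)
  then have "word_class R (word_inv u) \<otimes>\<^bsub>presented_group R\<^esub> x = \<one>\<^bsub>presented_group R\<^esub>"
    by (simp add: word_class_mult one_presented_group word_class_eq_iff word_eq_inv_append)
  then show "\<exists>y\<in>carrier (presented_group R). y \<otimes>\<^bsub>presented_group R\<^esub> x = \<one>\<^bsub>presented_group R\<^esub>"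
    by (auto simp: carrier_presented_group)
qed (auto simp: carrier_presented_group one_presented_group word_class_mult)

fun letter_val :: "('b, 'c) monoid_scheme \<Rightarrow> ('g \<Rightarrow> 'b) \<Rightarrow> 'g \<times> bool \<Rightarrow> 'b"
  where "letter_val H h (g, b) = (if b then h g else inv\<^bsub>H\<^esub> h g)"

definition word_val :: "('b, 'c) monoid_scheme \<Rightarrow> ('g \<Rightarrow> 'b) \<Rightarrow> 'g word \<Rightarrow> 'b"
  where "word_val H h u = foldr (\<lambda>l z. letter_val H h l \<otimes>\<^bsub>H\<^esub> z) u \<one>\<^bsub>H\<^esub>"

lemma word_val_simps:
  "word_val H h [] = \<one>\<^bsub>H\<^esub>"
  "word_val H h (l # u) = letter_val H h l \<otimes>\<^bsub>H\<^esub> word_val H h u"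
  by (simp_all add: word_val_def)

context group
begin

context
  fixes h :: "'g \<Rightarrow> 'a"
  assumes h: "\<And>g. h g \<in> carrier G"
begin

lemma letter_val_closed: "letter_val G h l \<in> carrier G"
  by (cases l) (simp add: h)

lemma word_val_closed: "word_val G h u \<in> carrier G"
  by (induction u) (simp_all add: word_val_simps letter_val_closed)

lemma word_val_append: "word_val G h (u @ v) = word_val G h u \<otimes> word_val G h v"
  by (induction u) (simp_all add: word_val_simps letter_val_closed word_val_closed m_assoc)

lemma word_val_gen: "word_val G h (word_gen g) = h g"
  by (simp add: word_gen_def word_val_simps h)

lemma word_val_pow: "word_val G h (word_pow u n) = word_val G h u [^] n"
proof (induction n)
  case (Suc n)
  have "word_val G h (word_pow u (Suc n)) = word_val G h u \<otimes> word_val G h u [^] n"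
    using Suc by (simp add: word_pow_def word_val_append)
  then show ?case using nat_pow_Suc2[OF word_val_closed, of u n] by simp
qed (simp add: word_pow_def word_val_simps)

lemma word_val_inv: "word_val G h (word_inv u) = inv (word_val G h u)"
proof (induction u)
  case (Cons l u)
  then show ?case
    by (cases l) (simp add: word_inv_Cons word_val_append word_val_simps h word_val_closed inv_mult_group)
qed (simp add: word_inv_def word_val_simps)

lemma word_val_commutator:
  "word_val G h (word_commutator u v) = commutator G (word_val G h u) (word_val G h v)"
  by (simp add: word_commutator_def commutator_def word_val_append word_val_inv word_val_closed m_assoc)

lemma word_val_cong:
  assumes R: "\<forall>(u, v)\<in>R. word_val G h u = word_val G h v" and "word_eq R u v"
  shows "word_val G h u = word_val G h v"
  using assms(2)
proof induction
  case (rel u v)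
  then show ?case using R by blast
next
  case (cancel g b)
  show ?case by (simp add: word_val_simps h)
next
  case (append u v u' v')
  then show ?case by (simp only: word_val_append)
qed simp_all

text \<open>
  The universal property of the presented group (von Dyck). Evaluation of words descends to their classes.
\<close>

lemma von_dyck:
  assumes R: "\<forall>(u, v)\<in>R. word_val G h u = word_val G h v"
  obtains \<phi> where "\<phi> \<in> hom (presented_group R) G" "\<And>u. \<phi> (word_class R u) = word_val G h u"
proof
  define \<phi> where "\<phi> A = the_elem (word_val G h ` A)" for A
  have \<phi>: "\<phi> (word_class R u) = word_val G h u" for u
  proof -
    have "word_val G h v = word_val G h u" if "v \<in> word_class R u" for v
      using word_val_cong[OF R, of u v] that by (simp add: word_class_def)
    moreover have "u \<in> word_class R u" by (simp add: word_class_def word_eq.refl)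
    ultimately have "word_val G h ` word_class R u = {word_val G h u}" by blast
    then show ?thesis by (simp add: \<phi>_def)
  qed
  show "\<phi> \<in> hom (presented_group R) G"
    by (rule homI) (auto simp: carrier_presented_group \<phi> word_val_closed word_class_mult word_val_append)
  show "\<And>u. \<phi> (word_class R u) = word_val G h u" by (rule \<phi>)
qed

end
end

lemma inv_presented_group:
  "inv\<^bsub>presented_group R\<^esub> word_class R u = word_class R (word_inv u)"
proof -
  interpret P: group "presented_group R" by (rule group_presented_group)
  show ?thesis
    by (rule P.inv_equality)
      (auto simp: word_class_mult one_presented_group word_class_eq_iff word_eq_inv_append carrier_presented_group)
qed

lemma word_val_presented_group:
  "word_val (presented_group R) (\<lambda>g. word_class R (word_gen g)) u = word_class R u"
proof (induction u)
  case (Cons l u)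
  obtain g b where l: "l = (g, b)" by (cases l)
  show ?case
    using Cons by (auto simp: l word_val_simps word_class_mult inv_presented_group word_gen_def word_inv_def)
qed (simp add: word_val_simps one_presented_group)

section \<open>A uniform presentation of the nonabelian groups of order \<open>p\<^sup>3\<close>\<close>

text \<open>
  With \<open>a\<close> and \<open>b\<close> as generators, these relations present a central extension of
  \<open>\<int>/p \<times> \<int>/p\<close> by \<open>\<int>/p\<close>. The relation \<open>a b = b a c\<close> says that \<open>c = [a, b]\<close> in the convention
  \<open>[a, b] = a\<^sup>-\<^sup>1 b\<^sup>-\<^sup>1 a b\<close>, without mentioning inverses.
\<close>

definition central_pair :: "('b, 'c) monoid_scheme \<Rightarrow> nat \<Rightarrow> nat \<Rightarrow> nat \<Rightarrow> 'b \<Rightarrow> 'b \<Rightarrow> 'b \<Rightarrow> bool"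
  where "central_pair H p e f a b c \<longleftrightarrow>
    a \<in> carrier H \<and> b \<in> carrier H \<and> c \<in> carrier H \<and>
    a \<otimes>\<^bsub>H\<^esub> b = b \<otimes>\<^bsub>H\<^esub> a \<otimes>\<^bsub>H\<^esub> c \<and> c \<otimes>\<^bsub>H\<^esub> a = a \<otimes>\<^bsub>H\<^esub> c \<and> c \<otimes>\<^bsub>H\<^esub> b = b \<otimes>\<^bsub>H\<^esub> c \<and>
    c [^]\<^bsub>H\<^esub> p = \<one>\<^bsub>H\<^esub> \<and> a [^]\<^bsub>H\<^esub> p = c [^]\<^bsub>H\<^esub> e \<and> b [^]\<^bsub>H\<^esub> p = c [^]\<^bsub>H\<^esub> f"

fun exponent_a :: "group_kind \<Rightarrow> nat" where
  "exponent_a H_p3 = 0" | "exponent_a _ = 1"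

fun exponent_b :: "group_kind \<Rightarrow> nat" where
  "exponent_b Q8 = 1" | "exponent_b _ = 0"

context group
begin

lemma eq_commutator_iff:
  assumes [simp]: "a \<in> carrier G" "b \<in> carrier G" "c \<in> carrier G"
  shows "c = commutator G a b \<longleftrightarrow> a \<otimes> b = b \<otimes> a \<otimes> c"
proof -
  have "commutator G a b = inv (b \<otimes> a) \<otimes> (a \<otimes> b)"
    by (simp add: commutator_def inv_mult_group m_assoc)
  then show ?thesis
    using inv_solve_left[of c "b \<otimes> a" "a \<otimes> b"] by simp
qed

lemma commutator_closed: "a \<in> carrier G \<Longrightarrow> b \<in> carrier G \<Longrightarrow> commutator G a b \<in> carrier G"
  by (simp add: commutator_def)

lemma central_pair_commutator:
  assumes "central_pair G p e f a b c"
  shows "c = commutator G a b"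
  using assms by (simp add: central_pair_def eq_commutator_iff)

lemma pow_a_past_b:
  assumes [simp]: "a \<in> carrier G" "b \<in> carrier G" "c \<in> carrier G"
    and ab: "a \<otimes> b = b \<otimes> a \<otimes> c" and ca: "c \<otimes> a = a \<otimes> c"
  shows "a [^] (n::nat) \<otimes> b = b \<otimes> a [^] n \<otimes> c [^] n"
proof (induction n)
  case (Suc n)
  have "a [^] Suc n \<otimes> b = a [^] n \<otimes> (a \<otimes> b)" by (simp add: m_assoc)
  also have "\<dots> = a [^] n \<otimes> (b \<otimes> a \<otimes> c)" by (simp only: ab)
  also have "\<dots> = (a [^] n \<otimes> b) \<otimes> a \<otimes> c" by (simp add: m_assoc)
  also have "\<dots> = b \<otimes> a [^] n \<otimes> (c [^] n \<otimes> a) \<otimes> c" by (simp add: Suc m_assoc)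
  also have "c [^] n \<otimes> a = a \<otimes> c [^] n" by (rule group_commutes_pow) (simp_all add: ca)
  also have "b \<otimes> a [^] n \<otimes> (a \<otimes> c [^] n) \<otimes> c = b \<otimes> a [^] Suc n \<otimes> c [^] Suc n"
    by (simp add: m_assoc)
  finally show ?case .
qed simp

text \<open>
  What has to be seen is that the short presentations force \<open>c\<close> to be central. In \<open>Q\<^sub>8\<close> it is a power of
  both generators. In \<open>D\<^sub>8\<close> and \<open>M(p\<^sup>3)\<close> we have \<open>c = a\<^sup>p\<close> with \<open>c\<^sup>p = 1\<close>, and conjugation by \<open>b\<close> sends
  \<open>a\<close> to \<open>a c\<close>, hence \<open>c = a\<^sup>p\<close> to \<open>a\<^sup>p c\<^sup>p = c\<close>.
\<close>

lemma relations_iff_central_pair: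
  fixes h :: "gen \<Rightarrow> 'a"
  assumes p: "prime p" and kind: "kind_allowed K p" and h: "\<And>g. h g \<in> carrier G"
  defines "a \<equiv> h Gen1" and "b \<equiv> h Gen2"
  shows "(\<forall>(u, v)\<in>relations K p. word_val G h u = word_val G h v) \<longleftrightarrow>
    central_pair G p (exponent_a K) (exponent_b K) a b (commutator G a b)"
proof -
  define c where "c = commutator G a b"
  have [simp]: "a \<in> carrier G" "b \<in> carrier G" by (simp_all add: a_def b_def h)
  then have [simp]: "c \<in> carrier G" unfolding c_def by (rule commutator_closed)
  have ab: "a \<otimes> b = b \<otimes> a \<otimes> c" by (simp add: eq_commutator_iff[THEN iffD1] c_def commutator_closed)
  note val = word_val_simps word_val_pow[OF h] word_val_append[OF h] word_val_gen[OF h]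
    word_val_commutator[OF h] a_def[symmetric] b_def[symmetric] c_def[symmetric]
  have cb: "c \<otimes> b = b \<otimes> c" if "c = a [^] n" "c [^] n = \<one>" for n :: nat
  proof -
    have "c \<otimes> a = a \<otimes> c" unfolding that(1) by (rule group_commutes_pow) simp_all
    then show ?thesis
      using pow_a_past_b[of a b c n] ab that by simp
  qed
  have ca: "c \<otimes> a = a \<otimes> c" if "c = a [^] n" for n :: nat
    unfolding that by (rule group_commutes_pow) simp_all
  have cb': "c \<otimes> b = b \<otimes> c" if "c = b [^] n" for n :: nat
    unfolding that by (rule group_commutes_pow) simp_all
  show ?thesis
  proof (cases K)
    case Q8
    then have [simp]: "p = 2" using kind by (simp add: kind_allowed_def)
    have "(a [^] (4::nat) = \<one> \<and> a [^] (2::nat) = b [^] (2::nat) \<and> b [^] (2::nat) = c) \<longleftrightarrow>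
      (c \<otimes> a = a \<otimes> c \<and> c \<otimes> b = b \<otimes> c \<and> c [^] (2::nat) = \<one> \<and> a [^] (2::nat) = c \<and> b [^] (2::nat) = c)"
      using ca[of 2] cb'[of 2] nat_pow_pow[of a 2 2] by auto
    then show ?thesis
      by (simp add: Q8 relations_def Let_def central_pair_def val ab)
  next
    case D8
    then have [simp]: "p = 2" using kind by (simp add: kind_allowed_def)
    have "(a [^] (4::nat) = \<one> \<and> b [^] (2::nat) = \<one> \<and> a [^] (2::nat) = c) \<longleftrightarrow>
      (c \<otimes> a = a \<otimes> c \<and> c \<otimes> b = b \<otimes> c \<and> c [^] (2::nat) = \<one> \<and> a [^] (2::nat) = c \<and> b [^] (2::nat) = \<one>)"
      using ca[of 2] cb[of 2] nat_pow_pow[of a 2 2] by auto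
    then show ?thesis
      by (simp add: D8 relations_def Let_def central_pair_def val ab)
  next
    case H_p3
    then show ?thesis
      by (auto simp add: relations_def Let_def central_pair_def val ab)
  next
    case M_p3
    have "(a [^] (p\<^sup>2) = \<one> \<and> b [^] p = \<one> \<and> a [^] p = c) \<longleftrightarrow>
      (c \<otimes> a = a \<otimes> c \<and> c \<otimes> b = b \<otimes> c \<and> c [^] p = \<one> \<and> a [^] p = c \<and> b [^] p = \<one>)"
      using ca[of p] cb[of p] nat_pow_pow[of a p p] by (auto simp: power2_eq_square)
    then show ?thesis
      by (simp add: M_p3 relations_def Let_def central_pair_def val ab)
  qed
qed

end

context group
begin

context
  fixes p e f :: nat and a b c :: 'a
  assumes p: "p > 0" and cp: "central_pair G p e f a b c"
begin

lemma central_pair_facts: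
  shows [simp]: "a \<in> carrier G" "b \<in> carrier G" "c \<in> carrier G"
    and "a \<otimes> b = b \<otimes> a \<otimes> c" "c \<otimes> a = a \<otimes> c" "c \<otimes> b = b \<otimes> c"
    "c [^] p = \<one>" "a [^] p = c [^] e" "b [^] p = c [^] f"
  using cp by (simp_all add: central_pair_def)

lemma central_pow_commutes:
  "c [^] (k::nat) \<otimes> a [^] (i::nat) = a [^] i \<otimes> c [^] k"
  "c [^] (k::nat) \<otimes> b [^] (i::nat) = b [^] i \<otimes> c [^] k"
  using central_pair_facts by (metis nat_pow_closed group_commutes_pow)+

lemma pow_reduce:
  assumes "x \<in> carrier G"
  shows "x [^] i = x [^] (i mod p) \<otimes> (x [^] p) [^] (i div p)"
  using assms by (simp add: nat_pow_mult nat_pow_pow)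

lemma pow_a_reduce: "a [^] i = a [^] (i mod p) \<otimes> c [^] (e * (i div p))"
  and pow_b_reduce: "b [^] i = b [^] (i mod p) \<otimes> c [^] (f * (i div p))"
  and pow_c_reduce: "c [^] i = c [^] (i mod p)"
  using pow_reduce[of a i] pow_reduce[of b i] pow_reduce[of c i] central_pair_facts by (simp_all add: nat_pow_pow)

lemma normal_form_reduce:
  "\<exists>i'<p. \<exists>j'<p. \<exists>k'<p. a [^] (i::nat) \<otimes> b [^] (j::nat) \<otimes> c [^] (k::nat) =
    a [^] i' \<otimes> b [^] j' \<otimes> c [^] k'"
proof (intro exI conjI)
  let ?k = "e * (i div p) + (f * (j div p) + k)"
  have "a [^] i \<otimes> b [^] j \<otimes> c [^] k =
      a [^] (i mod p) \<otimes> (c [^] (e * (i div p)) \<otimes> b [^] (j mod p)) \<otimes> c [^] (f * (j div p)) \<otimes> c [^] k"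
    by (subst pow_a_reduce, subst pow_b_reduce) (simp add: m_assoc)
  also have "\<dots> = a [^] (i mod p) \<otimes> b [^] (j mod p) \<otimes> c [^] ?k"
    by (simp add: central_pow_commutes m_assoc nat_pow_mult add.assoc)
  finally show "a [^] i \<otimes> b [^] j \<otimes> c [^] k = a [^] (i mod p) \<otimes> b [^] (j mod p) \<otimes> c [^] (?k mod p)"
    by (simp flip: pow_c_reduce)
qed (use p in auto)

lemma pow_b_pow_a: "\<exists>k::nat. b \<otimes> a [^] (i::nat) = a [^] i \<otimes> b \<otimes> c [^] k"
proof
  \<comment> \<open>This is the inverse of \<open>c\<^sup>i\<close>, as a power with a natural exponent.\<close>
  have "c [^] i \<otimes> c [^] (p * i - i) = \<one>"
    using p by (simp add: nat_pow_mult central_pair_facts flip: nat_pow_pow)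
  then show "b \<otimes> a [^] i = a [^] i \<otimes> b \<otimes> c [^] (p * i - i)"
    using pow_a_past_b[OF central_pair_facts(1-5), of i] by (simp add: m_assoc)
qed

text \<open>
  The generators have order dividing \<open>p\<^sup>2\<close>, as their \<open>p\<close>-th powers are powers of \<open>c\<close>.
\<close>

lemma inv_generator_eq_pow:
  "inv a = a [^] (p * p - 1)" "inv b = b [^] (p * p - 1)"
proof -
  have p1: "p * p = (p * p - 1) + 1" using p by simp
  have "a [^] (p * p) = \<one>" "b [^] (p * p) = \<one>"
    using central_pair_facts
    by (simp_all flip: nat_pow_pow) (simp_all add: nat_pow_pow mult.commute[of _ p] flip: nat_pow_pow[of c p])
  then show "inv a = a [^] (p * p - 1)" "inv b = b [^] (p * p - 1)"
    by (subst (asm) (1 2) p1, intro inv_equality; simp add: nat_pow_Suc2)+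
qed

text \<open>
  The elements \<open>a\<^sup>i b\<^sup>j c\<^sup>k\<close> are stable under multiplication from the left by \<open>a\<close>, because the exponent
  just increases, and by \<open>b\<close>, because \<open>b\<close> moves past \<open>a\<^sup>i\<close> at the cost of a power of \<open>c\<close>. Inverses of the
  generators are powers of them, so these elements exhaust all words; the exponents are then reduced
  modulo \<open>p\<close>, the excess going into \<open>c\<close>.
\<close>

lemma word_val_normal_form:
  assumes "h Gen1 = a" "h Gen2 = b"
  shows "\<exists>i<p. \<exists>j<p. \<exists>k<p. word_val G h u = a [^] i \<otimes> b [^] j \<otimes> c [^] k"
proof -
  define N where "N = {a [^] i \<otimes> b [^] j \<otimes> c [^] k | (i::nat) (j::nat) (k::nat). True}"
  have Na: "a [^] n \<otimes> x \<in> N" if "x \<in> N" for x and n :: nat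
  proof -
    from that obtain i j k :: nat where "x = a [^] i \<otimes> b [^] j \<otimes> c [^] k" unfolding N_def by blast
    then have "a [^] n \<otimes> x = a [^] (n + i) \<otimes> b [^] j \<otimes> c [^] k"
      by (simp add: m_assoc flip: nat_pow_mult)
    then show ?thesis by (auto simp: N_def)
  qed
  have Nb1: "b \<otimes> x \<in> N" if "x \<in> N" for x
  proof -
    from that obtain i j k :: nat where x: "x = a [^] i \<otimes> b [^] j \<otimes> c [^] k" unfolding N_def by blast
    obtain l :: nat where l: "b \<otimes> a [^] i = a [^] i \<otimes> b \<otimes> c [^] l" using pow_b_pow_a by blast
    have "b \<otimes> x = a [^] i \<otimes> b \<otimes> (c [^] l \<otimes> b [^] j) \<otimes> c [^] k"
      using l by (simp add: x flip: m_assoc)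
    also have "\<dots> = a [^] i \<otimes> (b \<otimes> b [^] j) \<otimes> (c [^] l \<otimes> c [^] k)"
      by (simp add: central_pow_commutes m_assoc)
    also have "\<dots> = a [^] i \<otimes> b [^] Suc j \<otimes> c [^] (l + k)"
      by (simp add: nat_pow_mult flip: nat_pow_Suc2)
    finally show ?thesis unfolding N_def by blast
  qed
  have N_carrier: "x \<in> carrier G" if "x \<in> N" for x
    using that by (auto simp: N_def)
  have Nb: "b [^] n \<otimes> x \<in> N" if "x \<in> N" for x and n :: nat
  proof (induction n)
    case (Suc n)
    have "b [^] Suc n \<otimes> x = b \<otimes> (b [^] n \<otimes> x)"
      using nat_pow_Suc2[OF central_pair_facts(2), of n] by (simp add: N_carrier[OF that] flip: m_assoc)
    then show ?case using Nb1[OF Suc] by simp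
  qed (use that N_carrier in simp)
  have "word_val G h u \<in> N"
  proof (induction u)
    case Nil
    have "\<one> = a [^] (0::nat) \<otimes> b [^] (0::nat) \<otimes> c [^] (0::nat)" by simp
    then show ?case unfolding N_def word_val_simps by blast
  next
    case (Cons l u)
    obtain g s where l: "l = (g, s)" by (cases l)
    have "\<exists>n::nat. letter_val G h l = a [^] n \<or> letter_val G h l = b [^] n"
    proof (cases s)
      case True
      then have "letter_val G h l = a [^] (1::nat) \<or> letter_val G h l = b [^] (1::nat)"
        using assms by (cases g) (simp_all add: l)
      then show ?thesis by blast
    next
      case False
      then show ?thesis using assms inv_generator_eq_pow by (cases g) (auto simp: l)
    qed
    then show ?case using Na[OF Cons] Nb[OF Cons] by (auto simp: word_val_simps)
  qed
  then show ?thesis using normal_form_reduce by (auto simp: N_def)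
qed

end
end

lemma group_group_p3: "group (group_p3 G p)"
  by (simp add: group_p3_def group_presented_group)

lemma group_p3_central_pair:
  assumes "prime p" "kind_allowed G p"
  defines "A \<equiv> group_p3_gen G p Gen1" and "B \<equiv> group_p3_gen G p Gen2"
  shows "central_pair (group_p3 G p) p (exponent_a G) (exponent_b G) A B (commutator (group_p3 G p) A B)"
proof -
  interpret P: group "group_p3 G p" by (rule group_group_p3)
  have "\<forall>(u, v)\<in>relations G p. word_val (group_p3 G p) (group_p3_gen G p) u = word_val (group_p3 G p) (group_p3_gen G p) v"
    using word_val_presented_group[of "relations G p"]
    by (auto simp: group_p3_def group_p3_gen_def[abs_def] word_class_eq_iff intro: word_eq.rel)
  then show ?thesis
    unfolding A_def B_def
    by (subst (asm) P.relations_iff_central_pair[OF assms(1,2)])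
      (auto simp: group_p3_def group_p3_gen_def carrier_presented_group)
qed

lemma group_p3_normal_form:
  assumes "prime p" "kind_allowed G p" "x \<in> carrier (group_p3 G p)"
  defines "A \<equiv> group_p3_gen G p Gen1" and "B \<equiv> group_p3_gen G p Gen2"
  shows "\<exists>i<p. \<exists>j<p. \<exists>k<p. x = A [^]\<^bsub>group_p3 G p\<^esub> i \<otimes>\<^bsub>group_p3 G p\<^esub> B [^]\<^bsub>group_p3 G p\<^esub> j
    \<otimes>\<^bsub>group_p3 G p\<^esub> commutator (group_p3 G p) A B [^]\<^bsub>group_p3 G p\<^esub> k"
proof -
  interpret P: group "group_p3 G p" by (rule group_group_p3)
  obtain u where "x = word_class (relations G p) u"
    using assms(3) by (auto simp: group_p3_def carrier_presented_group)
  then have "x = word_val (group_p3 G p) (group_p3_gen G p) u"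
    using word_val_presented_group[of "relations G p"]
    by (simp add: group_p3_def group_p3_gen_def[abs_def])
  then show ?thesis
    using P.word_val_normal_form[OF _ group_p3_central_pair[OF assms(1,2)], of "group_p3_gen G p" u] assms(1)
    by (simp add: A_def B_def prime_gt_0_nat)
qed

lemma group_p3_hom:
  assumes "group H" "prime p" "kind_allowed G p"
    and "central_pair H p (exponent_a G) (exponent_b G) a b c"
  obtains \<phi> where "\<phi> \<in> hom (group_p3 G p) H"
    "\<phi> (group_p3_gen G p Gen1) = a" "\<phi> (group_p3_gen G p Gen2) = b"
proof -
  interpret H: group H by fact
  define h where "h g = (case g of Gen1 \<Rightarrow> a | Gen2 \<Rightarrow> b)" for g
  have h: "h g \<in> carrier H" for g using assms(4) by (cases g) (simp_all add: h_def central_pair_def)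
  have "\<forall>(u, v)\<in>relations G p. word_val H h u = word_val H h v"
    using H.relations_iff_central_pair[where h = h, OF assms(2,3) h] assms(4) H.central_pair_commutator[OF assms(4)]
    by (simp add: h_def)
  then obtain \<phi> where "\<phi> \<in> hom (presented_group (relations G p)) H"
    "\<And>u. \<phi> (word_class (relations G p) u) = word_val H h u"
    using H.von_dyck[where h = h, OF h] by blast
  then show thesis
    by (intro that[of \<phi>]) (simp_all add: group_p3_def group_p3_gen_def H.word_val_gen[where h = h, OF h], simp_all add: h_def)
qed

section \<open>Subfields\<close>

abbreviation (input) is_subfield :: "'a::field set \<Rightarrow> bool"
  where "is_subfield F \<equiv> subfield F ring_of_type_algebra"

lemma field_ambient: "field (ring_of_type_algebra :: 'a::field ring)"
  by (rule field_from_type_algebra)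

lemma ambient_simps:
  "carrier ring_of_type_algebra = UNIV"
  "x \<otimes>\<^bsub>ring_of_type_algebra\<^esub> y = x * y"
  "x \<oplus>\<^bsub>ring_of_type_algebra\<^esub> y = x + y"
  "\<one>\<^bsub>ring_of_type_algebra\<^esub> = 1"
  "\<zero>\<^bsub>ring_of_type_algebra\<^esub> = 0"
  by (simp_all add: ring_of_type_algebra_def)

lemma ambient_uminus: "\<ominus>\<^bsub>ring_of_type_algebra\<^esub> (x::'a::field) = - x"
proof -
  interpret A: field "ring_of_type_algebra :: 'a ring" by (rule field_ambient)
  have "- x = \<ominus>\<^bsub>ring_of_type_algebra\<^esub> x"
    by (rule A.minus_equality[symmetric]) (simp_all add: ambient_simps)
  then show ?thesis by simp
qed

lemma ambient_inverse: "x \<noteq> 0 \<Longrightarrow> inv\<^bsub>ring_of_type_algebra\<^esub> (x::'a::field) = inverse x"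
proof -
  interpret A: field "ring_of_type_algebra :: 'a ring" by (rule field_ambient)
  assume "x \<noteq> 0"
  then show ?thesis
    using A.comm_inv_char[of x "inverse x"] by (simp add: ambient_simps)
qed

lemma subfield_iff_closed:
  fixes F :: "'a::field set"
  shows "is_subfield F \<longleftrightarrow> 1 \<in> F \<and> (\<forall>x\<in>F. - x \<in> F) \<and> (\<forall>x\<in>F. inverse x \<in> F) \<and>
    (\<forall>x\<in>F. \<forall>y\<in>F. x + y \<in> F) \<and> (\<forall>x\<in>F. \<forall>y\<in>F. x * y \<in> F)" (is "_ \<longleftrightarrow> ?closed")
proof -
  interpret A: field "ring_of_type_algebra :: 'a ring" by (rule field_ambient)
  show ?thesis
  proof
    assume F: "is_subfield F"
    note R = subringE[OF subfieldE(1)[OF F], unfolded ambient_simps ambient_uminus]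
    have "inverse x \<in> F" if "x \<in> F" for x
      using A.subfield_m_inv(1)[OF F, of x] that R(2) by (cases "x = 0") (auto simp: ambient_simps ambient_inverse)
    then show ?closed by (intro conjI ballI) (simp_all add: R(3,5-7))
  next
    assume closed: ?closed
    show "is_subfield F"
    proof (rule A.subfieldI')
      show "subring F ring_of_type_algebra"
        by (rule A.subringI) (use closed in \<open>auto simp: ambient_simps ambient_uminus\<close>)
    qed (use closed in \<open>auto simp: ambient_simps ambient_inverse\<close>)
  qed
qed

lemma subfield_closed:
  fixes F :: "'a::field set"
  assumes "is_subfield F"
  shows "1 \<in> F" "0 \<in> F" "x \<in> F \<Longrightarrow> - x \<in> F" "x \<in> F \<Longrightarrow> inverse x \<in> F"
    "x \<in> F \<Longrightarrow> y \<in> F \<Longrightarrow> x + y \<in> F" "x \<in> F \<Longrightarrow> y \<in> F \<Longrightarrow> x * y \<in> F"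
    "x \<in> F \<Longrightarrow> y \<in> F \<Longrightarrow> x - y \<in> F" "x \<in> F \<Longrightarrow> y \<in> F \<Longrightarrow> x / y \<in> F"
    "x \<in> F \<Longrightarrow> x ^ n \<in> F" "of_nat n \<in> F" "of_int i \<in> F"
proof -
  show one: "1 \<in> F" and uminus: "\<And>x. x \<in> F \<Longrightarrow> - x \<in> F" and inv: "\<And>x. x \<in> F \<Longrightarrow> inverse x \<in> F"
    and add: "\<And>x y. x \<in> F \<Longrightarrow> y \<in> F \<Longrightarrow> x + y \<in> F"
    and mult: "\<And>x y. x \<in> F \<Longrightarrow> y \<in> F \<Longrightarrow> x * y \<in> F"
    using assms unfolding subfield_iff_closed by blast+
  show zero: "0 \<in> F" using add[OF one uminus[OF one]] by simp
  show "x - y \<in> F" if "x \<in> F" "y \<in> F" using add[OF that(1) uminus[OF that(2)]] by simp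
  show "x / y \<in> F" if "x \<in> F" "y \<in> F" using mult[OF that(1) inv[OF that(2)]] by (simp add: divide_inverse)
  show "x ^ n \<in> F" if "x \<in> F" by (induction n) (simp_all add: one mult that)
  show of_nat: "of_nat n \<in> F" for n by (induction n) (simp_all add: one zero add)
  show "of_int i \<in> F" by (cases i rule: int_cases2) (simp_all add: of_nat uminus)
qed

lemma subfield_sum:
  "is_subfield F \<Longrightarrow> (\<And>i. i \<in> A \<Longrightarrow> g i \<in> F) \<Longrightarrow> sum g A \<in> F"
  by (induction A rule: infinite_finite_induct) (simp_all add: subfield_closed)

lemma subfield_carry: "is_subfield F \<Longrightarrow> x \<in> F \<Longrightarrow> y \<in> F \<Longrightarrow> carry p x y \<in> F"
  by (simp add: carry_def subfield_closed subfield_sum)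

lemma adjoin_subfield: "is_subfield (adjoin K A)"
proof -
  interpret A: field "ring_of_type_algebra :: 'a ring" by (rule field_ambient)
  show ?thesis unfolding adjoin_def by (rule A.generate_field_is_subfield) (simp add: ambient_simps)
qed

lemma adjoin_superset: "K \<subseteq> adjoin K A" "A \<subseteq> adjoin K A"
  by (auto simp: adjoin_def intro: generate_field.incl)

lemma adjoin_least:
  assumes "is_subfield E" "K \<subseteq> E" "A \<subseteq> E"
  shows "adjoin K A \<subseteq> E"
proof -
  interpret A: field "ring_of_type_algebra :: 'a ring" by (rule field_ambient)
  show ?thesis
    unfolding adjoin_def by (rule A.generate_field_min_subfield1) (use assms in \<open>auto simp: ambient_simps\<close>)
qed

lemma adjoin_adjoin: "adjoin (adjoin K A) B = adjoin K (A \<union> B)"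
proof (rule antisym)
  show "adjoin (adjoin K A) B \<subseteq> adjoin K (A \<union> B)"
    using adjoin_superset[of "A \<union> B" K] adjoin_superset[of K "A \<union> B"]
    by (intro adjoin_least adjoin_subfield) auto
  show "adjoin K (A \<union> B) \<subseteq> adjoin (adjoin K A) B"
    using adjoin_superset(1)[of "adjoin K A" B] adjoin_superset(2)[of B "adjoin K A"]
      adjoin_superset(1)[of K A] adjoin_superset(2)[of A K]
    by (intro adjoin_least adjoin_subfield) auto
qed

section \<open>Automorphisms of a subfield\<close>

text \<open>
  Injectivity and the preservation of the other field operations follow from these conditions. Values
  outside \<open>L\<close> are arbitrary; they are fixed to be \<open>undefined\<close> only on passing to the Galois group.
\<close>

definition field_aut :: "'a::field set \<Rightarrow> ('a \<Rightarrow> 'a) \<Rightarrow> bool"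
  where "field_aut L s \<longleftrightarrow> s ` L = L \<and>
    (\<forall>x\<in>L. \<forall>y\<in>L. s (x + y) = s x + s y) \<and> (\<forall>x\<in>L. \<forall>y\<in>L. s (x * y) = s x * s y)"

context
  fixes L :: "'a::field set" and s :: "'a \<Rightarrow> 'a"
  assumes L: "is_subfield L" and s: "field_aut L s"
begin

lemma field_aut_closed: "x \<in> L \<Longrightarrow> s x \<in> L"
  using s by (auto simp: field_aut_def)

lemma field_aut_add: "x \<in> L \<Longrightarrow> y \<in> L \<Longrightarrow> s (x + y) = s x + s y"
  and field_aut_mult: "x \<in> L \<Longrightarrow> y \<in> L \<Longrightarrow> s (x * y) = s x * s y"
  using s by (auto simp: field_aut_def)

lemma field_aut_zero: "s 0 = 0"
  using field_aut_add[OF subfield_closed(2)[OF L] subfield_closed(2)[OF L]]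
  by (simp only: add_0_right add_cancel_right_right)

lemma field_aut_one: "s 1 = 1"
proof -
  obtain x where "x \<in> L" "s x = 1"
    using s subfield_closed(1)[OF L] by (auto simp: field_aut_def) (metis imageE)
  then show ?thesis using field_aut_mult[OF _ subfield_closed(1)[OF L], of x] by simp
qed

lemma field_aut_uminus: "x \<in> L \<Longrightarrow> s (- x) = - s x"
  using field_aut_add[of x "- x"] field_aut_zero subfield_closed(3)[OF L, of x]
  by (simp add: eq_neg_iff_add_eq_0 add.commute)

lemma field_aut_diff: "x \<in> L \<Longrightarrow> y \<in> L \<Longrightarrow> s (x - y) = s x - s y"
  using field_aut_add[of x "- y"] field_aut_uminus[of y] subfield_closed(3)[OF L, of y] by simp

lemma field_aut_eq_0: "x \<in> L \<Longrightarrow> s x = 0 \<Longrightarrow> x = 0"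
  using field_aut_mult[of x "inverse x"] field_aut_one subfield_closed(4)[OF L, of x] by (cases "x = 0") auto

lemma field_aut_inj: "inj_on s L"
  using field_aut_diff field_aut_eq_0 subfield_closed(7)[OF L]
  by (intro inj_onI) (metis eq_iff_diff_eq_0)

lemma field_aut_inverse: "x \<in> L \<Longrightarrow> s (inverse x) = inverse (s x)"
  using field_aut_mult[of x "inverse x"] field_aut_one field_aut_zero subfield_closed(4)[OF L, of x]
  by (cases "x = 0") (auto simp: inverse_unique)

lemma field_aut_power: "x \<in> L \<Longrightarrow> s (x ^ n) = s x ^ n"
  by (induction n) (simp_all add: field_aut_one field_aut_mult subfield_closed(9)[OF L])

lemma field_aut_of_nat: "s (of_nat n) = of_nat n"
  by (induction n) (simp_all add: field_aut_zero field_aut_one field_aut_add subfield_closed[OF L])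

lemma field_aut_of_int: "s (of_int i) = of_int i"
  by (cases i rule: int_cases2) (simp_all add: field_aut_of_nat field_aut_uminus subfield_closed[OF L])

lemma field_aut_sum: "(\<And>i. i \<in> A \<Longrightarrow> g i \<in> L) \<Longrightarrow> s (sum g A) = (\<Sum>i\<in>A. s (g i))"
  by (induction A rule: infinite_finite_induct)
    (simp_all add: field_aut_zero field_aut_add subfield_sum[OF L])

lemma field_aut_carry: "x \<in> L \<Longrightarrow> y \<in> L \<Longrightarrow> s (carry p x y) = carry p (s x) (s y)"
  by (simp add: carry_def field_aut_uminus field_aut_sum field_aut_mult field_aut_power
      field_aut_of_nat subfield_closed[OF L] subfield_sum[OF L])

end

lemma field_aut_eqI:
  assumes "is_subfield L" "field_aut L s" "field_aut L t" "L = adjoin K A"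
    and "\<And>x. x \<in> K \<union> A \<Longrightarrow> s x = t x" and "x \<in> L"
  shows "s x = t x"
proof -
  have "is_subfield {x\<in>L. s x = t x}"
    unfolding subfield_iff_closed
    by (auto simp: subfield_closed[OF assms(1)] field_aut_one[OF assms(1,2)] field_aut_one[OF assms(1,3)]
        field_aut_uminus[OF assms(1,2)] field_aut_uminus[OF assms(1,3)]
        field_aut_inverse[OF assms(1,2)] field_aut_inverse[OF assms(1,3)]
        field_aut_add[OF assms(1,2)] field_aut_add[OF assms(1,3)]
        field_aut_mult[OF assms(1,2)] field_aut_mult[OF assms(1,3)])
  then have "adjoin K A \<subseteq> {x\<in>L. s x = t x}"
    using assms(4,5) adjoin_superset(1)[of K A] adjoin_superset(2)[of A K] by (intro adjoin_least) auto
  then show ?thesis using assms(4,6) by blast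
qed

lemma field_aut_comp:
  assumes "field_aut L s" "field_aut L t"
  shows "field_aut L (\<lambda>x. s (t x))"
proof -
  have "(\<lambda>x. s (t x)) ` L = s ` (t ` L)" by (simp add: image_image)
  moreover have "t x \<in> L" if "x \<in> L" for x using assms(2) that by (auto simp: field_aut_def)
  ultimately show ?thesis using assms unfolding field_aut_def by simp
qed

section \<open>The Galois group\<close>

lemma Gal_mem_iff:
  assumes L: "is_subfield L"
  shows "s \<in> carrier (Gal L K) \<longleftrightarrow> s \<in> extensional L \<and> field_aut L s \<and> (\<forall>k\<in>K. s k = k)"
proof -
  have "ring_iso (as_field L) (as_field L) = {s. s ` L = L \<and> inj_on s L \<and> s 1 = 1 \<and>
      (\<forall>x\<in>L. \<forall>y\<in>L. s (x + y) = s x + s y) \<and> (\<forall>x\<in>L. \<forall>y\<in>L. s (x * y) = s x * s y)}"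
    unfolding ring_iso_def ring_hom_def bij_betw_def by (auto simp: as_field_def ambient_simps)
  then show ?thesis
    using field_aut_one[OF L] field_aut_inj[OF L]
    by (auto simp: Gal_def Bij_def bij_betw_def field_aut_def)
qed

lemma Gal_mult:
  assumes "s \<in> carrier (Gal L K)" "t \<in> carrier (Gal L K)" "x \<in> L"
  shows "(s \<otimes>\<^bsub>Gal L K\<^esub> t) x = s (t x)"
  using assms by (simp add: Gal_def BijGroup_def compose_eq)

lemma Gal_one: "x \<in> L \<Longrightarrow> \<one>\<^bsub>Gal L K\<^esub> x = x"
  by (simp add: Gal_def BijGroup_def)

lemma group_Gal:
  assumes L: "is_subfield L" and K: "K \<subseteq> L"
  shows "group (Gal L K)"
proof -
  let ?H = "carrier (Gal L K)"
  interpret B: group "BijGroup L" by (rule group_BijGroup)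
  have Bij: "?H \<subseteq> Bij L" by (auto simp: Gal_def)
  have "subgroup ?H (BijGroup L)"
  proof (rule B.subgroupI)
    show "?H \<subseteq> carrier (BijGroup L)" using Bij by (simp add: BijGroup_def)
    have "(\<lambda>x\<in>L. x) \<in> ?H"
      using K by (auto simp: Gal_mem_iff[OF L] field_aut_def subfield_closed[OF L])
    then show "?H \<noteq> {}" by blast
  next
    fix s assume s: "s \<in> ?H"
    then have aut: "field_aut L s" and fixes_K: "\<And>k. k \<in> K \<Longrightarrow> s k = k" by (auto simp: Gal_mem_iff[OF L])
    have inj: "inj_on s L" by (rule field_aut_inj[OF L aut])
    have img: "s ` L = L" using aut by (simp add: field_aut_def)
    let ?t = "\<lambda>x\<in>L. inv_into L s x"
    have inv: "inv_into L s (s x) = x" if "x \<in> L" for x using inv_into_f_f[OF inj that] .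
    have "?t \<in> extensional L" by simp
    moreover have "field_aut L ?t"
    proof -
      have "?t ` L = L" using bij_betw_inv_into[of s L L] inj img by (simp add: bij_betw_def)
      moreover have "?t (x + y) = ?t x + ?t y" "?t (x * y) = ?t x * ?t y" if "x \<in> L" "y \<in> L" for x y
      proof -
        obtain x' y' where xy: "x' \<in> L" "y' \<in> L" "x = s x'" "y = s y'"
          using \<open>x \<in> L\<close> \<open>y \<in> L\<close> img by (metis imageE)
        then show "?t (x + y) = ?t x + ?t y" "?t (x * y) = ?t x * ?t y"
          using that inv[of "x' + y'"] inv[of "x' * y'"] inv[of x'] inv[of y']
          by (simp_all add: subfield_closed[OF L] field_aut_add[OF L aut] field_aut_mult[OF L aut])
      qed
      ultimately show ?thesis by (simp add: field_aut_def)
    qed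
    moreover have "?t k = k" if "k \<in> K" for k
      using inv[of k] fixes_K[OF that] that K by auto
    ultimately have "?t \<in> ?H" by (simp add: Gal_mem_iff[OF L])
    then show "inv\<^bsub>BijGroup L\<^esub> s \<in> ?H" using s Bij by (simp add: inv_BijGroup subset_iff)
  next
    fix s t assume st: "s \<in> ?H" "t \<in> ?H"
    then have "compose L s t \<in> extensional L \<and> field_aut L (compose L s t) \<and> (\<forall>k\<in>K. compose L s t k = k)"
      using field_aut_comp[of L s t] K
      by (auto simp: Gal_mem_iff[OF L] field_aut_def compose_eq subfield_closed[OF L] image_def)
    then show "s \<otimes>\<^bsub>BijGroup L\<^esub> t \<in> ?H"
      using st Bij by (simp add: BijGroup_def Gal_mem_iff[OF L] subset_iff)
  qed
  then have "group (BijGroup L \<lparr>carrier := ?H\<rparr>)" by (rule B.subgroup_imp_group)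
  then show ?thesis by (simp add: Gal_def)
qed

section \<open>Artin-Schreier extensions\<close>

lemma degree_artin_schreier_poly:
  assumes "p > 1"
  shows "degree (monom 1 p - [:c, 1:] :: 'a::field poly) = p"
proof -
  have "degree (monom 1 p + [:- c, - 1:]) = degree (monom (1::'a) p)"
    by (rule degree_add_eq_left) (use assms in \<open>simp add: degree_monom_eq\<close>)
  moreover have "monom 1 p + [:- c, - 1:] = monom 1 p - [:c, 1:]" by simp
  ultimately show ?thesis by (simp only: degree_monom_eq[OF one_neq_zero])
qed

context
  fixes p :: nat
  assumes p: "prime p" and char: "CHAR('a::field) = p"
begin

lemma wp_add: "wp p (x + y :: 'a) = wp p x + wp p y"
proof -
  have "(x + y) ^ p = x ^ p + y ^ p" using p char by (intro freshmans_dream) simp_all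
  then show ?thesis by (simp add: wp_def)
qed

lemma wp_of_nat: "wp p (of_nat n :: 'a) = 0"
proof (induction n)
  case 0
  show ?case using p by (simp add: wp_def prime_gt_0_nat power_0_left)
next
  case (Suc n)
  then show ?case using wp_add[of 1 "of_nat n"] by (simp add: wp_def)
qed

lemma wp_uminus: "wp p (- x :: 'a) = - wp p x"
  using wp_add[of x "- x"] wp_of_nat[of 0] by (simp add: eq_neg_iff_add_eq_0 add.commute)

lemma wp_diff: "wp p (x - y :: 'a) = wp p x - wp p y"
  using wp_add[of x "- y"] wp_uminus by simp

lemma wp_of_nat_mult: "wp p (of_nat n * x :: 'a) = of_nat n * wp p x"
proof -
  have "(of_nat n :: 'a) ^ p = of_nat n" using wp_of_nat[of n] by (simp add: wp_def)
  then show ?thesis by (simp add: wp_def power_mult_distrib right_diff_distrib)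
qed

lemma wp_of_int_mult: "wp p (of_int i * x :: 'a) = of_int i * wp p x"
  by (cases i rule: int_cases2) (simp_all add: wp_of_nat_mult wp_uminus)

lemma wp_carry: "wp p (carry p x y :: 'a) = carry p (x ^ p) (y ^ p) - carry p x y"
  by (simp add: wp_def carry_frobenius[OF p char])

lemma of_nat_inj_on: "inj_on (of_nat :: nat \<Rightarrow> 'a) {..<p}"
proof (rule linorder_inj_onI')
  fix i j assume ij: "i \<in> {..<p}" "j \<in> {..<p}" "i < j"
  then have "\<not> p dvd j - i" by (auto dest!: dvd_imp_le)
  then have "(of_nat (j - i) :: 'a) \<noteq> 0" by (simp only: of_nat_eq_0_iff_char_dvd char not_False_eq_True)
  moreover have "(of_nat (j - i) :: 'a) = of_nat j - of_nat i" using ij by (simp add: of_nat_diff)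
  ultimately show "(of_nat i :: 'a) \<noteq> of_nat j" by auto
qed

text \<open>
  The \<open>p\<close> elements of the prime field already exhaust the roots of \<open>X\<^sup>p - X\<close>.
\<close>

lemma wp_eq_0_imp_of_nat:
  assumes "wp p (x::'a) = 0"
  shows "\<exists>i<p. x = of_nat i"
proof (rule ccontr)
  assume none: "\<not> (\<exists>i<p. x = of_nat i)"
  define P :: "'a poly" where "P = monom 1 p - [:0, 1:]"
  have deg: "degree P = p"
    unfolding P_def by (rule degree_artin_schreier_poly[OF prime_gt_1_nat[OF p]])
  then have "P \<noteq> 0" using p by auto
  have root: "poly P z = 0 \<longleftrightarrow> wp p z = 0" for z
    by (simp add: P_def wp_def poly_monom)
  have "card (insert x (of_nat ` {..<p})) = Suc p"
    using none by (subst card_insert_disjoint) (auto simp: card_image of_nat_inj_on)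
  moreover have "card (insert x (of_nat ` {..<p})) \<le> degree P"
    by (rule order_trans[OF card_mono card_poly_roots_bound[OF \<open>P \<noteq> 0\<close>]])
      (use poly_roots_finite[OF \<open>P \<noteq> 0\<close>] assms in \<open>auto simp: root wp_of_nat\<close>)
  ultimately show False using deg by simp
qed

end

text \<open>
  Polynomials over a subfield are polynomials over the ambient field whose coefficients happen to lie in
  the subfield, so that they can be evaluated and factored in the ambient field.
\<close>

definition poly_over :: "'a::field set \<Rightarrow> 'a poly \<Rightarrow> bool"
  where "poly_over F f \<longleftrightarrow> (\<forall>n. coeff f n \<in> F)"

lemma poly_over_closed:
  assumes F: "is_subfield F"
  shows "poly_over F 0" "poly_over F 1" "a \<in> F \<Longrightarrow> poly_over F f \<Longrightarrow> poly_over F (pCons a f)"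
    "poly_over F f \<Longrightarrow> poly_over F g \<Longrightarrow> poly_over F (f + g)"
    "poly_over F f \<Longrightarrow> poly_over F g \<Longrightarrow> poly_over F (f - g)"
    "poly_over F f \<Longrightarrow> poly_over F g \<Longrightarrow> poly_over F (f * g)"
    "a \<in> F \<Longrightarrow> poly_over F f \<Longrightarrow> poly_over F (smult a f)"
    "a \<in> F \<Longrightarrow> poly_over F (monom a n)"
  by (auto simp: poly_over_def coeff_pCons coeff_mult subfield_closed[OF F] subfield_sum[OF F]
      split: nat.split)

lemma poly_over_pCons_iff: "poly_over F (pCons a f) \<longleftrightarrow> a \<in> F \<and> poly_over F f"
proof
  assume "poly_over F (pCons a f)"
  then have "coeff (pCons a f) 0 \<in> F" "coeff (pCons a f) (Suc n) \<in> F" for n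
    by (auto simp only: poly_over_def)
  then show "a \<in> F \<and> poly_over F f" by (simp add: poly_over_def)
qed (auto simp: poly_over_def coeff_pCons split: nat.split)

lemma poly_over_mono: "poly_over F f \<Longrightarrow> F \<subseteq> E \<Longrightarrow> poly_over E f"
  by (auto simp: poly_over_def)

lemma poly_in_subfield:
  assumes "is_subfield E" "poly_over E f" "x \<in> E"
  shows "poly f x \<in> E"
  using assms(2)
  by (induction f) (simp_all add: subfield_closed[OF assms(1)] poly_over_pCons_iff assms(3))

lemma poly_over_division:
  assumes F: "is_subfield F" and f: "poly_over F f" "lead_coeff f = 1" "degree f > 0" and g: "poly_over F g"
  shows "\<exists>q r. poly_over F q \<and> poly_over F r \<and> g = f * q + r \<and> degree r < degree f"
  using g
proof (induction "degree g" arbitrary: g rule: less_induct)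
  case less
  show ?case
  proof (cases "degree g < degree f")
    case True
    then show ?thesis
      using less.prems by (intro exI[of _ 0] exI[of _ g]) (simp add: poly_over_closed[OF F])
  next
    case False
    define m where "m = monom (lead_coeff g) (degree g - degree f)"
    have m: "poly_over F m"
      unfolding m_def by (rule poly_over_closed(8)[OF F]) (use less.prems in \<open>simp add: poly_over_def\<close>)
    have "coeff (g - m * f) n = 0" if "n > degree g - 1" for n
    proof (cases "n = degree g")
      case True
      then show ?thesis using False f(2) by (simp add: m_def coeff_monom_mult)
    next
      case False
      then have "n > degree g" using that by simp
      then show ?thesis using \<open>\<not> degree g < degree f\<close> by (simp add: m_def coeff_monom_mult coeff_eq_0)
    qed
    then have "degree (g - m * f) \<le> degree g - 1" by (intro degree_le) auto
    then have "degree (g - m * f) < degree g" using False f(3) by simp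
    moreover have "poly_over F (g - m * f)" using less.prems m f(1) by (simp add: poly_over_closed[OF F])
    ultimately obtain q r where qr: "poly_over F q" "poly_over F r" "g - m * f = f * q + r" "degree r < degree f"
      using less.hyps by blast
    then have "g = f * (q + m) + r" by (simp add: algebra_simps)
    moreover have "poly_over F (q + m)" using qr m by (simp add: poly_over_closed[OF F])
    ultimately show ?thesis using qr by blast
  qed
qed

text \<open>
  The second coefficient is what locates a sum of roots of a polynomial in the field of its coefficients.
\<close>

lemma coeff_prod_linear:
  fixes r :: "'b \<Rightarrow> 'a::field"
  assumes "finite A"
  shows "degree (\<Prod>i\<in>A. [:- r i, 1:]) = card A \<and> lead_coeff (\<Prod>i\<in>A. [:- r i, 1:]) = 1 \<and>
    (card A > 0 \<longrightarrow> coeff (\<Prod>i\<in>A. [:- r i, 1:]) (card A - 1) = - (\<Sum>i\<in>A. r i))"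
  using assms
proof induction
  case (insert i A)
  let ?P = "\<Prod>i\<in>A. [:- r i, 1:]"
  have P: "degree ?P = card A" "lead_coeff ?P = 1" "card A > 0 \<longrightarrow> coeff ?P (card A - 1) = - (\<Sum>i\<in>A. r i)"
    using insert.IH by auto
  then have "?P \<noteq> 0" by auto
  have prod: "(\<Prod>i\<in>insert i A. [:- r i, 1:]) = smult (- r i) ?P + pCons 0 ?P"
    using insert.hyps by simp
  have "degree ([:- r i, 1:] * ?P) = Suc (card A)"
    using \<open>?P \<noteq> 0\<close> P(1) by (subst degree_mult_eq) auto
  then have deg: "degree (\<Prod>i\<in>insert i A. [:- r i, 1:]) = Suc (card A)" using insert.hyps by simp
  moreover have "lead_coeff (\<Prod>i\<in>insert i A. [:- r i, 1:]) = 1"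
    unfolding deg unfolding prod using P by (simp add: coeff_eq_0)
  moreover have "coeff (\<Prod>i\<in>insert i A. [:- r i, 1:]) (card A) = - (\<Sum>i\<in>insert i A. r i)"
    unfolding prod using P insert.hyps by (cases "card A") (auto simp: coeff_pCons)
  ultimately show ?case using insert.hyps by simp
qed simp

locale artin_schreier_step =
  fixes p :: nat and F :: "'a::field set" and x :: 'a
  assumes p: "prime p" and char: "CHAR('a) = p" and F: "is_subfield F"
    and wp_x: "wp p x \<in> F" and x_notin: "x \<notin> F"
begin

definition AS :: "'a poly"
  where "AS = monom 1 p - [:wp p x, 1:]"

lemma degree_AS: "degree AS = p"
  unfolding AS_def by (rule degree_artin_schreier_poly[OF prime_gt_1_nat[OF p]])

lemma lead_coeff_AS: "lead_coeff AS = 1"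
  unfolding degree_AS using prime_gt_1_nat[OF p] by (simp add: AS_def coeff_pCons split: nat.split)

lemma poly_over_AS: "poly_over F AS"
  by (simp add: AS_def poly_over_closed[OF F] subfield_closed[OF F] wp_x)

lemma poly_AS: "poly AS y = wp p y - wp p x"
  by (simp add: AS_def poly_monom wp_def)

lemma inj_translates: "inj_on (\<lambda>i. x + of_nat i) {..<p}"
  using of_nat_inj_on[OF p char] by (auto simp: inj_on_def)

text \<open>
  A monic polynomial \<open>f\<close> of least degree \<open>d\<close> over \<open>F\<close> that vanishes at \<open>x\<close> divides
  \<open>X\<^sup>p - X - \<wp>(x) = \<Prod>i<p. (X - (x + i))\<close>. Counting roots, \<open>f\<close> is the product of \<open>d\<close> of these linear
  factors, so that its second coefficient is \<open>- (d x + m)\<close> for some \<open>m\<close> in the prime field. If \<open>d < p\<close>, then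
  \<open>d\<close> is invertible and \<open>x\<close> lies in \<open>F\<close>.
\<close>

lemma no_relation_below_p:
  assumes "poly_over F g" "poly g x = 0" "degree g < p"
  shows "g = 0"
proof (rule ccontr)
  assume "g \<noteq> 0"
  define Q where "Q d \<longleftrightarrow> (\<exists>f. poly_over F f \<and> f \<noteq> 0 \<and> poly f x = 0 \<and> degree f = d)" for d
  define d where "d = (LEAST d. Q d)"
  have "Q (degree g)" using assms \<open>g \<noteq> 0\<close> by (auto simp: Q_def)
  then have "Q d" and d_le: "d \<le> degree g" unfolding d_def by (rule LeastI, rule Least_le)
  then obtain f0 where f0: "poly_over F f0" "f0 \<noteq> 0" "poly f0 x = 0" "degree f0 = d" by (auto simp: Q_def)
  have least: "r = 0" if "poly_over F r" "poly r x = 0" "degree r < d" for r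
    using that not_less_Least[of "degree r" Q] by (auto simp: Q_def d_def)
  define f where "f = smult (inverse (lead_coeff f0)) f0"
  have f: "poly_over F f" "poly f x = 0" "degree f = d" "lead_coeff f = 1"
    using f0 by (auto simp: f_def poly_over_closed[OF F] subfield_closed[OF F] poly_over_def)
  have "d > 0"
  proof (rule ccontr)
    assume "\<not> d > 0"
    then have "f = [:1:]" using f(3,4) by (metis degree_eq_zeroE gr0I lead_coeff_pCons(2) pCons_0_0)
    then show False using f(2) by simp
  qed
  have "d < p" using d_le assms(3) by simp
  obtain q r where qr: "poly_over F q" "poly_over F r" "AS = f * q + r" "degree r < degree f"
    using poly_over_division[OF F f(1,4) _ poly_over_AS] f(3) \<open>d > 0\<close> by auto
  have "poly r x = 0" using arg_cong[OF qr(3), of "\<lambda>f. poly f x"] f(2) by (simp add: poly_AS)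
  then have "r = 0" using least qr f by simp
  then have AS_fq: "AS = f * q" using qr by simp
  have "f \<noteq> 0" using f(4) by auto
  have "AS \<noteq> 0" using degree_AS p by auto
  then have "q \<noteq> 0" using AS_fq by auto
  have degq: "degree q = p - d"
    using degree_AS degree_mult_eq[OF \<open>f \<noteq> 0\<close> \<open>q \<noteq> 0\<close>] f(3) by (simp add: AS_fq)
  define I where "I = {i. i < p \<and> poly f (x + of_nat i) = 0}"
  define J where "J = {i. i < p \<and> poly q (x + of_nat i) = 0}"
  have "poly f (x + of_nat i) = 0 \<or> poly q (x + of_nat i) = 0" for i
    using poly_AS[of "x + of_nat i"] by (simp add: AS_fq wp_add[OF p char] wp_of_nat[OF p char])
  then have IJ: "{..<p} = I \<union> J" by (auto simp: I_def J_def)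
  have cardI: "card ((\<lambda>i. x + of_nat i) ` I) = card I" and cardJ: "card ((\<lambda>i. x + of_nat i) ` J) = card J"
    by (auto intro!: card_image inj_on_subset[OF inj_translates] simp: I_def J_def)
  \<comment> \<open>Each of the \<open>p\<close> translates is a root of \<open>f\<close> or of \<open>q\<close>, which have at most \<open>d\<close> and \<open>p - d\<close> roots; so
    both bounds are attained.\<close>
  have "card ((\<lambda>i. x + of_nat i) ` I) \<le> degree f"
    by (rule order_trans[OF card_mono card_poly_roots_bound[OF \<open>f \<noteq> 0\<close>]])
      (auto simp: I_def poly_roots_finite \<open>f \<noteq> 0\<close>)
  moreover have "card ((\<lambda>i. x + of_nat i) ` J) \<le> degree q"
    by (rule order_trans[OF card_mono card_poly_roots_bound[OF \<open>q \<noteq> 0\<close>]])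
      (auto simp: J_def poly_roots_finite \<open>q \<noteq> 0\<close>)
  moreover have "p \<le> card I + card J" using card_Un_le[of I J] IJ by (metis card_lessThan)
  ultimately have cI: "card I = d" using cardI cardJ f(3) degq \<open>d < p\<close> by simp
  have "finite I" by (simp add: I_def)
  note pr = coeff_prod_linear[OF \<open>finite I\<close>, of "\<lambda>i. x + of_nat i"]
  have "f = (\<Prod>i\<in>I. [:- (x + of_nat i), 1:])"
  proof (rule poly_eqI_degree_lead_coeff)
    show "degree f \<le> card ((\<lambda>i. x + of_nat i) ` I)"
      "degree (\<Prod>i\<in>I. [:- (x + of_nat i), 1:]) \<le> card ((\<lambda>i. x + of_nat i) ` I)"
      using pr cardI cI f(3) by simp_all
    show "coeff f (card ((\<lambda>i. x + of_nat i) ` I)) =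
        coeff (\<Prod>i\<in>I. [:- (x + of_nat i), 1:]) (card ((\<lambda>i. x + of_nat i) ` I))"
      using pr cardI cI f(3,4) by metis
    show "card ((\<lambda>i. x + of_nat i) ` I) \<le> card ((\<lambda>i. x + of_nat i) ` I)" ..
    fix z assume "z \<in> (\<lambda>i. x + of_nat i) ` I"
    then show "poly f z = poly (\<Prod>i\<in>I. [:- (x + of_nat i), 1:]) z"
      using \<open>finite I\<close> by (auto simp: I_def poly_prod intro!: prod_zero[symmetric])
  qed
  then have "coeff f (d - 1) = - (\<Sum>i\<in>I. x + of_nat i)" using pr cI \<open>d > 0\<close> by simp
  moreover have "(\<Sum>i\<in>I. x + of_nat i) = of_nat d * x + (\<Sum>i\<in>I. of_nat i)"
    using cI by (simp add: sum.distrib)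
  ultimately have "of_nat d * x = - coeff f (d - 1) - (\<Sum>i\<in>I. of_nat i)" by simp
  moreover have "- coeff f (d - 1) - (\<Sum>i\<in>I. of_nat i) \<in> F"
    using f(1) by (intro subfield_closed[OF F] subfield_sum[OF F]) (auto simp: poly_over_def)
  ultimately have dx: "of_nat d * x \<in> F" by simp
  have "(of_nat d :: 'a) \<noteq> 0"
    using \<open>d > 0\<close> \<open>d < p\<close> by (simp add: of_nat_eq_0_iff_char_dvd char nat_dvd_not_less)
  then have "x = (of_nat d * x) / of_nat d" by simp
  also have "\<dots> \<in> F" by (intro subfield_closed(8)[OF F] dx subfield_closed(10)[OF F])
  finally show False using x_notin by simp
qed

lemma reduce_mod_AS:
  assumes "poly_over F f"
  obtains q r where "poly_over F q" "poly_over F r" "f = AS * q + r" "degree r < p" "poly r x = poly f x"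
proof -
  obtain q r where qr: "poly_over F q" "poly_over F r" "f = AS * q + r" "degree r < p"
    using poly_over_division[OF F poly_over_AS lead_coeff_AS _ assms] degree_AS prime_gt_0_nat[OF p] by auto
  moreover have "poly r x = poly f x" using qr(3) by (simp add: poly_AS)
  ultimately show thesis using that by blast
qed

abbreviation E :: "'a set"
  where "E \<equiv> adjoin F {x}"

lemma E: "is_subfield E"
  by (rule adjoin_subfield)

lemma F_subset_E: "F \<subseteq> E" and x_in_E: "x \<in> E"
  using adjoin_superset(1)[of F "{x}"] adjoin_superset(2)[of "{x}" F] by auto

lemma simple_extension_eq: "ring.simple_extension ring_of_type_algebra F x = {poly f x |f. poly_over F f}"
proof -
  interpret A: field "ring_of_type_algebra :: 'a ring" by (rule field_ambient)
  have "z \<in> {poly f x |f. poly_over F f}" if "z \<in> A.simple_extension F x" for z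
    using that
  proof induction
    case zero
    show ?case by (auto simp: ambient_simps intro!: exI[of _ 0] poly_over_closed[OF F])
  next
    case (lin k1 k2)
    then obtain f where "poly_over F f" "k1 = poly f x" by blast
    then show ?case
      using lin.hyps(2) by (auto simp: ambient_simps intro!: exI[of _ "pCons k2 f"] poly_over_closed[OF F])
  qed
  moreover have "poly f x \<in> A.simple_extension F x" if "poly_over F f" for f
    using that
  proof (induction f)
    case 0
    show ?case using A.simple_extension.zero by (simp add: ambient_simps)
  next
    case (pCons a f)
    then show ?case
      using A.simple_extension.lin[of "poly f x" F x a]
      by (simp add: poly_over_pCons_iff ambient_simps algebra_simps)
  qed
  ultimately show ?thesis by blast
qed

text \<open>
  The ring generated by \<open>x\<close> over \<open>F\<close> is a field because \<open>x\<close> is algebraic. To say that, the polynomial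
  has to be written as a list with the leading coefficient first, hence the reversal.
\<close>

lemma finite_dimension_E: "ring.finite_dimension ring_of_type_algebra F E"
  and E_eq: "E = {poly f x |f. poly_over F f}"
proof -
  interpret A: field "ring_of_type_algebra :: 'a ring" by (rule field_ambient)
  let ?l = "rev (coeffs AS)"
  have eval: "A.eval (rev cs) x = poly (Poly cs) x" for cs
    by (induction cs) (simp_all add: A.eval_append_aux ambient_simps algebra_simps)
  have "AS \<noteq> 0" using degree_AS p by auto
  then have "?l \<noteq> []" "set ?l \<subseteq> F"
    using poly_over_AS by (auto simp: poly_over_def coeffs_def)
  have "?l \<in> carrier (univ_poly ring_of_type_algebra F)"
    using \<open>set ?l \<subseteq> F\<close> \<open>?l \<noteq> []\<close> \<open>AS \<noteq> 0\<close>
    by (auto simp: univ_poly_def polynomial_def ambient_simps hd_rev last_coeffs_eq_coeff_degree)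
  moreover have "A.eval ?l x = \<zero>\<^bsub>ring_of_type_algebra\<^esub>"
    by (simp add: eval poly_AS ambient_simps)
  ultimately have alg: "(A.algebraic over F) x"
    using \<open>?l \<noteq> []\<close> by (intro A.algebraicI)
  have "E = A.simple_extension F x"
  proof (rule antisym)
    have "is_subfield (A.simple_extension F x)"
      using alg by (simp add: A.simple_extension_is_subfield[OF F] ambient_simps)
    then show "E \<subseteq> A.simple_extension F x"
      using A.simple_extension_incl[of F x] A.simple_extension_mem[OF subfieldE(1)[OF F], of x]
      by (intro adjoin_least) (auto simp: ambient_simps)
    show "A.simple_extension F x \<subseteq> E"
      unfolding simple_extension_eq
      using poly_in_subfield[OF E poly_over_mono[OF _ F_subset_E] x_in_E] by blast
  qed
  then show "E = {poly f x |f. poly_over F f}" "A.finite_dimension F E"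
    using alg by (simp_all add: simple_extension_eq[symmetric] A.finite_dimension_simple_extension[OF F] ambient_simps)
qed

text \<open>
  The assumption on \<open>u\<close> says that \<open>x + u\<close> is a root of the polynomial that \<open>t\<close> makes out of
  \<open>X\<^sup>p - X - \<wp>(x)\<close>. As this polynomial generates all relations of \<open>x\<close> over \<open>F\<close>, sending \<open>f(x)\<close> to
  \<open>f\<^sup>t(x + u)\<close> is well defined. It is onto because \<open>u = t(u')\<close> for some \<open>u'\<close> in \<open>F\<close>, so \<open>x\<close> is the image
  of \<open>x - u'\<close>.
\<close>

lemma extend_automorphism:
  assumes t: "field_aut F t" and u: "u \<in> F" "wp p u = t (wp p x) - wp p x"
  obtains s where "field_aut E s" "\<And>k. k \<in> F \<Longrightarrow> s k = t k" "s x = x + u"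
proof -
  note t_simps = field_aut_closed[OF F t] field_aut_add[OF F t] field_aut_mult[OF F t]
    field_aut_sum[OF F t] field_aut_diff[OF F t] field_aut_one[OF F t]
  have t0 [simp]: "t 0 = 0" by (rule field_aut_zero[OF F t])
  let ?m = "map_poly t"
  have over: "poly_over F (?m f)" if "poly_over F f" for f
    using that by (auto simp: poly_over_def coeff_map_poly t_simps)
  have m_add: "?m (f + g) = ?m f + ?m g" and m_diff: "?m (f - g) = ?m f - ?m g"
    and m_mult: "?m (f * g) = ?m f * ?m g"
    if "poly_over F f" "poly_over F g" for f g
    using that by (auto intro!: poly_eqI simp: coeff_map_poly poly_over_def t_simps coeff_mult subfield_closed[OF F])
  define y where "y = x + u"
  have "?m AS = monom 1 p - [:t (wp p x), 1:]"
    unfolding AS_def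
    by (subst m_diff) (auto simp: poly_over_closed[OF F] subfield_closed[OF F] wp_x map_poly_monom map_poly_pCons t_simps)
  then have "poly (?m AS) y = wp p y - t (wp p x)" by (simp add: poly_monom wp_def)
  also have "\<dots> = 0" by (simp add: y_def wp_add[OF p char] u)
  finally have root: "poly (?m AS) y = 0" .
  have vanish: "poly (?m f) y = 0" if f: "poly_over F f" "poly f x = 0" for f
  proof -
    obtain q r where qr: "poly_over F q" "poly_over F r" "f = AS * q + r" "degree r < p" "poly r x = poly f x"
      using reduce_mod_AS[OF f(1)] .
    have "poly r x = 0" using qr(5) f(2) by (rule HOL.trans)
    then have "r = 0" by (rule no_relation_below_p[OF qr(2) _ qr(4)])
    then show ?thesis using qr root by (simp add: m_mult poly_over_AS)
  qed
  have well_defined: "poly (?m f) y = poly (?m g) y"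
    if "poly_over F f" "poly_over F g" "poly f x = poly g x" for f g
    using vanish[of "f - g"] that by (simp add: m_diff poly_over_closed[OF F])
  define s where "s z = poly (?m (SOME f. poly_over F f \<and> poly f x = z)) y" for z
  have s: "s (poly f x) = poly (?m f) y" if "poly_over F f" for f
  proof -
    have "\<exists>g. poly_over F g \<and> poly g x = poly f x" using that by blast
    then have "poly_over F (SOME g. poly_over F g \<and> poly g x = poly f x) \<and>
        poly (SOME g. poly_over F g \<and> poly g x = poly f x) x = poly f x" by (rule someI_ex)
    then show ?thesis unfolding s_def using that by (intro well_defined) auto
  qed
  have s_F: "s k = t k" if "k \<in> F" for k
    using s[of "[:k:]"] that by (simp add: poly_over_closed[OF F] map_poly_pCons)
  have s_x: "s x = y"
    using s[of "[:0, 1:]"] by (simp add: poly_over_closed[OF F] subfield_closed[OF F] map_poly_pCons t_simps)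
  have s_add: "s (v + w) = s v + s w" and s_mult: "s (v * w) = s v * s w" if "v \<in> E" "w \<in> E" for v w
  proof -
    obtain f g where fg: "poly_over F f" "poly_over F g" "v = poly f x" "w = poly g x"
      using \<open>v \<in> E\<close> \<open>w \<in> E\<close> unfolding E_eq by blast
    then show "s (v + w) = s v + s w" "s (v * w) = s v * s w"
      using s[of "f + g"] s[of "f * g"] by (simp_all add: poly_over_closed[OF F] s m_add m_mult)
  qed
  have y_E: "y \<in> E" using F_subset_E x_in_E u(1) by (auto simp: y_def intro!: subfield_closed[OF E])
  have "s ` E \<subseteq> E"
  proof
    fix w assume "w \<in> s ` E"
    then obtain f where f: "poly_over F f" "w = s (poly f x)" unfolding E_eq by blast
    then show "w \<in> E"
      using poly_in_subfield[OF E poly_over_mono[OF over F_subset_E] y_E] by (simp add: s)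
  qed
  moreover have "poly f x \<in> s ` E" if "poly_over F f" for f
    using that
  proof (induction f)
    case 0
    show ?case using s_F[of 0] subfield_closed(2)[OF F] F_subset_E by force
  next
    case (pCons a f)
    then obtain v where v: "v \<in> E" "poly f x = s v" by (auto simp: poly_over_pCons_iff)
    have "a \<in> F" using pCons.prems by (simp add: poly_over_pCons_iff)
    then obtain a' u' where a': "a' \<in> F" "a = t a'" "u' \<in> F" "u = t u'"
      using t u(1) unfolding field_aut_def by (metis imageE)
    have x: "x - u' \<in> E" using x_in_E a' F_subset_E by (auto intro: subfield_closed[OF E])
    have "s (x - u' + u') = s (x - u') + s u'" using x a' F_subset_E by (intro s_add) auto
    then have "s (x - u') = x" using s_x s_F a' by (simp add: y_def)
    moreover have "s (a' + (x - u') * v) = s a' + s (x - u') * s v"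
      using x a'(1) v(1) F_subset_E by (subst s_add) (auto simp: s_mult intro!: subfield_closed[OF E])
    ultimately have "poly (pCons a f) x = s (a' + (x - u') * v)" using v(2) a' by (simp add: s_F)
    moreover have "a' + (x - u') * v \<in> E" using x a' v F_subset_E by (auto intro!: subfield_closed[OF E])
    ultimately show ?case by blast
  qed
  ultimately have "s ` E = E" unfolding E_eq by blast
  then have "field_aut E s" using s_add s_mult by (simp add: field_aut_def)
  then show thesis using that s_F s_x by (simp add: y_def)
qed

text \<open>
  If \<open>z = f(x)\<close> with \<open>f\<close> of degree less than \<open>p\<close> is fixed, then \<open>f(x + i) = z\<close> for all \<open>i < p\<close>, so that \<open>f\<close>
  takes the value \<open>z\<close> more often than its degree allows and is constant.
\<close>

lemma fixed_field:
  assumes s: "field_aut E s" and fixes_F: "\<And>k. k \<in> F \<Longrightarrow> s k = k" and "s x = x + 1"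
    and z: "z \<in> E" "s z = z"
  shows "z \<in> F"
proof -
  obtain g where g: "poly_over F g" "z = poly g x" using z(1) unfolding E_eq by blast
  obtain q f where f: "poly_over F q" "poly_over F f" "g = AS * q + f" "degree f < p" "poly f x = poly g x"
    using reduce_mod_AS[OF g(1)] .
  note f = f(2) g(2)[folded f(5)] f(4)
  have s_poly: "s (poly g w) = poly g (s w)" if "poly_over F g" "w \<in> E" for g w
    using that(1)
  proof (induction g)
    case 0
    show ?case using field_aut_zero[OF E s] by simp
  next
    case (pCons a g)
    then have "a \<in> E" "poly g w \<in> E" "s a = a"
      using F_subset_E fixes_F poly_in_subfield[OF E poly_over_mono[OF _ F_subset_E] that(2)]
      by (auto simp: poly_over_pCons_iff)
    then show ?case
      using pCons that(2)
      by (simp add: poly_over_pCons_iff field_aut_add[OF E s] field_aut_mult[OF E s] subfield_closed[OF E])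
  qed
  have "poly f (x + of_nat i) = z" for i
  proof (induction i)
    case (Suc i)
    have "x + of_nat i \<in> E" using x_in_E by (simp add: subfield_closed[OF E])
    moreover have "s (x + of_nat i) = x + of_nat (Suc i)"
      using x_in_E assms(3)
      by (simp add: field_aut_add[OF E s] field_aut_of_nat[OF E s] subfield_closed[OF E])
    ultimately show ?case using s_poly[OF f(1), of "x + of_nat i"] Suc z(2) by simp
  qed (simp add: f)
  then have "f = [:z:]"
    using f(3) card_image[OF inj_translates]
    by (intro poly_eqI_degree[of "(\<lambda>i. x + of_nat i) ` {..<p}"]) (auto simp: prime_gt_0_nat p)
  then show ?thesis using f(1) by (simp add: poly_over_pCons_iff)
qed

end

section \<open>Automorphisms acting by translations\<close>

lemma Gal_eqI:
  assumes L: "is_subfield L" and "L = adjoin K A"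
    and s: "s \<in> carrier (Gal L K)" and t: "t \<in> carrier (Gal L K)"
    and "\<And>x. x \<in> A \<Longrightarrow> s x = t x"
  shows "s = t"
proof (rule extensionalityI)
  show "s \<in> extensional L" "t \<in> extensional L" using s t by (simp_all add: Gal_mem_iff[OF L])
  show "s x = t x" if "x \<in> L" for x
    by (rule field_aut_eqI[OF L _ _ assms(2) _ that]) (use s t assms(5) in \<open>auto simp: Gal_mem_iff[OF L]\<close>)
qed

lemma Gal_restrict:
  assumes L: "is_subfield L" and "K \<subseteq> L" "field_aut L s" "\<And>k. k \<in> K \<Longrightarrow> s k = k"
  shows "restrict s L \<in> carrier (Gal L K)"
  using assms by (auto simp: Gal_mem_iff[OF L] field_aut_def subfield_closed[OF L] image_def)

lemma Gal_closed:
  assumes L: "is_subfield L" and s: "s \<in> carrier (Gal L K)" and "x \<in> L"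
  shows "s x \<in> L"
  using assms by (auto simp: Gal_mem_iff[OF L] field_aut_def)

lemma Gal_pow_Suc:
  assumes L: "is_subfield L" "K \<subseteq> L" and s: "s \<in> carrier (Gal L K)" and x: "x \<in> L"
  shows "(s [^]\<^bsub>Gal L K\<^esub> Suc n) x = (s [^]\<^bsub>Gal L K\<^esub> n) (s x)"
proof -
  interpret group "Gal L K" by (rule group_Gal[OF L])
  show ?thesis using s x by (simp add: Gal_mult)
qed

lemma field_aut_wp:
  assumes "is_subfield L" "field_aut L s" "x \<in> L"
  shows "s (wp p x) = wp p (s x)"
  using assms by (simp add: wp_def field_aut_diff field_aut_power subfield_closed)

text \<open>
  By Frobenius the left-hand side is \<open>S(x + \<kappa>, 1) - S(x, 1)\<close>. The cocycle identities for \<open>(x, \<kappa>, 1)\<close> and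
  \<open>(x, 1, \<kappa>)\<close> have the same right-hand side, and comparing them gives the claim.
\<close>

lemma wp_carry_1:
  assumes p: "prime p" and char: "CHAR('a::field) = p" and "wp p (x::'a) = \<kappa>"
  shows "wp p (carry p x 1) = carry p (x + 1) \<kappa> - carry p x \<kappa>"
proof -
  have "x ^ p = x + \<kappa>" using assms(3) by (simp add: wp_def algebra_simps)
  then have "wp p (carry p x 1) = carry p (x + \<kappa>) 1 - carry p x 1"
    by (simp add: wp_carry[OF p char])
  also have "carry p x \<kappa> + carry p (x + \<kappa>) 1 = carry p x 1 + carry p (x + 1) \<kappa>"
    using carry_cocycle[OF p, of x \<kappa> 1] carry_cocycle[OF p, of x 1 \<kappa>] carry_commute[of p \<kappa> 1]
    by (simp add: add.commute)
  then have "carry p (x + \<kappa>) 1 - carry p x 1 = carry p (x + 1) \<kappa> - carry p x \<kappa>"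
    by (simp add: algebra_simps)
  finally show ?thesis .
qed

lemma Gal_pow_translation:
  assumes L: "is_subfield L" "K \<subseteq> L" and s: "s \<in> carrier (Gal L K)"
    and x: "x \<in> L" "s x = x + of_nat m"
  shows "(s [^]\<^bsub>Gal L K\<^esub> n) x = x + of_nat (n * m)"
proof (induction n)
  case 0
  show ?case using x by (simp add: Gal_one)
next
  case (Suc n)
  interpret group "Gal L K" by (rule group_Gal[OF L])
  have sn: "field_aut L (s [^]\<^bsub>Gal L K\<^esub> n)" using s Gal_mem_iff[OF L(1)] nat_pow_closed by blast
  show ?case
    using Suc x
    by (simp only: Gal_pow_Suc[OF L s] field_aut_add[OF L(1) sn] field_aut_of_nat[OF L(1) sn]
        subfield_closed[OF L(1)]) (simp add: algebra_simps)
qed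

text \<open>
  The \<open>n\<close>-th power of \<open>s\<close> adds \<open>n v + m (\<Sum>i<n. S(x + i, 1))\<close> to \<open>y\<close>; for \<open>n = p\<close> the first summand
  vanishes and the sum is 1.
\<close>

lemma Gal_pow_carry:
  fixes L :: "'a::field set"
  assumes p: "prime p" and char: "CHAR('a) = p"
    and L: "is_subfield L" "K \<subseteq> L" and s: "s \<in> carrier (Gal L K)"
    and x: "x \<in> L" "s x = x + 1" and v: "v \<in> L" "s v = v"
    and y: "y \<in> L" "s y = y + v + of_nat m * carry p x 1"
  shows "(s [^]\<^bsub>Gal L K\<^esub> p) y = y + of_nat m"
proof -
  interpret group "Gal L K" by (rule group_Gal[OF L])
  have "(s [^]\<^bsub>Gal L K\<^esub> n) y = y + of_nat n * v + of_nat m * (\<Sum>i<n. carry p (x + of_nat i) 1)" for n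
  proof (induction n)
    case 0
    show ?case using y by (simp add: Gal_one)
  next
    case (Suc n)
    have sn: "field_aut L (s [^]\<^bsub>Gal L K\<^esub> n)" using s Gal_mem_iff[OF L(1)] nat_pow_closed by blast
    have "(s [^]\<^bsub>Gal L K\<^esub> n) x = x + of_nat n" "(s [^]\<^bsub>Gal L K\<^esub> n) v = v"
      using Gal_pow_translation[OF L s x(1), of 1 n] Gal_pow_translation[OF L s v(1), of 0 n] x v by simp_all
    moreover have "(s [^]\<^bsub>Gal L K\<^esub> Suc n) y = (s [^]\<^bsub>Gal L K\<^esub> n) y + (s [^]\<^bsub>Gal L K\<^esub> n) v
        + of_nat m * carry p ((s [^]\<^bsub>Gal L K\<^esub> n) x) 1"
      unfolding Gal_pow_Suc[OF L s y(1)]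
      by (simp only: y x v field_aut_add[OF L(1) sn] field_aut_mult[OF L(1) sn] field_aut_of_nat[OF L(1) sn]
          field_aut_one[OF L(1) sn] field_aut_carry[OF L(1) sn] subfield_closed[OF L(1)] subfield_carry[OF L(1)])
    ultimately show ?case using Suc by (simp add: algebra_simps)
  qed
  from this[of p] show ?thesis
    using of_nat_CHAR[where 'a = 'a] by (simp add: sum_carry_translates[OF p char] char)
qed

text \<open>
  The exponents of a normal form can be read off its action modulo \<open>p\<close>; the last exponent appears on \<open>x3\<close>
  once the first two are zero.
\<close>

lemma normal_form_action:
  assumes L: "is_subfield L" "K \<subseteq> L"
    and abc: "a \<in> carrier (Gal L K)" "b \<in> carrier (Gal L K)" "c \<in> carrier (Gal L K)"
    and x: "x1 \<in> L" "x2 \<in> L" "x3 \<in> L"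
    and act: "a x1 = x1 + 1" "a x2 = x2" "b x1 = x1" "b x2 = x2 + 1" "c x1 = x1" "c x2 = x2" "c x3 = x3 + 1"
  defines "t i j k \<equiv> a [^]\<^bsub>Gal L K\<^esub> i \<otimes>\<^bsub>Gal L K\<^esub> b [^]\<^bsub>Gal L K\<^esub> j \<otimes>\<^bsub>Gal L K\<^esub> c [^]\<^bsub>Gal L K\<^esub> (k::nat)"
  shows "t i j k x1 = x1 + of_nat i" "t i j k x2 = x2 + of_nat j" "t 0 0 k x3 = x3 + of_nat k"
proof -
  interpret group "Gal L K" by (rule group_Gal[OF L])
  have carr: "a [^]\<^bsub>Gal L K\<^esub> i \<in> carrier (Gal L K)" "b [^]\<^bsub>Gal L K\<^esub> j \<in> carrier (Gal L K)"
    "c [^]\<^bsub>Gal L K\<^esub> k \<in> carrier (Gal L K)" for i j k :: nat by (simp_all add: abc)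
  have t: "t i j k x = (a [^]\<^bsub>Gal L K\<^esub> i) ((b [^]\<^bsub>Gal L K\<^esub> j) ((c [^]\<^bsub>Gal L K\<^esub> k) x))" if "x \<in> L" for x i j k
    unfolding t_def using that carr Gal_closed[OF L(1) carr(3) that] by (simp add: Gal_mult)
  have ai: "field_aut L (a [^]\<^bsub>Gal L K\<^esub> i)" for i :: nat
    using carr(1) Gal_mem_iff[OF L(1)] by blast
  note tr = Gal_pow_translation[OF L]
  have c: "(c [^]\<^bsub>Gal L K\<^esub> k) x1 = x1" "(c [^]\<^bsub>Gal L K\<^esub> k) x2 = x2" "(c [^]\<^bsub>Gal L K\<^esub> k) x3 = x3 + of_nat k" for k
    using tr[OF abc(3) x(1), of 0 k] tr[OF abc(3) x(2), of 0 k] tr[OF abc(3) x(3), of 1 k] act by simp_all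
  have b: "(b [^]\<^bsub>Gal L K\<^esub> j) x1 = x1" "(b [^]\<^bsub>Gal L K\<^esub> j) x2 = x2 + of_nat j" for j
    using tr[OF abc(2) x(1), of 0 j] tr[OF abc(2) x(2), of 1 j] act by simp_all
  have a: "(a [^]\<^bsub>Gal L K\<^esub> i) x1 = x1 + of_nat i" "(a [^]\<^bsub>Gal L K\<^esub> i) x2 = x2" for i
    using tr[OF abc(1) x(1), of 1 i] tr[OF abc(1) x(2), of 0 i] act by simp_all
  show "t i j k x1 = x1 + of_nat i" "t i j k x2 = x2 + of_nat j" "t 0 0 k x3 = x3 + of_nat k"
    using x by (simp_all add: t a b c Gal_one field_aut_add[OF L(1) ai] field_aut_of_nat[OF L(1) ai]
        subfield_closed[OF L(1)])
qed

section \<open>The tower of Artin-Schreier extensions\<close>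

locale artin_schreier_tower =
  fixes p e f :: nat and K :: "'a::field set" and \<kappa>1 \<kappa>2 \<kappa>3 x1 x2 x3 :: 'a
  assumes p: "prime p" and char: "CHAR('a) = p" and K: "is_subfield K"
    and \<kappa>: "\<kappa>1 \<in> K" "\<kappa>2 \<in> K" "\<kappa>3 \<in> K" and indep: "independent_cosets p K \<kappa>1 \<kappa>2"
    and wp_x: "wp p x1 = \<kappa>1" "wp p x2 = \<kappa>2"
      "wp p x3 = - \<kappa>2 * x1 + of_nat e * carry p x1 \<kappa>1 + of_nat f * carry p x2 \<kappa>2 + \<kappa>3"
begin

abbreviation "F1 \<equiv> adjoin K {x1}"
abbreviation "F2 \<equiv> adjoin F1 {x2}"
abbreviation "L \<equiv> adjoin F2 {x3}"

lemma F1: "is_subfield F1" and F2: "is_subfield F2" and L: "is_subfield L"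
  by (rule adjoin_subfield)+

lemma tower: "K \<subseteq> F1" "F1 \<subseteq> F2" "F2 \<subseteq> L" "K \<subseteq> F2" "K \<subseteq> L" "F1 \<subseteq> L"
  by (blast intro: subsetD[OF adjoin_superset(1)])+

lemma x_mem: "x1 \<in> F1" "x2 \<in> F2" "x3 \<in> L" "x1 \<in> F2" "x1 \<in> L" "x2 \<in> L"
  by (blast intro: subsetD[OF adjoin_superset(1)] subsetD[OF adjoin_superset(2)])+

lemma L_eq: "L = adjoin K {x1, x2, x3}"
  by (simp add: adjoin_adjoin insert_commute)

lemma no_combination:
  assumes "y \<in> K" "wp p y = of_nat i * \<kappa>1 + of_int j * \<kappa>2"
  shows "of_int j = (0::'a)" "of_nat i = (0::'a)"
proof -
  have "of_nat i * \<kappa>1 + of_int j * \<kappa>2 \<in> wp p ` K" using assms by (metis imageI)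
  moreover have "of_nat i = (of_int (int i) :: 'a)" by simp
  ultimately show "of_int j = (0::'a)" "of_nat i = (0::'a)"
    using indep unfolding independent_cosets_def by (metis rangeI)+
qed

lemma step1: "artin_schreier_step p K x1"
proof (rule artin_schreier_step.intro)
  show "x1 \<notin> K" using no_combination(2)[of x1 1 0] wp_x by auto
qed (simp_all add: p char K wp_x \<kappa>)

lemma exists_aut_F1:
  obtains s where "field_aut F1 s" "\<And>k. k \<in> K \<Longrightarrow> s k = k" "s x1 = x1 + 1"
proof -
  interpret artin_schreier_step p K x1 by (rule step1)
  have "field_aut K (\<lambda>k. k)" by (simp add: field_aut_def)
  then obtain s where "field_aut F1 s" "\<And>k. k \<in> K \<Longrightarrow> s k = k" "s x1 = x1 + 1"
    using extend_automorphism[of "\<lambda>k. k" 1] wp_of_nat[OF p char, of 1] subfield_closed(1)[OF K] by auto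
  then show thesis using that by blast
qed

text \<open>
  If \<open>x2\<close> were in \<open>K(x1)\<close>, then the automorphism \<open>x1 \<mapsto> x1 + 1\<close> would add some \<open>j\<close> of the prime field to
  it, so that \<open>x2 - j x1\<close> would be fixed, hence in \<open>K\<close>, and \<open>\<kappa>2 - j \<kappa>1\<close> would be in \<open>\<wp>(K)\<close>.
\<close>

lemma step2: "artin_schreier_step p F1 x2"
proof (rule artin_schreier_step.intro)
  obtain s where s: "field_aut F1 s" "\<And>k. k \<in> K \<Longrightarrow> s k = k" "s x1 = x1 + 1"
    using exists_aut_F1 by blast
  interpret step1: artin_schreier_step p K x1 by (rule step1)
  show "x2 \<notin> F1"
  proof
    assume x2: "x2 \<in> F1"
    have "s (wp p x2) = wp p x2" using s(2) \<kappa> wp_x by simp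
    then have "wp p (s x2 - x2) = 0"
      by (simp add: wp_diff[OF p char] field_aut_wp[OF F1 s(1) x2])
    then obtain j where "s x2 - x2 = of_nat j" using wp_eq_0_imp_of_nat[OF p char] by blast
    then have "s x2 = x2 + of_nat j" by (simp add: algebra_simps)
    then have "s (x2 - of_nat j * x1) = x2 - of_nat j * x1"
      using x2 x_mem
      by (simp add: field_aut_diff[OF F1 s(1)] field_aut_mult[OF F1 s(1)] field_aut_of_nat[OF F1 s(1)] s(3)
          subfield_closed[OF F1] algebra_simps)
    moreover have "x2 - of_nat j * x1 \<in> F1" using x2 x_mem by (simp add: subfield_closed[OF F1])
    ultimately have "x2 - of_nat j * x1 \<in> K" using s by (intro step1.fixed_field)
    \<comment> \<open>The elements of the prime field are images of natural numbers, also \<open>- j = (p - 1) j\<close>.\<close>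
    moreover have "\<exists>i. (- of_nat j :: 'a) = of_nat i"
    proof
      show "- of_nat j = (of_nat ((p - 1) * j) :: 'a)"
        using of_nat_CHAR[where 'a = 'a] prime_gt_0_nat[OF p] by (simp add: char of_nat_diff)
    qed
    ultimately obtain i where "x2 - of_nat j * x1 \<in> K" "wp p (x2 - of_nat j * x1) = of_nat i * \<kappa>1 + of_int 1 * \<kappa>2"
      by (auto simp: wp_diff[OF p char] wp_of_nat_mult[OF p char] wp_x)
        (metis add.commute diff_conv_add_uminus mult_minus_left)
    from no_combination(1)[OF this] show False by simp
  qed
qed (simp_all add: p char F1 wp_x \<kappa> subsetD[OF tower(1)])

lemma exists_aut_F2:
  obtains t1 t2 where
    "field_aut F2 t1" "\<And>k. k \<in> K \<Longrightarrow> t1 k = k" "t1 x1 = x1 + 1" "t1 x2 = x2"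
    "field_aut F2 t2" "\<And>k. k \<in> F1 \<Longrightarrow> t2 k = k" "t2 x2 = x2 + 1"
proof -
  interpret step2: artin_schreier_step p F1 x2 by (rule step2)
  obtain s where s: "field_aut F1 s" "\<And>k. k \<in> K \<Longrightarrow> s k = k" "s x1 = x1 + 1"
    using exists_aut_F1 by blast
  have wp0: "wp p (0::'a) = 0" and wp1: "wp p (1::'a) = 0"
    using wp_of_nat[OF p char, of 0] wp_of_nat[OF p char, of 1] by simp_all
  have "wp p 0 = s (wp p x2) - wp p x2" using s(2) \<kappa> wp_x wp0 by simp
  then obtain t1 where t1: "field_aut F2 t1" "\<And>k. k \<in> F1 \<Longrightarrow> t1 k = s k" "t1 x2 = x2 + 0"
    using step2.extend_automorphism[OF s(1) subfield_closed(2)[OF F1]] by blast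
  have "field_aut F1 (\<lambda>k. k)" by (simp add: field_aut_def)
  then obtain t2 where t2: "field_aut F2 t2" "\<And>k. k \<in> F1 \<Longrightarrow> t2 k = k" "t2 x2 = x2 + 1"
    using step2.extend_automorphism[of "\<lambda>k. k" 1] wp1 subfield_closed(1)[OF F1] by auto
  have "t1 k = k" if "k \<in> K" for k using that t1(2) s(2) tower(1) by auto
  moreover have "t1 x1 = x1 + 1" "t1 x2 = x2" using t1(2,3) s(3) x_mem(1) by simp_all
  ultimately show thesis using that[of t1 t2] t1(1) t2 by blast
qed

definition rhs where "rhs = - \<kappa>2 * x1 + of_nat e * carry p x1 \<kappa>1 + of_nat f * carry p x2 \<kappa>2 + \<kappa>3"

text \<open>
  The displacements of \<open>x3\<close> by the lifts of \<open>x1 \<mapsto> x1 + 1\<close> and \<open>x2 \<mapsto> x2 + 1\<close>.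
\<close>

definition d1 where "d1 = - x2 + of_nat e * carry p x1 1"
definition d2 where "d2 = of_nat f * carry p x2 1"

lemma d_mem: "d1 \<in> F2" "d2 \<in> F2" "rhs \<in> F2"
  using x_mem \<kappa> subsetD[OF tower(4)]
  by (auto simp: d1_def d2_def rhs_def intro!: subfield_closed[OF F2] subfield_carry[OF F2])

text \<open>
  This is where the shape of the equation for \<open>x3\<close> matters: the effect of either shift on the right-hand
  side is the image under \<open>\<wp>\<close> of an element of \<open>K(x1, x2)\<close>, which may then be added to \<open>x3\<close>.
\<close>

lemma rhs_shift:
  assumes "is_subfield M" "field_aut M s" "K \<subseteq> M" "\<And>k. k \<in> K \<Longrightarrow> s k = k" "x1 \<in> M" "x2 \<in> M"
  shows "s x1 = x1 + 1 \<Longrightarrow> s x2 = x2 \<Longrightarrow> s rhs - rhs = wp p d1"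
    "s x1 = x1 \<Longrightarrow> s x2 = x2 + 1 \<Longrightarrow> s rhs - rhs = wp p d2"
    "s x1 = x1 \<Longrightarrow> s x2 = x2 \<Longrightarrow> s rhs = rhs"
proof -
  note M = assms(1) and s = assms(2)
  have k: "\<kappa>1 \<in> M" "\<kappa>2 \<in> M" "\<kappa>3 \<in> M" using \<kappa> assms(3) by auto
  have eq: "s rhs = - \<kappa>2 * s x1 + of_nat e * carry p (s x1) \<kappa>1 + of_nat f * carry p (s x2) \<kappa>2 + \<kappa>3"
    using k assms(5,6) \<kappa>
    by (simp add: rhs_def field_aut_add[OF M s] field_aut_diff[OF M s] field_aut_uminus[OF M s] field_aut_mult[OF M s]
        field_aut_of_nat[OF M s] field_aut_carry[OF M s] assms(4) subfield_closed[OF M] subfield_carry[OF M])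
  show "s x1 = x1 + 1 \<Longrightarrow> s x2 = x2 \<Longrightarrow> s rhs - rhs = wp p d1"
    "s x1 = x1 \<Longrightarrow> s x2 = x2 + 1 \<Longrightarrow> s rhs - rhs = wp p d2"
    "s x1 = x1 \<Longrightarrow> s x2 = x2 \<Longrightarrow> s rhs = rhs"
    unfolding eq
    by (simp_all add: rhs_def d1_def d2_def wp_add[OF p char] wp_diff[OF p char] wp_uminus[OF p char] wp_of_nat_mult[OF p char]
        wp_carry_1[OF p char] wp_x algebra_simps)
qed

lemma wp_x3: "wp p x3 = rhs"
  by (simp add: wp_x rhs_def)

text \<open>
  If \<open>x3\<close> were in \<open>K(x1, x2)\<close>, then its automorphisms \<open>x1 \<mapsto> x1 + 1\<close> and \<open>x2 \<mapsto> x2 + 1\<close> would act on \<open>x3\<close> by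
  adding \<open>d1\<close> and \<open>d2\<close> up to elements of the prime field. Because of the summand \<open>- x2\<close> of \<open>d1\<close>, their two
  compositions would differ by 1 on \<open>x3\<close>; but they commute on \<open>x1\<close> and \<open>x2\<close>, hence everywhere.
\<close>

lemma step3: "artin_schreier_step p F2 x3"
proof (rule artin_schreier_step.intro)
  obtain t1 t2 where t1: "field_aut F2 t1" "\<And>k. k \<in> K \<Longrightarrow> t1 k = k" "t1 x1 = x1 + 1" "t1 x2 = x2"
    and t2: "field_aut F2 t2" "\<And>k. k \<in> F1 \<Longrightarrow> t2 k = k" "t2 x2 = x2 + 1"
    using exists_aut_F2 by blast
  have t2': "\<And>k. k \<in> K \<Longrightarrow> t2 k = k" "t2 x1 = x1" using t2(2) tower(1) x_mem(1) by auto
  have wp_t: "wp p (t x3) = t rhs" if "field_aut F2 t" "x3 \<in> F2" for t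
    using field_aut_wp[OF F2 that, of p] wp_x3 by simp
  show "x3 \<notin> F2"
  proof
    assume x3: "x3 \<in> F2"
    have "wp p (t1 x3 - x3 - d1) = 0"
      using rhs_shift(1)[OF F2 t1(1) tower(4) t1(2) x_mem(4,2) t1(3,4)] wp_t[OF t1(1) x3] wp_x3
      by (simp add: wp_diff[OF p char])
    then obtain i where i: "t1 x3 - x3 - d1 = of_nat i" using wp_eq_0_imp_of_nat[OF p char] by blast
    have "wp p (t2 x3 - x3 - d2) = 0"
      using rhs_shift(2)[OF F2 t2(1) tower(4) t2'(1) x_mem(4,2) t2'(2) t2(3)] wp_t[OF t2(1) x3] wp_x3
      by (simp add: wp_diff[OF p char])
    then obtain j where j: "t2 x3 - x3 - d2 = of_nat j" using wp_eq_0_imp_of_nat[OF p char] by blast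
    have t1x3: "t1 x3 = x3 + d1 + of_nat i" and t2x3: "t2 x3 = x3 + d2 + of_nat j"
      using i j by (simp_all add: algebra_simps)
    have carry_mem: "carry p x1 1 \<in> F2" "carry p x2 1 \<in> F2"
      using x_mem by (simp_all add: subfield_carry[OF F2] subfield_closed[OF F2])
    have t1d2: "t1 d2 = d2" and t2d1: "t2 d1 = d1 - 1"
      using x_mem carry_mem
      by (simp_all add: d1_def d2_def field_aut_add[OF F2] field_aut_uminus[OF F2] field_aut_diff[OF F2]
          field_aut_mult[OF F2] field_aut_carry[OF F2] field_aut_one[OF F2] field_aut_of_nat[OF F2]
          subfield_closed[OF F2] t1 t2 t2')
    have t12: "t1 (t2 x3) = x3 + d1 + of_nat i + d2 + of_nat j"
      using x3 d_mem
      by (simp add: t2x3 field_aut_add[OF F2 t1(1)] field_aut_of_nat[OF F2 t1(1)] subfield_closed[OF F2] t1x3 t1d2)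
    have t21: "t2 (t1 x3) = x3 + d2 + of_nat j + (d1 - 1) + of_nat i"
      using x3 d_mem
      by (simp add: t1x3 field_aut_add[OF F2 t2(1)] field_aut_of_nat[OF F2 t2(1)] subfield_closed[OF F2] t2x3 t2d1)
    have "t1 (t2 x3) = t2 (t1 x3)"
    proof (rule field_aut_eqI[OF F2 field_aut_comp[OF t1(1) t2(1)] field_aut_comp[OF t2(1) t1(1)] _ _ x3])
      show "F2 = adjoin K {x1, x2}" by (simp add: adjoin_adjoin insert_commute)
      show "t1 (t2 y) = t2 (t1 y)" if "y \<in> K \<union> {x1, x2}" for y
        using that x_mem
        by (auto simp: t1 t2 t2' field_aut_add[OF F2] field_aut_one[OF F2] subfield_closed[OF F2])
    qed
    then show False by (simp add: t12 t21)
  qed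
qed (simp_all add: p char F2 wp_x3 d_mem)

lemma L_algebraic: "y \<in> L \<Longrightarrow> ring.algebraic ring_of_type_algebra K y"
proof -
  interpret A: field "ring_of_type_algebra :: 'a ring" by (rule field_ambient)
  have "A.finite_dimension K F2"
    using artin_schreier_step.finite_dimension_E[OF step1] artin_schreier_step.finite_dimension_E[OF step2]
    by (rule A.telescopic_base_dim(1)[OF K F1])
  then have "A.finite_dimension K L"
    using artin_schreier_step.finite_dimension_E[OF step3] by (rule A.telescopic_base_dim(1)[OF K F2])
  then show "y \<in> L \<Longrightarrow> A.algebraic K y"
    using A.finite_dimension_imp_algebraic[OF K subfieldE(1)[OF L]] by (simp add: over_def)
qed

text \<open>
  An element fixed by \<open>a\<close>, \<open>b\<close> and \<open>c\<close> descends through the tower, one automorphism for each step.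
\<close>

lemma exists_generators:
  obtains a b c where
    "a \<in> carrier (Gal L K)" "a x1 = x1 + 1" "a x2 = x2" "a x3 = x3 + d1"
    "b \<in> carrier (Gal L K)" "b x1 = x1" "b x2 = x2 + 1" "b x3 = x3 + d2"
    "c \<in> carrier (Gal L K)" "c x1 = x1" "c x2 = x2" "c x3 = x3 + 1"
    "\<And>z. z \<in> L \<Longrightarrow> a z = z \<Longrightarrow> b z = z \<Longrightarrow> c z = z \<Longrightarrow> z \<in> K"
proof -
  interpret s3: artin_schreier_step p F2 x3 by (rule step3)
  interpret s2: artin_schreier_step p F1 x2 by (rule step2)
  interpret s1: artin_schreier_step p K x1 by (rule step1)
  obtain t1 t2 where t1: "field_aut F2 t1" "\<And>k. k \<in> K \<Longrightarrow> t1 k = k" "t1 x1 = x1 + 1" "t1 x2 = x2"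
    and t2: "field_aut F2 t2" "\<And>k. k \<in> F1 \<Longrightarrow> t2 k = k" "t2 x2 = x2 + 1"
    using exists_aut_F2 by blast
  have t2': "\<And>k. k \<in> K \<Longrightarrow> t2 k = k" "t2 x1 = x1" using t2(2) tower(1) x_mem(1) by auto
  have t3: "field_aut F2 (\<lambda>k. k)" by (simp add: field_aut_def)
  have "wp p d1 = t1 (wp p x3) - wp p x3"
    using rhs_shift(1)[OF F2 t1(1) tower(4) t1(2) x_mem(4,2) t1(3,4)] by (simp add: wp_x3)
  then obtain a where a: "field_aut L a" "\<And>k. k \<in> F2 \<Longrightarrow> a k = t1 k" "a x3 = x3 + d1"
    using s3.extend_automorphism[OF t1(1) d_mem(1)] by blast
  have "wp p d2 = t2 (wp p x3) - wp p x3"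
    using rhs_shift(2)[OF F2 t2(1) tower(4) t2'(1) x_mem(4,2) t2'(2) t2(3)] by (simp add: wp_x3)
  then obtain b where b: "field_aut L b" "\<And>k. k \<in> F2 \<Longrightarrow> b k = t2 k" "b x3 = x3 + d2"
    using s3.extend_automorphism[OF t2(1) d_mem(2)] by blast
  have "wp p 1 = wp p x3 - wp p x3" using wp_of_nat[OF p char, of 1] by simp
  then obtain c where c: "field_aut L c" "\<And>k. k \<in> F2 \<Longrightarrow> c k = k" "c x3 = x3 + 1"
    using s3.extend_automorphism[OF t3 subfield_closed(1)[OF F2]] by blast
  have in_F2: "\<And>k. k \<in> K \<Longrightarrow> k \<in> F2" using tower(4) by blast
  show thesis
  proof
    show "restrict a L \<in> carrier (Gal L K)" "restrict b L \<in> carrier (Gal L K)" "restrict c L \<in> carrier (Gal L K)"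
      using a b c t1(2) t2'(1) in_F2 by (simp_all add: Gal_restrict[OF L tower(5)])
    fix z assume z: "z \<in> L" "restrict a L z = z" "restrict b L z = z" "restrict c L z = z"
    then have "z \<in> F2" using s3.fixed_field[OF c] by simp
    moreover from this have "t2 z = z" using b(2) z by simp
    ultimately have "z \<in> F1" using s2.fixed_field[OF t2] by simp
    obtain s where s: "field_aut F1 s" "\<And>k. k \<in> K \<Longrightarrow> s k = k" "s x1 = x1 + 1" using exists_aut_F1 by blast
    \<comment> \<open>Both \<open>s\<close> and \<open>a\<close> fix \<open>K\<close> and send \<open>x1\<close> to \<open>x1 + 1\<close>, so they agree on \<open>F1\<close>.\<close>
    have "s z = z"
    proof -
      have M: "is_subfield {v \<in> F1. s v = t1 v}"
        unfolding subfield_iff_closed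
        using tower(2)
        by (auto simp: subfield_closed[OF F1] field_aut_one[OF F1 s(1)] field_aut_one[OF F2 t1(1)]
            field_aut_uminus[OF F1 s(1)] field_aut_uminus[OF F2 t1(1)] field_aut_inverse[OF F1 s(1)]
            field_aut_inverse[OF F2 t1(1)] field_aut_add[OF F1 s(1)] field_aut_add[OF F2 t1(1)]
            field_aut_mult[OF F1 s(1)] field_aut_mult[OF F2 t1(1)] subsetD)
      then have "F1 \<subseteq> {v \<in> F1. s v = t1 v}"
        using s t1 x_mem tower(1) by (intro adjoin_least) auto
      then have "s z = t1 z" using \<open>z \<in> F1\<close> by blast
      also have "\<dots> = a z" using a(2) \<open>z \<in> F2\<close> by simp
      finally show ?thesis using z by simp
    qed
    then show "z \<in> K" using s1.fixed_field[OF s \<open>z \<in> F1\<close>] by simp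
  qed (use a b c t1 t2 t2' x_mem in auto)
qed

context
  fixes a b c
  assumes a: "a \<in> carrier (Gal L K)" "a x1 = x1 + 1" "a x2 = x2" "a x3 = x3 + d1"
    and b: "b \<in> carrier (Gal L K)" "b x1 = x1" "b x2 = x2 + 1" "b x3 = x3 + d2"
    and c: "c \<in> carrier (Gal L K)" "c x1 = x1" "c x2 = x2" "c x3 = x3 + 1"
begin

interpretation Gal: group "Gal L K" by (rule group_Gal[OF L tower(5)])

lemma eq_at_generators:
  assumes "s \<in> carrier (Gal L K)" "t \<in> carrier (Gal L K)" "s x1 = t x1" "s x2 = t x2" "s x3 = t x3"
  shows "s = t"
  using Gal_eqI[OF L L_eq assms(1,2)] assms(3-5) by blast

lemma auts: "field_aut L a" "field_aut L b" "field_aut L c"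
  using a(1) b(1) c(1) by (simp_all add: Gal_mem_iff[OF L])

lemma L_mem: "d1 \<in> L" "d2 \<in> L" "1 \<in> L" "carry p x1 1 \<in> L" "carry p x2 1 \<in> L"
  using d_mem tower(3) x_mem by (auto simp: subfield_closed[OF L] subfield_carry[OF L])

lemma d_action: "a d2 = d2" "b d1 = d1 - 1" "c d1 = d1" "c d2 = d2"
  using x_mem L_mem a b c
  by (simp_all add: d1_def d2_def field_aut_add[OF L] field_aut_uminus[OF L] field_aut_diff[OF L]
      field_aut_mult[OF L] field_aut_carry[OF L] field_aut_one[OF L] field_aut_of_nat[OF L]
      subfield_closed[OF L] auts)

lemma c_pow: "(c [^]\<^bsub>Gal L K\<^esub> n) x1 = x1" "(c [^]\<^bsub>Gal L K\<^esub> n) x2 = x2"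
  "(c [^]\<^bsub>Gal L K\<^esub> n) x3 = x3 + of_nat n"
  using Gal_pow_translation[OF L tower(5) c(1) x_mem(5), of 0 n]
    Gal_pow_translation[OF L tower(5) c(1) x_mem(6), of 0 n]
    Gal_pow_translation[OF L tower(5) c(1) x_mem(3), of 1 n] c by simp_all

lemma a_pow: "(a [^]\<^bsub>Gal L K\<^esub> n) x1 = x1 + of_nat n" "(a [^]\<^bsub>Gal L K\<^esub> n) x2 = x2"
  and b_pow: "(b [^]\<^bsub>Gal L K\<^esub> n) x1 = x1" "(b [^]\<^bsub>Gal L K\<^esub> n) x2 = x2 + of_nat n"
  using Gal_pow_translation[OF L tower(5) a(1) x_mem(5), of 1 n]
    Gal_pow_translation[OF L tower(5) a(1) x_mem(6), of 0 n]
    Gal_pow_translation[OF L tower(5) b(1) x_mem(5), of 0 n]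
    Gal_pow_translation[OF L tower(5) b(1) x_mem(6), of 1 n] a b by simp_all

lemma of_nat_p: "of_nat p = (0::'a)"
  using of_nat_CHAR[where 'a = 'a] char by simp

lemma central_pair_Gal: "central_pair (Gal L K) p e f a b c"
  unfolding central_pair_def
proof (intro conjI a(1) b(1) c(1))
  note mult = Gal_mult[OF Gal.m_closed[OF b(1) a(1)] c(1)] Gal_mult[OF a(1) b(1)] Gal_mult[OF b(1) a(1)]
    Gal_mult[OF c(1) a(1)] Gal_mult[OF a(1) c(1)] Gal_mult[OF c(1) b(1)] Gal_mult[OF b(1) c(1)]
  note act = a(2-) b(2-) c(2-) d_action field_aut_add[OF L] field_aut_one[OF L] auts subfield_closed[OF L]
    x_mem L_mem mult
  show "a \<otimes>\<^bsub>Gal L K\<^esub> b = b \<otimes>\<^bsub>Gal L K\<^esub> a \<otimes>\<^bsub>Gal L K\<^esub> c"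
    by (rule eq_at_generators) (use a(1) b(1) c(1) in \<open>simp_all add: act\<close>)
  show "c \<otimes>\<^bsub>Gal L K\<^esub> a = a \<otimes>\<^bsub>Gal L K\<^esub> c"
    by (rule eq_at_generators) (use a(1) b(1) c(1) in \<open>simp_all add: act\<close>)
  show "c \<otimes>\<^bsub>Gal L K\<^esub> b = b \<otimes>\<^bsub>Gal L K\<^esub> c"
    by (rule eq_at_generators) (use a(1) b(1) c(1) in \<open>simp_all add: act\<close>)
  show "c [^]\<^bsub>Gal L K\<^esub> p = \<one>\<^bsub>Gal L K\<^esub>"
    by (rule eq_at_generators) (use c(1) x_mem in \<open>simp_all add: c_pow Gal_one of_nat_p\<close>)
  have "(a [^]\<^bsub>Gal L K\<^esub> p) x3 = x3 + of_nat e"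
    using x_mem a by (intro Gal_pow_carry[OF p char L tower(5) a(1) x_mem(5), of "- x2"])
      (simp_all add: d1_def subfield_closed[OF L] field_aut_uminus[OF L auts(1)])
  then show "a [^]\<^bsub>Gal L K\<^esub> p = c [^]\<^bsub>Gal L K\<^esub> e"
    by (intro eq_at_generators) (use a(1) c(1) in \<open>simp_all add: a_pow c_pow of_nat_p\<close>)
  have "(b [^]\<^bsub>Gal L K\<^esub> p) x3 = x3 + of_nat f"
    using x_mem b by (intro Gal_pow_carry[OF p char L tower(5) b(1) x_mem(6), of 0])
      (simp_all add: d2_def subfield_closed[OF L] field_aut_zero[OF L auts(2)])
  then show "b [^]\<^bsub>Gal L K\<^esub> p = c [^]\<^bsub>Gal L K\<^esub> f"
    by (intro eq_at_generators) (use b(1) c(1) in \<open>simp_all add: b_pow c_pow of_nat_p\<close>)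
qed

text \<open>
  An automorphism \<open>t\<close> moves \<open>x1\<close> and \<open>x2\<close> by elements \<open>i\<close> and \<open>j\<close> of the prime field. Then \<open>(a\<^sup>i b\<^sup>j)\<^sup>-\<^sup>1 t\<close>
  fixes both, hence also the right-hand side of the equation for \<open>x3\<close>, and can only add an element of the
  prime field to \<open>x3\<close>.
\<close>

lemma Gal_normal_form:
  assumes t: "t \<in> carrier (Gal L K)"
  shows "\<exists>i j k. t = a [^]\<^bsub>Gal L K\<^esub> (i::nat) \<otimes>\<^bsub>Gal L K\<^esub> b [^]\<^bsub>Gal L K\<^esub> (j::nat) \<otimes>\<^bsub>Gal L K\<^esub> c [^]\<^bsub>Gal L K\<^esub> (k::nat)"
proof -
  have wp_aut: "wp p (s x) = s (wp p x)" if "s \<in> carrier (Gal L K)" "x \<in> L" for s x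
    using that by (simp add: Gal_mem_iff[OF L] field_aut_wp[OF L])
  have fix_K: "s k = k" if "s \<in> carrier (Gal L K)" "k \<in> K" for s k
    using that by (simp add: Gal_mem_iff[OF L])
  have "wp p (t x1 - x1) = 0" "wp p (t x2 - x2) = 0"
    using wp_aut[OF t] fix_K[OF t] x_mem \<kappa> wp_x by (simp_all add: wp_diff[OF p char])
  then obtain i j where "t x1 - x1 = of_nat i" "t x2 - x2 = of_nat j"
    using wp_eq_0_imp_of_nat[OF p char] by blast
  then have ij: "t x1 = x1 + of_nat i" "t x2 = x2 + of_nat j" by (simp_all add: algebra_simps)
  define g where "g = a [^]\<^bsub>Gal L K\<^esub> i \<otimes>\<^bsub>Gal L K\<^esub> b [^]\<^bsub>Gal L K\<^esub> j"
  have g: "g \<in> carrier (Gal L K)" by (simp add: g_def a b)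
  have ai: "field_aut L (a [^]\<^bsub>Gal L K\<^esub> i)"
    using Gal.nat_pow_closed[OF a(1)] Gal_mem_iff[OF L] by blast
  have gx: "g x1 = t x1" "g x2 = t x2"
    using x_mem
    by (simp_all add: g_def Gal_mult a(1) b(1) ij a_pow b_pow field_aut_add[OF L ai] field_aut_of_nat[OF L ai]
        subfield_closed[OF L])
  define r where "r = inv\<^bsub>Gal L K\<^esub> g \<otimes>\<^bsub>Gal L K\<^esub> t"
  have r: "r \<in> carrier (Gal L K)" by (simp add: r_def g t)
  have inv_g: "(inv\<^bsub>Gal L K\<^esub> g) (g x) = x" if "x \<in> L" for x
    using Gal_mult[OF Gal.inv_closed[OF g] g that] that by (simp add: g Gal_one)
  have rx: "r x1 = x1" "r x2 = x2"
    using x_mem inv_g gx by (simp_all add: r_def Gal_mult g t flip: gx)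
  have r_aut: "field_aut L r" using r by (simp add: Gal_mem_iff[OF L])
  have "r rhs = rhs"
    using rhs_shift(3)[OF L r_aut tower(5) fix_K[OF r] x_mem(5,6) rx] by simp
  then have "wp p (r x3 - x3) = 0" using wp_aut[OF r] x_mem wp_x3 by (simp add: wp_diff[OF p char])
  then obtain k where "r x3 - x3 = of_nat k" using wp_eq_0_imp_of_nat[OF p char] by blast
  then have "r x3 = x3 + of_nat k" by (simp add: algebra_simps)
  then have "r = c [^]\<^bsub>Gal L K\<^esub> k"
    using r c(1) rx by (intro eq_at_generators) (simp_all add: c_pow)
  then have "t = g \<otimes>\<^bsub>Gal L K\<^esub> c [^]\<^bsub>Gal L K\<^esub> k"
    using Gal.inv_solve_left[of "c [^]\<^bsub>Gal L K\<^esub> k" g t] g t c(1) by (simp add: r_def)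
  then show ?thesis unfolding g_def by blast
qed

end

end

section \<open>Galois descent\<close>

definition twisted_sum :: "('a::field \<times> 'a) list \<Rightarrow> ('a \<Rightarrow> 'a) \<Rightarrow> 'a"
  where "twisted_sum ps s = (\<Sum>(a, b)\<leftarrow>ps. a * s b)"

lemma twisted_sum_simps:
  "twisted_sum [] s = 0"
  "twisted_sum ((a, b) # ps) s = a * s b + twisted_sum ps s"
  "twisted_sum (ps @ qs) s = twisted_sum ps s + twisted_sum qs s"
  by (simp_all add: twisted_sum_def)

definition trace :: "'a::field set \<Rightarrow> 'a set \<Rightarrow> 'a \<Rightarrow> 'a"
  where "trace L K y = (\<Sum>s\<in>carrier (Gal L K). s y)"

locale finite_galois =
  fixes K L :: "'a::field set"
  assumes K: "is_subfield K" and L: "is_subfield L" and KL: "K \<subseteq> L"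
    and finite: "finite (carrier (Gal L K))"
    and fixed_field: "\<And>x. x \<in> L \<Longrightarrow> (\<And>s. s \<in> carrier (Gal L K) \<Longrightarrow> s x = x) \<Longrightarrow> x \<in> K"
begin

sublocale Gal: group "Gal L K"
  by (rule group_Gal[OF L KL])

lemma aut: "s \<in> carrier (Gal L K) \<Longrightarrow> field_aut L s"
  and fixes_K: "s \<in> carrier (Gal L K) \<Longrightarrow> k \<in> K \<Longrightarrow> s k = k"
  by (simp_all add: Gal_mem_iff[OF L])

text \<open>
  The functions \<open>s \<mapsto> \<Sum> a\<^sub>i s(b\<^sub>i)\<close> are closed under products. For a single \<open>s \<noteq> 1\<close> and \<open>m\<close> moved by \<open>s\<close>, the
  function \<open>t \<mapsto> (t(m) - s(m)) / (m - s(m))\<close> is of this form; it is 1 at the identity and 0 at \<open>s\<close>. The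
  product over all \<open>s \<noteq> 1\<close> is the wanted function.
\<close>

lemma dual_bases:
  assumes M: "is_subfield M" "M \<subseteq> L"
    and moves: "\<And>s. s \<in> carrier (Gal L K) \<Longrightarrow> s \<noteq> \<one>\<^bsub>Gal L K\<^esub> \<Longrightarrow> \<exists>m\<in>M. s m \<in> M \<and> s m \<noteq> m"
  obtains ps where "set ps \<subseteq> M \<times> M"
    "\<And>s. s \<in> carrier (Gal L K) \<Longrightarrow> twisted_sum ps s = (if s = \<one>\<^bsub>Gal L K\<^esub> then 1 else 0)"
proof -
  have "\<exists>ps. set ps \<subseteq> M \<times> M \<and> twisted_sum ps \<one>\<^bsub>Gal L K\<^esub> = 1 \<and> (\<forall>t\<in>T. twisted_sum ps t = 0)"
    if "finite T" "T \<subseteq> carrier (Gal L K) - {\<one>\<^bsub>Gal L K\<^esub>}" for T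
    using that
  proof induction
    case empty
    have "set [(1, 1)] \<subseteq> M \<times> M" "twisted_sum [(1, 1)] \<one>\<^bsub>Gal L K\<^esub> = 1"
      by (simp_all add: subfield_closed[OF M(1)] subfield_closed[OF L] twisted_sum_def Gal_one)
    then show ?case by blast
  next
    case (insert s T)
    then obtain ps where ps: "set ps \<subseteq> M \<times> M" "twisted_sum ps \<one>\<^bsub>Gal L K\<^esub> = 1" "\<forall>t\<in>T. twisted_sum ps t = 0"
      by auto
    obtain m where m: "m \<in> M" "s m \<in> M" "s m \<noteq> m" using moves insert.prems by blast
    define d where "d = m - s m"
    have d: "d \<noteq> 0" "d \<in> M" using m by (auto simp: d_def subfield_closed[OF M(1)])
    define qs where "qs = map (\<lambda>(a, b). (a / d, b * m)) ps @ map (\<lambda>(a, b). (- (a * s m / d), b)) ps"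
    have "set qs \<subseteq> M \<times> M"
      using ps(1) m d by (auto simp: qs_def subfield_closed[OF M(1)] subset_iff)
    moreover have qs: "twisted_sum qs t = (t m - s m) / d * twisted_sum ps t"
      if t: "t \<in> carrier (Gal L K)" for t
    proof -
      have "twisted_sum (map (\<lambda>(a, b). (a / d, b * m)) ps) t = t m / d * twisted_sum ps t"
        using ps(1)
        by (induction ps) (use m M(2) d(1) in \<open>auto simp: twisted_sum_simps field_aut_mult[OF L aut[OF t]] field_simps subsetD\<close>)
      moreover have "twisted_sum (map (\<lambda>(a, b). (- (a * s m / d), b)) ps) t = - (s m / d * twisted_sum ps t)"
        by (induction ps) (use d(1) in \<open>auto simp: twisted_sum_simps field_simps\<close>)
      ultimately show ?thesis
        using d by (simp add: qs_def twisted_sum_simps field_simps)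
    qed
    moreover have "twisted_sum qs \<one>\<^bsub>Gal L K\<^esub> = 1"
      using qs[OF Gal.one_closed] ps(2) m M(2) d by (simp add: Gal_one d_def subsetD)
    moreover have "twisted_sum qs t = 0" if "t \<in> insert s T" for t
      using qs[of t] that ps(3) insert.prems by auto
    ultimately show ?case by blast
  qed
  from this[of "carrier (Gal L K) - {\<one>\<^bsub>Gal L K\<^esub>}"] obtain ps where
    "set ps \<subseteq> M \<times> M" "twisted_sum ps \<one>\<^bsub>Gal L K\<^esub> = 1"
    "\<forall>t\<in>carrier (Gal L K) - {\<one>\<^bsub>Gal L K\<^esub>}. twisted_sum ps t = 0"
    using finite by auto
  then show thesis by (intro that[of ps]) auto
qed

lemma trace_in_K:
  assumes y: "y \<in> L"
  shows "trace L K y \<in> K"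
proof (rule fixed_field)
  show tr: "trace L K y \<in> L"
    unfolding trace_def by (rule subfield_sum[OF L]) (use y Gal_closed[OF L] in blast)
  fix s assume s: "s \<in> carrier (Gal L K)"
  have "s (trace L K y) = (\<Sum>t\<in>carrier (Gal L K). s (t y))"
    unfolding trace_def by (rule field_aut_sum[OF L aut[OF s]]) (use y Gal_closed[OF L] in blast)
  also have "\<dots> = (\<Sum>t\<in>carrier (Gal L K). (s \<otimes>\<^bsub>Gal L K\<^esub> t) y)"
    using s y by (simp add: Gal_mult)
  also have "\<dots> = trace L K y"
    unfolding trace_def
    by (rule sum.reindex_bij_witness[of _ "\<lambda>t. inv\<^bsub>Gal L K\<^esub> s \<otimes>\<^bsub>Gal L K\<^esub> t" "\<lambda>t. s \<otimes>\<^bsub>Gal L K\<^esub> t"])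
      (use s in \<open>simp_all add: Gal.m_assoc[symmetric]\<close>)
  finally show "s (trace L K y) = trace L K y" .
qed

text \<open>
  Exchanging the two sums leaves \<open>s(y)\<close> with the coefficient 1 for \<open>s = 1\<close> and 0 for all other \<open>s\<close>.
\<close>

lemma expand_by_dual_bases:
  assumes ps: "set ps \<subseteq> L \<times> L"
    "\<And>s. s \<in> carrier (Gal L K) \<Longrightarrow> twisted_sum ps s = (if s = \<one>\<^bsub>Gal L K\<^esub> then 1 else 0)"
    and y: "y \<in> L"
  shows "y = (\<Sum>(a, b)\<leftarrow>ps. a * trace L K (b * y))"
proof -
  have "(\<Sum>(a, b)\<leftarrow>ps. a * trace L K (b * y)) = (\<Sum>s\<in>carrier (Gal L K). twisted_sum ps s * s y)"
    using ps(1)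
  proof (induction ps)
    case (Cons q ps)
    obtain a b where q: "q = (a, b)" by (cases q)
    have "a * trace L K (b * y) = (\<Sum>s\<in>carrier (Gal L K). a * s b * s y)"
      using Cons.prems y
      by (simp add: q trace_def sum_distrib_left field_aut_mult[OF L aut] mult.assoc)
    then show ?case using Cons by (simp add: q twisted_sum_simps sum.distrib distrib_right)
  qed (simp add: twisted_sum_simps)
  also have "\<dots> = (\<Sum>s\<in>carrier (Gal L K). if s = \<one>\<^bsub>Gal L K\<^esub> then s y else 0)"
    by (rule sum.cong) (simp_all add: ps(2))
  also have "\<dots> = y" using finite y by (simp add: Gal_one)
  finally show ?thesis by simp
qed

text \<open>
  With the dual bases chosen in \<open>M\<close>, the expansion of an element of \<open>L\<close> has coefficients in \<open>M\<close> and traces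
  in \<open>K\<close>, so the element is in \<open>M\<close>.
\<close>

lemma galois_descent:
  assumes M: "is_subfield M" "K \<subseteq> M" "M \<subseteq> L"
    and moves: "\<And>s. s \<in> carrier (Gal L K) \<Longrightarrow> s \<noteq> \<one>\<^bsub>Gal L K\<^esub> \<Longrightarrow> \<exists>m\<in>M. s m \<in> M \<and> s m \<noteq> m"
  shows "M = L"
proof
  obtain ps where ps: "set ps \<subseteq> M \<times> M"
    "\<And>s. s \<in> carrier (Gal L K) \<Longrightarrow> twisted_sum ps s = (if s = \<one>\<^bsub>Gal L K\<^esub> then 1 else 0)"
    using dual_bases[OF M(1,3) moves] by blast
  show "L \<subseteq> M"
  proof
    fix y assume y: "y \<in> L"
    have "y = (\<Sum>(a, b)\<leftarrow>ps. a * trace L K (b * y))"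
      by (rule expand_by_dual_bases[OF _ ps(2) y]) (use ps(1) M(3) in auto)
    also have "\<dots> \<in> M"
      using ps(1)
    proof (induction ps)
      case (Cons q ps)
      then have "fst q \<in> M" "snd q * y \<in> L" using M(3) y by (auto simp: subfield_closed[OF L])
      then show ?case
        using Cons trace_in_K M(2) by (auto simp: split_beta subfield_closed[OF M(1)] subset_iff)
    qed (simp add: subfield_closed[OF M(1)])
    finally show "y \<in> M" .
  qed
qed (rule M)

lemma trace_one_element: "\<exists>\<theta>\<in>L. trace L K \<theta> = 1"
proof -
  have "\<exists>m\<in>L. s m \<in> L \<and> s m \<noteq> m" if s: "s \<in> carrier (Gal L K)" "s \<noteq> \<one>\<^bsub>Gal L K\<^esub>" for s
  proof (rule ccontr)
    assume "\<not> ?thesis"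
    then have "s m = \<one>\<^bsub>Gal L K\<^esub> m" if "m \<in> L" for m
      using that Gal_closed[OF L s(1)] by (auto simp: Gal_one)
    moreover have "L = adjoin K L" using adjoin_least[OF L KL order.refl] adjoin_superset(2)[of L K] by blast
    ultimately show False using Gal_eqI[OF L _ s(1) Gal.one_closed] s(2) by blast
  qed
  then obtain ps where ps: "set ps \<subseteq> L \<times> L"
    "\<And>s. s \<in> carrier (Gal L K) \<Longrightarrow> twisted_sum ps s = (if s = \<one>\<^bsub>Gal L K\<^esub> then 1 else 0)"
    using dual_bases[OF L order.refl] by blast
  have "1 = (\<Sum>(a, b)\<leftarrow>ps. a * trace L K (b * 1))"
    using ps by (intro expand_by_dual_bases) (auto simp: subfield_closed[OF L])
  have "\<exists>b\<in>L. trace L K b \<noteq> 0"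
  proof (rule ccontr)
    assume "\<not> ?thesis"
    then have "(\<Sum>(a, b)\<leftarrow>ps. a * trace L K (b * 1)) = 0"
      using ps(1) by (induction ps) auto
    then show False using \<open>1 = _\<close> by simp
  qed
  then obtain b where b: "b \<in> L" "trace L K b \<noteq> 0" by blast
  have k: "inverse (trace L K b) \<in> K" using trace_in_K[OF b(1)] by (simp add: subfield_closed[OF K])
  have "trace L K (inverse (trace L K b) * b) = inverse (trace L K b) * trace L K b"
    unfolding trace_def[of L K "inverse (trace L K b) * b"]
    using k KL b(1)
    by (subst (3) trace_def) (auto simp: sum_distrib_left field_aut_mult[OF L aut] fixes_K subset_iff intro!: sum.cong)
  then show ?thesis using b k KL by (intro bexI[of _ "inverse (trace L K b) * b"]) (auto simp: subfield_closed[OF L])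
qed

text \<open>
  The classical average \<open>- (\<Sum>t. z(t) t(\<theta>))\<close>, for an element \<open>\<theta>\<close> of trace 1.
\<close>

lemma additive_hilbert_90:
  assumes z: "\<And>s. s \<in> carrier (Gal L K) \<Longrightarrow> z s \<in> L"
    and cocycle: "\<And>s t. s \<in> carrier (Gal L K) \<Longrightarrow> t \<in> carrier (Gal L K) \<Longrightarrow>
      z (s \<otimes>\<^bsub>Gal L K\<^esub> t) = z s + s (z t)"
  shows "\<exists>x\<in>L. \<forall>s\<in>carrier (Gal L K). s x = x + z s"
proof -
  obtain \<theta> where \<theta>: "\<theta> \<in> L" "trace L K \<theta> = 1" using trace_one_element by blast
  define x where "x = - (\<Sum>t\<in>carrier (Gal L K). z t * t \<theta>)"
  have mem: "z t * t \<theta> \<in> L" "t \<theta> \<in> L" if "t \<in> carrier (Gal L K)" for t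
    using that z Gal_closed[OF L that \<theta>(1)] by (auto simp: subfield_closed[OF L])
  have x: "x \<in> L" unfolding x_def using mem by (intro subfield_closed(3)[OF L] subfield_sum[OF L])
  have "s x = x + z s" if s: "s \<in> carrier (Gal L K)" for s
  proof -
    have "s x = - (\<Sum>t\<in>carrier (Gal L K). s (z t * t \<theta>))"
      unfolding x_def using mem
      by (simp add: field_aut_uminus[OF L aut[OF s]] field_aut_sum[OF L aut[OF s]] subfield_sum[OF L])
    also have "(\<Sum>t\<in>carrier (Gal L K). s (z t * t \<theta>)) =
        (\<Sum>t\<in>carrier (Gal L K). (z (s \<otimes>\<^bsub>Gal L K\<^esub> t) - z s) * (s \<otimes>\<^bsub>Gal L K\<^esub> t) \<theta>)"
      using s mem z \<theta>(1)
      by (intro sum.cong) (simp_all add: field_aut_mult[OF L aut[OF s]] cocycle Gal_mult)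
    also have "\<dots> = (\<Sum>t\<in>carrier (Gal L K). (z t - z s) * t \<theta>)"
      by (rule sum.reindex_bij_witness[of _ "\<lambda>t. inv\<^bsub>Gal L K\<^esub> s \<otimes>\<^bsub>Gal L K\<^esub> t" "\<lambda>t. s \<otimes>\<^bsub>Gal L K\<^esub> t"])
        (use s in \<open>simp_all add: Gal.m_assoc[symmetric]\<close>)
    also have "\<dots> = - x - z s * trace L K \<theta>"
      by (simp add: x_def trace_def sum_distrib_left left_diff_distrib sum_subtractf)
    finally show ?thesis using \<theta>(2) by simp
  qed
  then show ?thesis using x by blast
qed

section \<open>Cocycles from generators and relations\<close>

text \<open>
  Homomorphisms to this group that lift a given homomorphism to \<open>Gal L K\<close> are the cocycles with
  values in \<open>L\<close>: the second component of the product is the cocycle rule.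
\<close>

definition semidirect :: "(('a \<Rightarrow> 'a) \<times> 'a) monoid"
  where "semidirect = \<lparr>carrier = carrier (Gal L K) \<times> L,
    monoid.mult = \<lambda>(s, u) (t, v). (s \<otimes>\<^bsub>Gal L K\<^esub> t, u + s v),
    one = (\<one>\<^bsub>Gal L K\<^esub>, 0)\<rparr>"

lemma semidirect_simps:
  "carrier semidirect = carrier (Gal L K) \<times> L"
  "(s, u) \<otimes>\<^bsub>semidirect\<^esub> (t, v) = (s \<otimes>\<^bsub>Gal L K\<^esub> t, u + s v)"
  "\<one>\<^bsub>semidirect\<^esub> = (\<one>\<^bsub>Gal L K\<^esub>, 0)"
  by (simp_all add: semidirect_def)

lemma group_semidirect: "group semidirect"
proof (rule groupI)
  fix x assume "x \<in> carrier semidirect"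
  then obtain s u where x: "x = (s, u)" "s \<in> carrier (Gal L K)" "u \<in> L" by (auto simp: semidirect_simps)
  let ?s = "inv\<^bsub>Gal L K\<^esub> s"
  have "(?s, - ?s u) \<otimes>\<^bsub>semidirect\<^esub> x = \<one>\<^bsub>semidirect\<^esub>"
    using x by (simp add: semidirect_simps)
  moreover have "(?s, - ?s u) \<in> carrier semidirect"
    using x Gal_closed[OF L Gal.inv_closed[OF x(2)] x(3)] by (simp add: semidirect_simps subfield_closed[OF L])
  ultimately show "\<exists>y\<in>carrier semidirect. y \<otimes>\<^bsub>semidirect\<^esub> x = \<one>\<^bsub>semidirect\<^esub>" by blast
next
  fix x y z assume "x \<in> carrier semidirect" "y \<in> carrier semidirect" "z \<in> carrier semidirect"
  then show "x \<otimes>\<^bsub>semidirect\<^esub> y \<otimes>\<^bsub>semidirect\<^esub> z = x \<otimes>\<^bsub>semidirect\<^esub> (y \<otimes>\<^bsub>semidirect\<^esub> z)"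
    by (auto simp: semidirect_simps Gal.m_assoc Gal_mult field_aut_add[OF L aut] Gal_closed[OF L])
qed (auto simp: semidirect_simps subfield_closed[OF L] Gal_closed[OF L] Gal_one)

lemma semidirect_pow:
  assumes "s \<in> carrier (Gal L K)" "u \<in> L"
  shows "(s, u) [^]\<^bsub>semidirect\<^esub> (n::nat) = (s [^]\<^bsub>Gal L K\<^esub> n, \<Sum>i<n. (s [^]\<^bsub>Gal L K\<^esub> i) u)"
proof -
  interpret S: group semidirect by (rule group_semidirect)
  show ?thesis
    by (induction n) (use assms in \<open>simp_all add: semidirect_simps\<close>)
qed

text \<open>
  The second component of the \<open>n\<close>-th power of \<open>(s, u)\<close> is \<open>\<Sum>i<n. s\<^sup>i(u)\<close>; so each relation on the group
  becomes an additive condition on \<open>u\<close> and \<open>v\<close>. The value \<open>r\<close> at \<open>c\<close> is in the prime field and hence fixed.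
\<close>

lemma semidirect_central_pair:
  assumes cp: "central_pair (Gal L K) p e f a b c"
    and uv: "u \<in> L" "v \<in> L" and "of_nat p = (0::'a)"
    and ab: "u + a v = v + b u + of_nat r" and c: "c u = u" "c v = v"
    and pow: "(\<Sum>i<p. (a [^]\<^bsub>Gal L K\<^esub> i) u) = of_nat (e * r)" "(\<Sum>i<p. (b [^]\<^bsub>Gal L K\<^esub> i) v) = of_nat (f * r)"
  shows "central_pair semidirect p e f (a, u) (b, v) (c, of_nat r)"
proof -
  have abc: "a \<in> carrier (Gal L K)" "b \<in> carrier (Gal L K)" "c \<in> carrier (Gal L K)"
    and rels: "a \<otimes>\<^bsub>Gal L K\<^esub> b = b \<otimes>\<^bsub>Gal L K\<^esub> a \<otimes>\<^bsub>Gal L K\<^esub> c" "c \<otimes>\<^bsub>Gal L K\<^esub> a = a \<otimes>\<^bsub>Gal L K\<^esub> c"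
      "c \<otimes>\<^bsub>Gal L K\<^esub> b = b \<otimes>\<^bsub>Gal L K\<^esub> c" "c [^]\<^bsub>Gal L K\<^esub> p = \<one>\<^bsub>Gal L K\<^esub>"
      "a [^]\<^bsub>Gal L K\<^esub> p = c [^]\<^bsub>Gal L K\<^esub> e" "b [^]\<^bsub>Gal L K\<^esub> p = c [^]\<^bsub>Gal L K\<^esub> f"
    using cp by (simp_all add: central_pair_def)
  have of_nat: "s (of_nat m) = of_nat m" if "s \<in> carrier (Gal L K)" for s m
    by (rule field_aut_of_nat[OF L aut[OF that]])
  have ba: "(b \<otimes>\<^bsub>Gal L K\<^esub> a) (of_nat r) = of_nat r" by (rule of_nat) (simp add: abc)
  have cn: "(\<Sum>i<n. (c [^]\<^bsub>Gal L K\<^esub> (i::nat)) (of_nat r)) = of_nat (n * r)" for n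
    using of_nat[OF Gal.nat_pow_closed[OF abc(3)]] by simp
  show ?thesis
    unfolding central_pair_def
    using abc uv rels ab c pow assms(4)
    by (simp add: semidirect_simps semidirect_pow subfield_closed[OF L] of_nat ba cn add.commute)
qed

end

lemma group_hom_word_val:
  assumes "\<phi> \<in> hom G H" "group G" "group H" "\<And>g. h g \<in> carrier G"
  shows "\<phi> (word_val G h u) = word_val H (\<lambda>g. \<phi> (h g)) u"
proof -
  interpret group_hom G H \<phi> using assms by (simp add: group_hom_def group_hom_axioms_def)
  have "\<phi> (letter_val G h l) = letter_val H (\<lambda>g. \<phi> (h g)) l" for l
    by (cases l) (simp add: assms(4))
  then show ?thesis
    by (induction u) (simp_all add: word_val_simps G.letter_val_closed[where h = h, OF assms(4)]
        G.word_val_closed[where h = h, OF assms(4)])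
qed

lemma group_p3_hom_unique:
  assumes "\<phi> \<in> hom (group_p3 G p) H" "\<psi> \<in> hom (group_p3 G p) H" "group H"
    and "\<phi> (group_p3_gen G p Gen1) = \<psi> (group_p3_gen G p Gen1)"
    and "\<phi> (group_p3_gen G p Gen2) = \<psi> (group_p3_gen G p Gen2)"
    and x: "x \<in> carrier (group_p3 G p)"
  shows "\<phi> x = \<psi> x"
proof -
  obtain u where "x = word_class (relations G p) u"
    using x by (auto simp: group_p3_def carrier_presented_group)
  then have x: "x = word_val (group_p3 G p) (group_p3_gen G p) u"
    using word_val_presented_group[of "relations G p"]
    by (simp add: group_p3_def group_p3_gen_def[abs_def])
  have gen: "group_p3_gen G p g \<in> carrier (group_p3 G p)" for g
    by (simp add: group_p3_def group_p3_gen_def carrier_presented_group)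
  have "(\<lambda>g. \<phi> (group_p3_gen G p g)) = (\<lambda>g. \<psi> (group_p3_gen G p g))"
    using assms(4,5) by (intro ext) (metis gen.exhaust)
  then show ?thesis
    unfolding x
    using group_hom_word_val[OF assms(1) group_group_p3 assms(3), of "group_p3_gen G p" u]
      group_hom_word_val[OF assms(2) group_group_p3 assms(3), of "group_p3_gen G p" u] gen by simp
qed

context finite_galois
begin

text \<open>
  The homomorphism to the semidirect product given by \<open>(a, u)\<close> and \<open>(b, v)\<close> lifts \<open>\<psi>\<close>, so it is a cocycle on
  \<open>Gal L K\<close>, and Hilbert 90 provides \<open>x\<close>. The displacement of \<open>x\<close> by \<open>c\<close> is then
  determined by the relation \<open>a b = b a c\<close>.
\<close>

lemma solve_cocycle:
  assumes p: "prime p" "kind_allowed G p" and iso: "\<psi> \<in> iso (group_p3 G p) (Gal L K)"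
  defines "a \<equiv> \<psi> (group_p3_gen G p Gen1)" and "b \<equiv> \<psi> (group_p3_gen G p Gen2)"
  assumes cp: "central_pair semidirect p (exponent_a G) (exponent_b G) (a, u) (b, v) (c, w)"
  shows "\<exists>x\<in>L. a x = x + u \<and> b x = x + v \<and> c x = x + w"
proof -
  let ?P = "group_p3 G p"
  obtain \<Phi> where \<Phi>: "\<Phi> \<in> hom ?P semidirect"
    "\<Phi> (group_p3_gen G p Gen1) = (a, u)" "\<Phi> (group_p3_gen G p Gen2) = (b, v)"
    using group_p3_hom[OF group_semidirect p cp] .
  have \<psi>: "\<psi> \<in> hom ?P (Gal L K)" "bij_betw \<psi> (carrier ?P) (carrier (Gal L K))"
    using iso by (auto simp: iso_def)
  have "fst \<in> hom semidirect (Gal L K)" by (rule homI) (auto simp: semidirect_simps)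
  then have "(\<lambda>x. fst (\<Phi> x)) \<in> hom ?P (Gal L K)"
    using hom_compose[OF \<Phi>(1)] by (simp add: comp_def)
  then have fst_\<Phi>: "fst (\<Phi> x) = \<psi> x" if "x \<in> carrier ?P" for x
    using group_p3_hom_unique[OF _ \<psi>(1) Gal.is_group _ _ that, of "\<lambda>x. fst (\<Phi> x)"] \<Phi> by (simp add: a_def b_def)
  define \<psi>' where "\<psi>' = inv_into (carrier ?P) \<psi>"
  have \<psi>': "\<psi>' s \<in> carrier ?P" "\<psi> (\<psi>' s) = s" if "s \<in> carrier (Gal L K)" for s
    using that \<psi>(2) unfolding \<psi>'_def bij_betw_def by (metis inv_into_into, metis f_inv_into_f)
  have \<psi>'_mult: "\<psi>' (s \<otimes>\<^bsub>Gal L K\<^esub> t) = \<psi>' s \<otimes>\<^bsub>?P\<^esub> \<psi>' t"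
    if "s \<in> carrier (Gal L K)" "t \<in> carrier (Gal L K)" for s t
  proof -
    interpret P: group ?P by (rule group_group_p3)
    have "\<psi> (\<psi>' (s \<otimes>\<^bsub>Gal L K\<^esub> t)) = \<psi> (\<psi>' s \<otimes>\<^bsub>?P\<^esub> \<psi>' t)"
      using that \<psi>' hom_mult[OF \<psi>(1)] by simp
    then show ?thesis
      by (rule inj_onD[OF bij_betw_imp_inj_on[OF \<psi>(2)]]) (simp_all add: \<psi>' that)
  qed
  define z where "z s = snd (\<Phi> (\<psi>' s))" for s
  have \<Phi>_eq: "\<Phi> (\<psi>' s) = (s, z s)" if "s \<in> carrier (Gal L K)" for s
    using fst_\<Phi>[OF \<psi>'(1)[OF that]] \<psi>'(2)[OF that] by (simp add: z_def prod_eq_iff)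
  have zL: "z s \<in> L" if "s \<in> carrier (Gal L K)" for s
    using hom_in_carrier[OF \<Phi>(1) \<psi>'(1)[OF that]] \<Phi>_eq[OF that] by (simp add: semidirect_simps)
  have "z (s \<otimes>\<^bsub>Gal L K\<^esub> t) = z s + s (z t)" if "s \<in> carrier (Gal L K)" "t \<in> carrier (Gal L K)" for s t
  proof -
    have "\<Phi> (\<psi>' (s \<otimes>\<^bsub>Gal L K\<^esub> t)) = (s, z s) \<otimes>\<^bsub>semidirect\<^esub> (t, z t)"
      using that hom_mult[OF \<Phi>(1)] by (simp add: \<psi>'_mult \<psi>' \<Phi>_eq)
    then show ?thesis using that by (simp add: z_def semidirect_simps)
  qed
  then obtain x where x: "x \<in> L" "\<And>s. s \<in> carrier (Gal L K) \<Longrightarrow> s x = x + z s"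
    using additive_hilbert_90[of z] zL by blast
  have gens: "group_p3_gen G p g \<in> carrier ?P" for g
    by (simp add: group_p3_def group_p3_gen_def carrier_presented_group)
  have \<psi>'_gen: "\<psi>' (\<psi> y) = y" if "y \<in> carrier ?P" for y
    using \<psi>(2) that unfolding \<psi>'_def bij_betw_def by (simp add: inv_into_f_f)
  have abc: "a \<in> carrier (Gal L K)" "b \<in> carrier (Gal L K)" "c \<in> carrier (Gal L K)" and w: "w \<in> L"
    using cp by (auto simp: central_pair_def semidirect_simps)
  have ax: "a x = x + u" using x(2)[OF abc(1)] \<Phi>(2) by (simp add: z_def a_def \<psi>'_gen gens)
  have bx: "b x = x + v" using x(2)[OF abc(2)] \<Phi>(3) by (simp add: z_def b_def \<psi>'_gen gens)
  have uv: "u \<in> L" "v \<in> L" using cp by (auto simp: central_pair_def semidirect_simps)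
  have ab: "a \<otimes>\<^bsub>Gal L K\<^esub> b = b \<otimes>\<^bsub>Gal L K\<^esub> a \<otimes>\<^bsub>Gal L K\<^esub> c"
    and sum: "u + a v = v + b u + (b \<otimes>\<^bsub>Gal L K\<^esub> a) w"
    using cp by (auto simp: central_pair_def semidirect_simps)
  define q where "q = c x - x"
  have q: "q \<in> L" "c x = x + q" using x(1) Gal_closed[OF L abc(3) x(1)] by (simp_all add: q_def subfield_closed[OF L])
  have ba: "b \<otimes>\<^bsub>Gal L K\<^esub> a \<in> carrier (Gal L K)" by (simp add: abc)
  have "(a \<otimes>\<^bsub>Gal L K\<^esub> b) x = x + (u + a v)"
    using x(1) uv by (simp add: Gal_mult abc bx ax field_aut_add[OF L aut[OF abc(1)]])
  moreover have "(b \<otimes>\<^bsub>Gal L K\<^esub> a \<otimes>\<^bsub>Gal L K\<^esub> c) x = x + (v + b u) + (b \<otimes>\<^bsub>Gal L K\<^esub> a) q"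
    using x(1) uv q
    by (simp add: Gal_mult[OF ba abc(3)] field_aut_add[OF L aut[OF ba]])
      (simp add: Gal_mult abc ax bx field_aut_add[OF L aut[OF abc(2)]])
  ultimately have "(b \<otimes>\<^bsub>Gal L K\<^esub> a) q = (b \<otimes>\<^bsub>Gal L K\<^esub> a) w" using ab sum by simp
  then have "q = w" using field_aut_inj[OF L aut[OF ba]] q(1) w by (simp add: inj_on_def)
  then show ?thesis using x(1) ax bx q(2) by blast
qed

end

section \<open>The data in terms of the exponents\<close>

text \<open>
  For \<open>p = 2\<close> the carry is the product, so that \<open>D\<^sub>8\<close> and \<open>M(p\<^sup>3)\<close> follow the same formula.
\<close>

lemma kind_cases_eq_carry:
  assumes p: "prime p" and "CHAR('a::field) = p" and kind: "kind_allowed G p"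
  shows "(case G of Q8 \<Rightarrow> x * y | D8 \<Rightarrow> x * y | H_p3 \<Rightarrow> 0 | M_p3 \<Rightarrow> S p x y) = of_nat (exponent_a G) * carry p (x::'a) y"
    and "(case G of Q8 \<Rightarrow> x * y | D8 \<Rightarrow> 0 | H_p3 \<Rightarrow> 0 | M_p3 \<Rightarrow> 0) = of_nat (exponent_b G) * carry p (x::'a) y"
  using assms carry_2[where 'b = 'a, of x y] S_eq_carry[OF p, of x y]
  by (cases G; simp add: kind_allowed_def)+

lemma frak_s_eq:
  assumes "prime p" and "CHAR('a::field) = p" and "kind_allowed G p"
  shows "frak_s G p \<kappa>1 \<kappa>2 x1 (x2::'a) = - \<kappa>2 * x1 + of_nat (exponent_a G) * carry p x1 \<kappa>1
    + of_nat (exponent_b G) * carry p x2 \<kappa>2"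
  using kind_cases_eq_carry[OF assms, of x1 \<kappa>1, symmetric] kind_cases_eq_carry[OF assms, of x2 \<kappa>2, symmetric]
  by (cases G) (simp_all add: frak_s_def mult.commute)

lemma action_iff:
  assumes "prime p" and "CHAR('a::field) = p" and "kind_allowed G p"
  shows "artin_schreier_action G p x1 x2 (x3::'a) s1 s2 s3 \<longleftrightarrow>
    s1 x1 = x1 + 1 \<and> s1 x2 = x2 \<and> s1 x3 = x3 + (- x2 + of_nat (exponent_a G) * carry p x1 1) \<and>
    s2 x1 = x1 \<and> s2 x2 = x2 + 1 \<and> s2 x3 = x3 + of_nat (exponent_b G) * carry p x2 1 \<and>
    s3 x1 = x1 \<and> s3 x2 = x2 \<and> s3 x3 = x3 + 1"
  unfolding artin_schreier_action_def
    kind_cases_eq_carry(1)[OF assms, of x1 1, unfolded mult_1_right] kind_cases_eq_carry(2)[OF assms, of x2 1, unfolded mult_1_right]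
  by (auto simp: diff_eq_eq add.commute)

lemma central_pair_hom:
  assumes "\<phi> \<in> hom G H" "group G" "group H" "central_pair G p e f a b c"
  shows "central_pair H p e f (\<phi> a) (\<phi> b) (\<phi> c)"
proof -
  interpret group_hom G H \<phi> using assms by (simp add: group_hom_def group_hom_axioms_def)
  show ?thesis
    using assms(4) unfolding central_pair_def
    by (metis hom_closed hom_mult hom_nat_pow hom_one G.m_closed)
qed

lemma finite_group_p3:
  assumes "prime p" "kind_allowed G p"
  shows "finite (carrier (group_p3 G p))"
proof -
  let ?P = "group_p3 G p"
  let ?A = "group_p3_gen G p Gen1" and ?B = "group_p3_gen G p Gen2"
  have "carrier ?P \<subseteq> (\<lambda>(i, j, k). ?A [^]\<^bsub>?P\<^esub> i \<otimes>\<^bsub>?P\<^esub> ?B [^]\<^bsub>?P\<^esub> j \<otimes>\<^bsub>?P\<^esub> commutator ?P ?A ?B [^]\<^bsub>?P\<^esub> k)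
      ` ({..<p} \<times> {..<p} \<times> {..<p})"
    using group_p3_normal_form[OF assms] by force
  then show ?thesis by (rule finite_subset) auto
qed

section \<open>From Artin-Schreier data to the Galois group\<close>

text \<open>
  The homomorphism from the presented group exists because its target satisfies the relations. It is onto
  because every automorphism is a product \<open>a\<^sup>i b\<^sup>j c\<^sup>k\<close>, and injective because the exponents of a normal
  form below \<open>p\<close> are determined by the action on \<open>x1\<close>, \<open>x2\<close> and \<open>x3\<close>.
\<close>

lemma artin_schreier_data_imp_galois:
  fixes K L :: "'a::field set"
  assumes p: "prime p" and char: "CHAR('a) = p" and K: "is_subfield K" and kind: "kind_allowed G p"
    and data: "artin_schreier_data G p L K \<kappa>1 \<kappa>2 \<kappa>3 x1 x2 x3"
  shows "galois_extension L K"
    and "\<exists>a\<in>carrier (Gal L K). \<exists>b\<in>carrier (Gal L K). \<exists>c\<in>carrier (Gal L K).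
      artin_schreier_action G p x1 x2 x3 a b c \<and>
      (\<forall>a'\<in>carrier (Gal L K). \<forall>b'\<in>carrier (Gal L K). \<forall>c'\<in>carrier (Gal L K).
         artin_schreier_action G p x1 x2 x3 a' b' c' \<longrightarrow> a' = a \<and> b' = b \<and> c' = c) \<and>
      carrier (Gal L K) = generate (Gal L K) {a, b, c} \<and> c = commutator (Gal L K) a b \<and>
      (\<exists>\<phi>\<in>iso (group_p3 G p) (Gal L K). \<phi> (group_p3_gen G p Gen1) = a \<and> \<phi> (group_p3_gen G p Gen2) = b)"
proof -
  interpret artin_schreier_tower p "exponent_a G" "exponent_b G" K \<kappa>1 \<kappa>2 \<kappa>3 x1 x2 x3
    by (rule artin_schreier_tower.intro)
      (use data in \<open>auto simp: artin_schreier_data_def frak_s_eq[OF p char kind] wp_def p char K\<close>)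
  have L_tower: "L = adjoin (adjoin (adjoin K {x1}) {x2}) {x3}"
    using data L_eq by (simp add: artin_schreier_data_def)
  note L = L[folded L_tower] and KL = tower(5)[folded L_tower] and x_L = x_mem(5,6,3)[folded L_tower]
  obtain a b c where
    a: "a \<in> carrier (Gal L K)" "a x1 = x1 + 1" "a x2 = x2" "a x3 = x3 + d1"
    and b: "b \<in> carrier (Gal L K)" "b x1 = x1" "b x2 = x2 + 1" "b x3 = x3 + d2"
    and c: "c \<in> carrier (Gal L K)" "c x1 = x1" "c x2 = x2" "c x3 = x3 + 1"
    and fixed: "\<And>z. z \<in> L \<Longrightarrow> a z = z \<Longrightarrow> b z = z \<Longrightarrow> c z = z \<Longrightarrow> z \<in> K"
    using exists_generators[folded L_tower] by blast
  note abc = a[unfolded L_tower] b[unfolded L_tower] c[unfolded L_tower]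
  note cp = central_pair_Gal[OF abc, folded L_tower]
    and normal_form = Gal_normal_form[OF abc, folded L_tower]
  interpret Gal: group "Gal L K" by (rule group_Gal[OF L KL])
  have "z \<in> K" if "z \<in> L" "\<forall>s\<in>carrier (Gal L K). s z = z" for z
    using fixed that a(1) b(1) c(1) by blast
  then have "{z \<in> L. \<forall>s\<in>carrier (Gal L K). s z = z} = K"
    using KL by (auto simp: Gal_mem_iff[OF L])
  then show "galois_extension L K"
    unfolding galois_extension_def using K L KL L_algebraic[folded L_tower] by blast
  have action: "artin_schreier_action G p x1 x2 x3 a b c"
    using a b c by (simp add: action_iff[OF p char kind] d1_def d2_def)
  have unique: "a' = a \<and> b' = b \<and> c' = c"
    if "a' \<in> carrier (Gal L K)" "b' \<in> carrier (Gal L K)" "c' \<in> carrier (Gal L K)"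
      "artin_schreier_action G p x1 x2 x3 a' b' c'" for a' b' c'
    using that action a(1) b(1) c(1)
    by (auto simp: action_iff[OF p char kind] intro!: Gal_eqI[OF L HOL.trans[OF L_tower L_eq]])
  let ?H = "generate (Gal L K) {a, b, c}"
  have pow: "x [^]\<^bsub>Gal L K\<^esub> (n::nat) \<in> ?H" if "x \<in> ?H" for x n
    by (induction n) (use that in \<open>simp_all add: generate.one generate.eng\<close>)
  have gen: "carrier (Gal L K) = ?H"
  proof
    show "carrier (Gal L K) \<subseteq> ?H"
    proof
      fix t assume "t \<in> carrier (Gal L K)"
      then obtain i j k :: nat where "t = a [^]\<^bsub>Gal L K\<^esub> i \<otimes>\<^bsub>Gal L K\<^esub> b [^]\<^bsub>Gal L K\<^esub> j \<otimes>\<^bsub>Gal L K\<^esub> c [^]\<^bsub>Gal L K\<^esub> k"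
        using normal_form by blast
      then show "t \<in> ?H" using pow[of a i] pow[of b j] pow[of c k] by (simp add: generate.incl generate.eng)
    qed
    show "?H \<subseteq> carrier (Gal L K)" using a(1) b(1) c(1) by (intro Gal.generate_incl) auto
  qed
  have comm: "c = commutator (Gal L K) a b" by (rule Gal.central_pair_commutator[OF cp])
  let ?P = "group_p3 G p"
  let ?A = "group_p3_gen G p Gen1" and ?B = "group_p3_gen G p Gen2"
  let ?C = "commutator ?P ?A ?B"
  obtain \<phi> where \<phi>: "\<phi> \<in> hom ?P (Gal L K)" "\<phi> ?A = a" "\<phi> ?B = b"
    using group_p3_hom[OF Gal.is_group p kind cp] .
  interpret \<phi>: group_hom ?P "Gal L K" \<phi>
    using \<phi>(1) group_group_p3 Gal.is_group by (simp add: group_hom_def group_hom_axioms_def)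
  have cpP: "central_pair ?P p (exponent_a G) (exponent_b G) ?A ?B ?C" by (rule group_p3_central_pair[OF p kind])
  then have ABC: "?A \<in> carrier ?P" "?B \<in> carrier ?P" "?C \<in> carrier ?P" by (simp_all add: central_pair_def)
  have "central_pair (Gal L K) p (exponent_a G) (exponent_b G) a b (\<phi> ?C)"
    using central_pair_hom[OF \<phi>(1) group_group_p3 Gal.is_group cpP] \<phi> by simp
  then have \<phi>C: "\<phi> ?C = c" using Gal.central_pair_commutator comm by metis
  have \<phi>_form: "\<phi> (?A [^]\<^bsub>?P\<^esub> (i::nat) \<otimes>\<^bsub>?P\<^esub> ?B [^]\<^bsub>?P\<^esub> (j::nat) \<otimes>\<^bsub>?P\<^esub> ?C [^]\<^bsub>?P\<^esub> (k::nat)) =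
      a [^]\<^bsub>Gal L K\<^esub> i \<otimes>\<^bsub>Gal L K\<^esub> b [^]\<^bsub>Gal L K\<^esub> j \<otimes>\<^bsub>Gal L K\<^esub> c [^]\<^bsub>Gal L K\<^esub> k" for i j k
    by (simp add: ABC \<phi>.hom_nat_pow \<phi> \<phi>C)
  have zero: "n = 0" if "x + of_nat n = (x::'a)" "n < p" for n x
    using that by (auto simp: of_nat_eq_0_iff_char_dvd char dest: dvd_imp_le)
  have "\<phi> \<in> iso ?P (Gal L K)"
    unfolding \<phi>.iso_iff
  proof (intro conjI ballI impI subsetI)
    fix t assume "t \<in> carrier (Gal L K)"
    then obtain i j k :: nat where "t = a [^]\<^bsub>Gal L K\<^esub> i \<otimes>\<^bsub>Gal L K\<^esub> b [^]\<^bsub>Gal L K\<^esub> j \<otimes>\<^bsub>Gal L K\<^esub> c [^]\<^bsub>Gal L K\<^esub> k"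
      using normal_form by blast
    then have "t = \<phi> (?A [^]\<^bsub>?P\<^esub> i \<otimes>\<^bsub>?P\<^esub> ?B [^]\<^bsub>?P\<^esub> j \<otimes>\<^bsub>?P\<^esub> ?C [^]\<^bsub>?P\<^esub> k)" by (simp only: \<phi>_form)
    then show "t \<in> \<phi> ` carrier ?P" by (rule image_eqI) (simp add: ABC)
  next
    fix x assume x: "x \<in> carrier ?P" and one: "\<phi> x = \<one>\<^bsub>Gal L K\<^esub>"
    obtain i j k where ijk: "i < p" "j < p" "k < p"
      and form: "x = ?A [^]\<^bsub>?P\<^esub> i \<otimes>\<^bsub>?P\<^esub> ?B [^]\<^bsub>?P\<^esub> j \<otimes>\<^bsub>?P\<^esub> ?C [^]\<^bsub>?P\<^esub> k"
      using group_p3_normal_form[OF p kind x] by blast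
    note act = normal_form_action[OF L KL a(1) b(1) c(1) x_L a(2,3) b(2,3) c(2-4)]
    have id: "(a [^]\<^bsub>Gal L K\<^esub> i \<otimes>\<^bsub>Gal L K\<^esub> b [^]\<^bsub>Gal L K\<^esub> j \<otimes>\<^bsub>Gal L K\<^esub> c [^]\<^bsub>Gal L K\<^esub> k) y = y" if "y \<in> L" for y
      using one that by (simp add: form \<phi>_form Gal_one)
    have "i = 0" using act(1)[of i j k] id[OF x_L(1)] zero ijk by metis
    moreover have "j = 0" using act(2)[of i j k] id[OF x_L(2)] zero ijk by metis
    ultimately have "k = 0" using act(3)[of k] id[OF x_L(3)] zero ijk by metis
    then show "x = \<one>\<^bsub>?P\<^esub>" using \<open>i = 0\<close> \<open>j = 0\<close> by (simp add: form)
  qed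
  then have iso: "\<exists>\<phi>\<in>iso ?P (Gal L K). \<phi> ?A = a \<and> \<phi> ?B = b" using \<phi>(2,3) by blast
  show "\<exists>a\<in>carrier (Gal L K). \<exists>b\<in>carrier (Gal L K). \<exists>c\<in>carrier (Gal L K).
      artin_schreier_action G p x1 x2 x3 a b c \<and>
      (\<forall>a'\<in>carrier (Gal L K). \<forall>b'\<in>carrier (Gal L K). \<forall>c'\<in>carrier (Gal L K).
         artin_schreier_action G p x1 x2 x3 a' b' c' \<longrightarrow> a' = a \<and> b' = b \<and> c' = c) \<and>
      carrier (Gal L K) = generate (Gal L K) {a, b, c} \<and> c = commutator (Gal L K) a b \<and>
      (\<exists>\<phi>\<in>iso (group_p3 G p) (Gal L K). \<phi> (group_p3_gen G p Gen1) = a \<and> \<phi> (group_p3_gen G p Gen2) = b)"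
    by (rule bexI[OF _ a(1)], rule bexI[OF _ b(1)], rule bexI[OF _ c(1)])
      (intro conjI ballI impI action gen comm iso unique[THEN conjunct1]
        unique[THEN conjunct2, THEN conjunct1] unique[THEN conjunct2, THEN conjunct2]; assumption)
qed

section \<open>From the Galois group to Artin-Schreier data\<close>

text \<open>
  The elements \<open>x1\<close>, \<open>x2\<close>, \<open>x3\<close> split the cocycles with values \<open>(1, 0)\<close>, \<open>(0, 1)\<close>, \<open>(d1, d2)\<close>
  at the generators and \<open>0\<close>, \<open>0\<close>, \<open>1\<close> at the commutator. That \<open>\<kappa>1\<close>, \<open>\<kappa>2\<close>, \<open>\<kappa>3\<close> are in \<open>K\<close> is checked on the
  generators. A linear combination of \<open>\<kappa>1\<close> and \<open>\<kappa>2\<close> in \<open>\<wp>(K)\<close> would put the same combination of \<open>x1\<close>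
  and \<open>x2\<close> into \<open>K\<close>, where \<open>a\<close> and \<open>b\<close> cannot move it. Finally, an automorphism in normal form that fixes
  \<open>x1\<close>, \<open>x2\<close> and \<open>x3\<close> is trivial, and Galois descent shows that they generate \<open>L\<close>.
\<close>

lemma galois_imp_artin_schreier_data:
  fixes K L :: "'a::field set"
  assumes p: "prime p" and char: "CHAR('a) = p" and kind: "kind_allowed G p"
    and gal: "galois_extension L K" and iso: "Gal L K \<cong> group_p3 G p"
  shows "\<exists>\<kappa>1 \<kappa>2 \<kappa>3 x1 x2 x3. artin_schreier_data G p L K \<kappa>1 \<kappa>2 \<kappa>3 x1 x2 x3"
proof -
  have K: "is_subfield K" and L: "is_subfield L" and KL: "K \<subseteq> L"
    using gal by (auto simp: galois_extension_def)
  interpret Gal: group "Gal L K" by (rule group_Gal[OF L KL])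
  let ?P = "group_p3 G p"
  let ?A = "group_p3_gen G p Gen1" and ?B = "group_p3_gen G p Gen2"
  let ?C = "commutator ?P ?A ?B"
  obtain \<psi> where \<psi>: "\<psi> \<in> iso ?P (Gal L K)"
    using Gal.iso_sym[OF iso] by (auto simp: is_iso_def)
  then have \<psi>_hom: "\<psi> \<in> hom ?P (Gal L K)" and \<psi>_bij: "bij_betw \<psi> (carrier ?P) (carrier (Gal L K))"
    by (auto simp: iso_def)
  interpret finite_galois K L
  proof (rule finite_galois.intro)
    show "finite (carrier (Gal L K))"
      using bij_betw_finite[OF \<psi>_bij] finite_group_p3[OF p kind] by simp
    show "x \<in> K" if "x \<in> L" "\<And>s. s \<in> carrier (Gal L K) \<Longrightarrow> s x = x" for x
      using gal that by (auto simp: galois_extension_def)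
  qed (fact K L KL)+
  define a b c where "a = \<psi> ?A" and "b = \<psi> ?B" and "c = \<psi> ?C"
  define e f where "e = exponent_a G" and "f = exponent_b G"
  have cpP: "central_pair ?P p e f ?A ?B ?C" unfolding e_def f_def by (rule group_p3_central_pair[OF p kind])
  have cp: "central_pair (Gal L K) p e f a b c"
    unfolding a_def b_def c_def by (rule central_pair_hom[OF \<psi>_hom group_group_p3 Gal.is_group cpP])
  have abc: "a \<in> carrier (Gal L K)" "b \<in> carrier (Gal L K)" "c \<in> carrier (Gal L K)"
    using cp by (simp_all add: central_pair_def)
  have ABC: "?A \<in> carrier ?P" "?B \<in> carrier ?P" "?C \<in> carrier ?P"
    using cpP by (simp_all add: central_pair_def)
  have normal_form: "\<exists>i<p. \<exists>j<p. \<exists>k<p. s = a [^]\<^bsub>Gal L K\<^esub> i \<otimes>\<^bsub>Gal L K\<^esub> b [^]\<^bsub>Gal L K\<^esub> j \<otimes>\<^bsub>Gal L K\<^esub> c [^]\<^bsub>Gal L K\<^esub> k"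
    if s: "s \<in> carrier (Gal L K)" for s
  proof -
    interpret \<psi>: group_hom ?P "Gal L K" \<psi>
      using \<psi>_hom group_group_p3 Gal.is_group by (simp add: group_hom_def group_hom_axioms_def)
    obtain x where x: "x \<in> carrier ?P" "s = \<psi> x" using \<psi>_bij s by (auto simp: bij_betw_def)
    then obtain i j k where "i < p" "j < p" "k < p"
      "x = ?A [^]\<^bsub>?P\<^esub> i \<otimes>\<^bsub>?P\<^esub> ?B [^]\<^bsub>?P\<^esub> j \<otimes>\<^bsub>?P\<^esub> ?C [^]\<^bsub>?P\<^esub> k"
      using group_p3_normal_form[OF p kind x(1)] by blast
    then show ?thesis using x(2) by (auto simp: ABC \<psi>.hom_nat_pow a_def b_def c_def)
  qed
  have in_K: "y \<in> K" if y: "y \<in> L" "a y = y" "b y = y" "c y = y" for y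
  proof (rule fixed_field[OF y(1)])
    fix s assume "s \<in> carrier (Gal L K)"
    then obtain i j k :: nat where s: "s = a [^]\<^bsub>Gal L K\<^esub> i \<otimes>\<^bsub>Gal L K\<^esub> b [^]\<^bsub>Gal L K\<^esub> j \<otimes>\<^bsub>Gal L K\<^esub> c [^]\<^bsub>Gal L K\<^esub> k"
      using normal_form by blast
    have "(t [^]\<^bsub>Gal L K\<^esub> n) y = y" if "t \<in> carrier (Gal L K)" "t y = y" for t and n :: nat
      using Gal_pow_translation[OF L KL that(1) y(1), of 0 n] that(2) by simp
    then show "s y = y" using abc y by (simp add: s Gal_mult)
  qed
  have of_nat_p: "of_nat p = (0::'a)" using of_nat_CHAR[where 'a = 'a] char by simp
  have solve: "\<exists>x\<in>L. a x = x + u \<and> b x = x + v \<and> c x = x + of_nat r"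
    if "u \<in> L" "v \<in> L" "u + a v = v + b u + of_nat r" "c u = u" "c v = v"
      "(\<Sum>i<p. (a [^]\<^bsub>Gal L K\<^esub> i) u) = of_nat (e * r)" "(\<Sum>i<p. (b [^]\<^bsub>Gal L K\<^esub> i) v) = of_nat (f * r)" for u v r
    using solve_cocycle[OF p kind \<psi>, folded a_def b_def]
      semidirect_central_pair[OF cp that(1,2) of_nat_p that(3-7)] unfolding e_def f_def by blast
  have pow_aut: "field_aut L (t [^]\<^bsub>Gal L K\<^esub> i)" if "t \<in> carrier (Gal L K)" for t and i :: nat
    using that by (intro aut) simp
  note zero_one = field_aut_zero[OF L aut[OF abc(1)]] field_aut_zero[OF L aut[OF abc(2)]]
    field_aut_zero[OF L aut[OF abc(3)]] field_aut_one[OF L aut[OF abc(1)]]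
    field_aut_one[OF L aut[OF abc(2)]] field_aut_one[OF L aut[OF abc(3)]]
    field_aut_zero[OF L pow_aut[OF abc(1)]] field_aut_zero[OF L pow_aut[OF abc(2)]]
    field_aut_one[OF L pow_aut[OF abc(1)]] field_aut_one[OF L pow_aut[OF abc(2)]]
  obtain x1 where x1: "x1 \<in> L" "a x1 = x1 + 1" "b x1 = x1" "c x1 = x1"
    using solve[of 1 0 0] of_nat_p by (auto simp: zero_one subfield_closed[OF L])
  obtain x2 where x2: "x2 \<in> L" "a x2 = x2" "b x2 = x2 + 1" "c x2 = x2"
    using solve[of 0 1 0] of_nat_p by (auto simp: zero_one subfield_closed[OF L])
  note act_simps = field_aut_add[OF L] field_aut_uminus[OF L] field_aut_diff[OF L] field_aut_mult[OF L]
    field_aut_carry[OF L] field_aut_one[OF L] field_aut_of_nat[OF L] subfield_closed[OF L] subfield_carry[OF L]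
  define d1 d2 where "d1 = - x2 + of_nat e * carry p x1 1" and "d2 = of_nat f * carry p x2 1"
  have d_mem: "d1 \<in> L" "d2 \<in> L" using x1 x2 by (simp_all add: d1_def d2_def act_simps)
  have d_act: "a d2 = d2" "b d1 = d1 - 1" "c d1 = d1" "c d2 = d2"
    using x1 x2 by (simp_all add: d1_def d2_def act_simps aut abc)
  have a_d1: "(a [^]\<^bsub>Gal L K\<^esub> i) d1 = - x2 + of_nat e * carry p (x1 + of_nat i) 1" for i :: nat
    using Gal_pow_translation[OF L KL abc(1) x1(1), of 1 i] Gal_pow_translation[OF L KL abc(1) x2(1), of 0 i] x1 x2
    by (simp add: d1_def act_simps pow_aut abc)
  have b_d2: "(b [^]\<^bsub>Gal L K\<^esub> i) d2 = of_nat f * carry p (x2 + of_nat i) 1" for i :: nat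
    using Gal_pow_translation[OF L KL abc(2) x2(1), of 1 i] x2
    by (simp add: d2_def act_simps pow_aut abc)
  have "(\<Sum>i<p. (a [^]\<^bsub>Gal L K\<^esub> i) d1) = of_nat (e * 1)" "(\<Sum>i<p. (b [^]\<^bsub>Gal L K\<^esub> i) d2) = of_nat (f * 1)"
    using of_nat_p
    by (simp_all add: a_d1 b_d2 sum_subtractf sum.distrib sum_carry_translates[OF p char] flip: sum_distrib_left)
  then obtain x3 where x3: "x3 \<in> L" "a x3 = x3 + d1" "b x3 = x3 + d2" "c x3 = x3 + 1"
    using solve[OF d_mem, of 1] d_act by auto
  define \<kappa>1 \<kappa>2 where "\<kappa>1 = wp p x1" and "\<kappa>2 = wp p x2"
  have wp_L: "wp p x \<in> L" if "x \<in> L" for x using that by (simp add: wp_def subfield_closed[OF L])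
  have wp1: "wp p (1::'a) = 0" using wp_of_nat[OF p char, of 1] by simp
  note wp_simps = wp_add[OF p char] wp_diff[OF p char] wp_uminus[OF p char] wp1
  have wp_aut: "s (wp p x) = wp p (s x)" if "s \<in> carrier (Gal L K)" "x \<in> L" for s x
    using field_aut_wp[OF L aut[OF that(1)] that(2)] .
  have \<kappa>: "\<kappa>1 \<in> K" "\<kappa>2 \<in> K"
    unfolding \<kappa>1_def \<kappa>2_def
    using x1 x2 by (auto intro!: in_K simp: wp_L wp_aut abc wp_simps)
  define R where "R = - \<kappa>2 * x1 + of_nat e * carry p x1 \<kappa>1 + of_nat f * carry p x2 \<kappa>2"
  have \<kappa>_L: "\<kappa>1 \<in> L" "\<kappa>2 \<in> L" using \<kappa> KL by auto
  have R_L: "R \<in> L" using x1 x2 \<kappa>_L by (simp add: R_def subfield_closed[OF L] subfield_carry[OF L])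
  have R_aut: "s R = - \<kappa>2 * s x1 + of_nat e * carry p (s x1) \<kappa>1 + of_nat f * carry p (s x2) \<kappa>2"
    if "s \<in> carrier (Gal L K)" for s
    using x1 x2 \<kappa>_L \<kappa> by (simp add: R_def act_simps aut[OF that] fixes_K[OF that])
  have wp_d: "wp p d1 = - \<kappa>2 + of_nat e * (carry p (x1 + 1) \<kappa>1 - carry p x1 \<kappa>1)"
    "wp p d2 = of_nat f * (carry p (x2 + 1) \<kappa>2 - carry p x2 \<kappa>2)"
    by (simp_all add: d1_def d2_def wp_simps wp_of_nat_mult[OF p char] wp_carry_1[OF p char] \<kappa>1_def \<kappa>2_def)
  have \<kappa>3: "wp p x3 - R \<in> K"
  proof (rule in_K)
    show "wp p x3 - R \<in> L" using R_L x3 wp_L by (simp add: subfield_closed[OF L])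
    have diff: "s (wp p x3 - R) = wp p (s x3) - s R" if "s \<in> carrier (Gal L K)" for s
      using that x3 R_L by (simp add: field_aut_diff[OF L aut] wp_L wp_aut)
    show "a (wp p x3 - R) = wp p x3 - R" "b (wp p x3 - R) = wp p x3 - R" "c (wp p x3 - R) = wp p x3 - R"
      unfolding diff[OF abc(1)] diff[OF abc(2)] diff[OF abc(3)] R_aut[OF abc(1)] R_aut[OF abc(2)] R_aut[OF abc(3)]
      by (simp_all add: x1 x2 x3 wp_simps wp_d R_def algebra_simps)
  qed
  have "independent_cosets p K \<kappa>1 \<kappa>2"
    unfolding independent_cosets_def
  proof (intro ballI impI)
    fix m n :: 'a assume "m \<in> range of_int" "n \<in> range of_int" and comb: "m * \<kappa>1 + n * \<kappa>2 \<in> wp p ` K"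
    then obtain i j y where ij: "m = of_int i" "n = of_int j" and y: "y \<in> K" "m * \<kappa>1 + n * \<kappa>2 = wp p y" by auto
    define D where "D = of_int i * x1 + of_int j * x2 - y"
    have "wp p D = 0" using y by (simp add: D_def wp_simps wp_of_int_mult[OF p char] \<kappa>1_def \<kappa>2_def ij)
    then obtain l where "D = of_nat l" using wp_eq_0_imp_of_nat[OF p char] by blast
    then have fixed: "s D = D" if "s \<in> carrier (Gal L K)" for s
      using field_aut_of_nat[OF L aut[OF that]] by simp
    have "s D = of_int i * s x1 + of_int j * s x2 - y" if "s \<in> carrier (Gal L K)" for s
      using x1 x2 y KL
      by (simp add: D_def act_simps field_aut_of_int[OF L] aut[OF that] fixes_K[OF that] subsetD)
    from this[OF abc(1)] this[OF abc(2)] fixed[OF abc(1)] fixed[OF abc(2)]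
    show "m = 0 \<and> n = 0" by (simp add: x1 x2 D_def ij algebra_simps)
  qed
  moreover have "adjoin K {x1, x2, x3} = L"
  proof (rule galois_descent[OF adjoin_subfield adjoin_superset(1)])
    let ?M = "adjoin K {x1, x2, x3}"
    note M = adjoin_subfield[of K "{x1, x2, x3}"]
    show "?M \<subseteq> L" using x1 x2 x3 KL by (intro adjoin_least[OF L]) auto
    have x_M: "x1 \<in> ?M" "x2 \<in> ?M" "x3 \<in> ?M" using adjoin_superset(2)[of "{x1, x2, x3}" K] by auto
    fix s assume s: "s \<in> carrier (Gal L K)" "s \<noteq> \<one>\<^bsub>Gal L K\<^esub>"
    obtain i j k where ijk: "i < p" "j < p" "k < p"
      and form: "s = a [^]\<^bsub>Gal L K\<^esub> i \<otimes>\<^bsub>Gal L K\<^esub> b [^]\<^bsub>Gal L K\<^esub> j \<otimes>\<^bsub>Gal L K\<^esub> c [^]\<^bsub>Gal L K\<^esub> k"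
      using normal_form[OF s(1)] by blast
    note act = normal_form_action[OF L KL abc x1(1) x2(1) x3(1) x1(2) x2(2) x1(3) x2(3) x1(4) x2(4) x3(4)]
    have moved: "\<exists>m\<in>?M. s m \<in> ?M \<and> s m \<noteq> m" if "x \<in> ?M" "s x = x + of_nat n" "0 < n" "n < p" for x n
    proof -
      have "of_nat n \<noteq> (0::'a)"
        using that(3,4) by (auto simp: of_nat_eq_0_iff_char_dvd char dest: dvd_imp_le)
      then show ?thesis using that(1,2) by (intro bexI[of _ x]) (auto simp: subfield_closed[OF M])
    qed
    consider "i > 0" | "j > 0" | "i = 0" "j = 0" "k > 0" | "i = 0" "j = 0" "k = 0" by linarith
    then show "\<exists>m\<in>?M. s m \<in> ?M \<and> s m \<noteq> m"
    proof cases
      case 1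
      then show ?thesis using moved[OF x_M(1)] act(1)[of i j k] ijk form by blast
    next
      case 2
      then show ?thesis using moved[OF x_M(2)] act(2)[of i j k] ijk form by blast
    next
      case 3
      then show ?thesis using moved[OF x_M(3)] act(3)[of k] ijk form by blast
    next
      case 4
      then show ?thesis using s(2) form by simp
    qed
  qed
  ultimately have "artin_schreier_data G p L K \<kappa>1 \<kappa>2 (wp p x3 - R) x1 x2 x3"
    using \<kappa> \<kappa>3
    by (auto simp: artin_schreier_data_def frak_s_eq[OF p char kind] R_def e_def f_def \<kappa>1_def \<kappa>2_def wp_def)
  then show ?thesis by blast
qed

section \<open>The characterisation\<close>

theorem theorem1p2:
  fixes K L :: "'a::field set" and p :: nat and G :: group_kind
  assumes "prime p" and "CHAR('a) = p"
    and "subfield K ring_of_type_algebra"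
    and "subfield L ring_of_type_algebra"
    and "K \<subseteq> L"
    and "kind_allowed G p"
  shows "(galois_extension L K \<and> Gal L K \<cong> group_p3 G p \<longleftrightarrow>
           (\<exists>\<kappa>1 \<kappa>2 \<kappa>3 x1 x2 x3. artin_schreier_data G p L K \<kappa>1 \<kappa>2 \<kappa>3 x1 x2 x3))
       \<and> (\<forall>\<kappa>1 \<kappa>2 \<kappa>3 x1 x2 x3. artin_schreier_data G p L K \<kappa>1 \<kappa>2 \<kappa>3 x1 x2 x3 \<longrightarrow>
           (\<exists>\<sigma>1\<in>carrier (Gal L K). \<exists>\<sigma>2\<in>carrier (Gal L K). \<exists>\<sigma>3\<in>carrier (Gal L K).
              artin_schreier_action G p x1 x2 x3 \<sigma>1 \<sigma>2 \<sigma>3 \<and>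
              (\<forall>\<tau>1\<in>carrier (Gal L K). \<forall>\<tau>2\<in>carrier (Gal L K). \<forall>\<tau>3\<in>carrier (Gal L K).
                 artin_schreier_action G p x1 x2 x3 \<tau>1 \<tau>2 \<tau>3 \<longrightarrow>
                 \<tau>1 = \<sigma>1 \<and> \<tau>2 = \<sigma>2 \<and> \<tau>3 = \<sigma>3) \<and>
              carrier (Gal L K) = generate (Gal L K) {\<sigma>1, \<sigma>2, \<sigma>3} \<and>
              \<sigma>3 = commutator (Gal L K) \<sigma>1 \<sigma>2 \<and>
              (\<exists>\<phi>\<in>iso (group_p3 G p) (Gal L K).
                 \<phi> (group_p3_gen G p Gen1) = \<sigma>1 \<and> \<phi> (group_p3_gen G p Gen2) = \<sigma>2)))"
proof (intro conjI allI impI iffI)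
  assume "galois_extension L K \<and> Gal L K \<cong> group_p3 G p"
  then show "\<exists>\<kappa>1 \<kappa>2 \<kappa>3 x1 x2 x3. artin_schreier_data G p L K \<kappa>1 \<kappa>2 \<kappa>3 x1 x2 x3"
    using galois_imp_artin_schreier_data[OF assms(1,2,6)] by blast
next
  assume "\<exists>\<kappa>1 \<kappa>2 \<kappa>3 x1 x2 x3. artin_schreier_data G p L K \<kappa>1 \<kappa>2 \<kappa>3 x1 x2 x3"
  then obtain \<kappa>1 \<kappa>2 \<kappa>3 x1 x2 x3 where data: "artin_schreier_data G p L K \<kappa>1 \<kappa>2 \<kappa>3 x1 x2 x3" by blast
  note forward = artin_schreier_data_imp_galois[OF assms(1,2,3,6) data]
  show "galois_extension L K" by (rule forward(1))
  have "group_p3 G p \<cong> Gal L K" using forward(2) by (auto intro: is_isoI)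
  then show "Gal L K \<cong> group_p3 G p" by (rule group.iso_sym[OF group_group_p3])
next
  fix \<kappa>1 \<kappa>2 \<kappa>3 x1 x2 x3
  assume "artin_schreier_data G p L K \<kappa>1 \<kappa>2 \<kappa>3 x1 x2 x3"
  then show "\<exists>\<sigma>1\<in>carrier (Gal L K). \<exists>\<sigma>2\<in>carrier (Gal L K). \<exists>\<sigma>3\<in>carrier (Gal L K).
      artin_schreier_action G p x1 x2 x3 \<sigma>1 \<sigma>2 \<sigma>3 \<and>
      (\<forall>\<tau>1\<in>carrier (Gal L K). \<forall>\<tau>2\<in>carrier (Gal L K). \<forall>\<tau>3\<in>carrier (Gal L K).
         artin_schreier_action G p x1 x2 x3 \<tau>1 \<tau>2 \<tau>3 \<longrightarrow>
         \<tau>1 = \<sigma>1 \<and> \<tau>2 = \<sigma>2 \<and> \<tau>3 = \<sigma>3) \<and>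
      carrier (Gal L K) = generate (Gal L K) {\<sigma>1, \<sigma>2, \<sigma>3} \<and>
      \<sigma>3 = commutator (Gal L K) \<sigma>1 \<sigma>2 \<and>
      (\<exists>\<phi>\<in>iso (group_p3 G p) (Gal L K).
         \<phi> (group_p3_gen G p Gen1) = \<sigma>1 \<and> \<phi> (group_p3_gen G p Gen2) = \<sigma>2)"
    by (rule artin_schreier_data_imp_galois(2)[OF assms(1,2,3,6)])
qed

end
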